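(* Let $p>1$ and $b>0$. Let $\Omega\subset\mathbb{R}^N$ be a bounded domain and let $f\in C(\Omega)\cap L^\infty(\Omega)$ be nonnegative in $\Omega$. Suppose that there are $Y\subset\mathbb{R}^N$ and $R>0$ such that $$\Omega=\bigcap_{y\in Y}B_R(y),\qquad R\le\bar R:=\frac{(p-1)^{\frac{p-1}{p}}}{p\,b^{\frac1p}\,\|f\|_\infty^{\frac{p-1}{p}}},$$ where $\bar R=+\infty$ if $f\equiv0$. Then there exists a unique convex viscosity solution $u\in C(\overline\Omega)$ of $$\left(\det(D^2u)\right)^{\frac1N}=f(x)+b|Du|^p\ \text{ in }\Omega,\qquad u=0\ \text{ on }\partial\Omega.$$
   Context: $B_R(y)$ is the open ball of radius $R$ and center $y$; $\|\cdot\|_\infty$ is the sup norm on $\Omega$. The Monge–Ampère operator $X\mapsto(\det X)^{1/N}$ is considered only on nonnegative symmetric matrices $X\ge0$, and (sub/super)solutions are sought in the class of convex functions. A convex function $u$ in $\Omega$ is a viscosity subsolution of the equation if, whenever $x_0\in\Omega$, $\psi\in C^2(\Omega)$ and $u-\psi$ has a local maximum at $x_0$ (so that $D^2\psi(x_0)\ge0$), one has $(\det D^2\psi(x_0))^{1/N}\ge f(x_0)+b|D\psi(x_0)|^p$. It is a viscosity supersolution if, whenever $x_0\in\Omega$, $\psi\in C^2(\Omega)$, $u-\psi$ has a local minimum at $x_0$ and $D^2\psi(x_0)\ge0$, one has $(\det D^2\psi(x_0))^{1/N}\le f(x_0)+b|D\psi(x_0)|^p$. A solution of the Dirichlet problem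 is a convex $u\in C(\overline\Omega)$ that is both a subsolution and a supersolution and vanishes on $\partial\Omega$. *)

theory Defs
  imports "HOL-Analysis.Analysis"
begin

definition gradient :: "(real ^ 'n \<Rightarrow> real) \<Rightarrow> real ^ 'n \<Rightarrow> real ^ 'n" where
  "gradient \<psi> x = (\<chi> i. frechet_derivative \<psi> (at x) (axis i 1))"

definition hessian :: "(real ^ 'n \<Rightarrow> real) \<Rightarrow> real ^ 'n \<Rightarrow> real ^ 'n ^ 'n" where
  "hessian \<psi> x = jacobian (gradient \<psi>) (at x)"

text \<open>The class \<open>C\<^sup>2(S)\<close>, intended for open \<open>S\<close>. Continuity of \<open>\<psi>\<close> and of its
  gradient follows from differentiability.\<close>

definition C2_on :: "(real ^ 'n) set \<Rightarrow> (real ^ 'n \<Rightarrow> real) \<Rightarrow> bool" where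
  "C2_on S \<psi> \<longleftrightarrow>
     (\<forall>x\<in>S. \<psi> differentiable (at x)) \<and>
     (\<forall>x\<in>S. gradient \<psi> differentiable (at x)) \<and>
     continuous_on S (hessian \<psi>)"

definition nonneg_matrix :: "real ^ 'n ^ 'n \<Rightarrow> bool" where
  "nonneg_matrix X \<longleftrightarrow> transpose X = X \<and> (\<forall>v. 0 \<le> v \<bullet> (X *v v))"

definition local_max_in :: "'a::topological_space set \<Rightarrow> ('a \<Rightarrow> real) \<Rightarrow> 'a \<Rightarrow> bool" where
  "local_max_in S g x \<longleftrightarrow> x \<in> S \<and> (\<forall>\<^sub>F y in at x within S. g y \<le> g x)"

definition local_min_in :: "'a::topological_space set \<Rightarrow> ('a \<Rightarrow> real) \<Rightarrow> 'a \<Rightarrow> bool" where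
  "local_min_in S g x \<longleftrightarrow> x \<in> S \<and> (\<forall>\<^sub>F y in at x within S. g x \<le> g y)"

text \<open>The operator \<open>(det X)\<close> to the power \<open>1/N\<close>. It is meant for \<open>nonneg_matrix X\<close> only,
  where the determinant is nonnegative; the value of \<^const>\<open>root\<close> at negative arguments
  is irrelevant.\<close>

definition monge_ampere :: "real ^ 'n ^ 'n \<Rightarrow> real" where
  "monge_ampere X = root CARD('n) (det X)"

text \<open>In the subsolution condition \<open>nonneg_matrix (hessian \<psi> x)\<close> need not be required: it
  follows from the convexity of \<open>u\<close> when \<open>u - \<psi>\<close> has a local maximum at \<open>x\<close>.
  In the supersolution condition it is a genuine restriction on the test functions.\<close>

definition viscosity_subsolution ::
  "real \<Rightarrow> real \<Rightarrow> (real ^ 'n \<Rightarrow> real) \<Rightarrow> (real ^ 'n) set \<Rightarrow> (real ^ 'n \<Rightarrow> real) \<Rightarrow> bool" where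
  "viscosity_subsolution b p f \<Omega> u \<longleftrightarrow>
     convex_on \<Omega> u \<and>
     (\<forall>x\<in>\<Omega>. \<forall>\<psi>. C2_on \<Omega> \<psi> \<and> local_max_in \<Omega> (\<lambda>y. u y - \<psi> y) x \<longrightarrow>
        monge_ampere (hessian \<psi> x) \<ge> f x + b * norm (gradient \<psi> x) powr p)"

definition viscosity_supersolution ::
  "real \<Rightarrow> real \<Rightarrow> (real ^ 'n \<Rightarrow> real) \<Rightarrow> (real ^ 'n) set \<Rightarrow> (real ^ 'n \<Rightarrow> real) \<Rightarrow> bool" where
  "viscosity_supersolution b p f \<Omega> u \<longleftrightarrow>
     convex_on \<Omega> u \<and>
     (\<forall>x\<in>\<Omega>. \<forall>\<psi>. C2_on \<Omega> \<psi> \<and> local_min_in \<Omega> (\<lambda>y. u y - \<psi> y) x \<and>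
        nonneg_matrix (hessian \<psi> x) \<longrightarrow>
        monge_ampere (hessian \<psi> x) \<le> f x + b * norm (gradient \<psi> x) powr p)"

definition dirichlet_solution ::
  "real \<Rightarrow> real \<Rightarrow> (real ^ 'n \<Rightarrow> real) \<Rightarrow> (real ^ 'n) set \<Rightarrow> (real ^ 'n \<Rightarrow> real) \<Rightarrow> bool" where
  "dirichlet_solution b p f \<Omega> u \<longleftrightarrow>
     continuous_on (closure \<Omega>) u \<and>
     viscosity_subsolution b p f \<Omega> u \<and>
     viscosity_supersolution b p f \<Omega> u \<and>
     (\<forall>x\<in>frontier \<Omega>. u x = 0)"

text \<open>Meaningful for nonempty \<open>S\<close> and \<open>f\<close> bounded on \<open>S\<close>; for continuous \<open>f\<close> and open \<open>S\<close>
  it coincides with the essential supremum of \<open>\<bar>f\<bar>\<close>.\<close>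

definition sup_norm_on :: "'a set \<Rightarrow> ('a \<Rightarrow> real) \<Rightarrow> real" where
  "sup_norm_on S f = (SUP x\<in>S. \<bar>f x\<bar>)"

definition critical_radius :: "real \<Rightarrow> real \<Rightarrow> real \<Rightarrow> ereal" where
  "critical_radius p b M =
     (if M = 0 then \<infinity>
      else ereal ((p - 1) powr ((p - 1) / p) / (p * b powr (1 / p) * M powr ((p - 1) / p))))"

end

theory Submission
  imports Defs
begin

text \<open>
  Uniqueness. The operator \<open>F(X) = (det X)\<close> to the power \<open>1/N\<close> is an infimum of linear functionals:
  \<open>N F(X) / F(H) \<le> tr (H\<inverse> X)\<close> for positive definite \<open>H\<close>, with equality at \<open>X = H\<close>; likewise
  \<open>|q|\<close> to the power \<open>p\<close> is a supremum of affine functions. So a convex viscosity subsolution \<open>u\<close>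
  satisfies \<open>tr (H\<inverse> D\<^sup>2 u) - \<beta> \<bullet> D u \<ge> g\<close> in the viscosity sense for all \<open>H\<close> and matching \<open>\<beta>\<close>,
  \<open>g\<close>. Comparing \<open>u\<close> with its own evolution under the heat flow of this constant-coefficient operator,
  which is a smooth test function and starts above \<open>u\<close> by convexity, gives a mean value inequality. That
  inequality survives averaging, so mollifications of \<open>u\<close> are classical subsolutions up to a small error.
  A smooth strict subsolution cannot touch a supersolution from below; strictness comes from a convex
  combination of \<open>u\<close> with a paraboloid \<open>s (|x - y|\<^sup>2 - R\<^sup>2) / 2\<close>, \<open>y \<in> Y\<close>, a subsolution that
  exists exactly because \<open>R\<close> does not exceed the critical radius. Neither the theorem of Alexandrov
  nor that of Jensen and Ishii is needed.

  Existence. The supremum of all nonpositive subsolutions is convex, hence continuous inside; the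
  paraboloids are barriers at every boundary point, and a bump argument shows that the supremum is a
  supersolution.
\<close>

section \<open>Symmetric matrices and the Monge--Ampere operator\<close>

text \<open>The obstacle is that comparison wants a smooth function where only a convex viscosity
  subsolution is at hand, and mollification does not commute with a nonlinear operator. It does so
  up to an inequality, because \<open>F(X) - b |q|^p\<close> is an infimum of affine functions of
  \<open>(X, q)\<close>: each affine inequality survives averaging, and at the point of interest one
  picks the affine function that is exact at the Hessian and gradient of the mollification itself.
  The heat flow translates the viscosity inequality, which speaks only of test functions, into an
  inequality between values of \<open>u\<close>, which can be averaged. Degeneracy is met by adding
  a small multiple of the identity to the Hessian and removing it by continuity of the determinant.
  At the critical radius the strictness of the paraboloid may be lost on the sphere of radius
  \<open>R\<close>, but it persists inside. Comparison therefore takes place on a compact subset of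
  the domain, where the gap has a positive minimum that absorbs the oscillation of the right-hand
  side over the mollification radius.\<close>

lemma first_order_max_sphere:
  fixes A :: "real^'n^'n"
  assumes sym: "transpose A = A" and v: "norm v = 1" and S: "subspace S" "v \<in> S"
    and mx: "\<And>x. x \<in> S \<Longrightarrow> norm x = 1 \<Longrightarrow> x \<bullet> (A *v x) \<le> v \<bullet> (A *v v)"
    and w: "w \<in> S" "w \<bullet> v = 0"
  shows "w \<bullet> (A *v v) = 0"
proof (rule ccontr)
  let ?c = "v \<bullet> (A *v v)"
  assume ne: "w \<bullet> (A *v v) \<noteq> 0"
  define a where "a = w \<bullet> (A *v v)"
  have sw: "v \<bullet> (A *v w) = a"
    unfolding a_def by (metis dot_lmul_matrix inner_commute sym transpose_matrix_vector)
  \<comment> \<open>Homogeneity extends the bound from the unit sphere to all of \<open>S\<close>,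
    so that the competitors \<open>v + t *\<^sub>R w\<close> can be inserted without
    normalisation.\<close>
  have hom: "x \<bullet> (A *v x) \<le> ?c * (x \<bullet> x)" if "x \<in> S" for x
  proof (cases "x = 0")
    case False
    have "(inverse (norm x) *\<^sub>R x) \<bullet> (A *v (inverse (norm x) *\<^sub>R x)) \<le> ?c"
      using False that S by (intro mx) (auto simp: subspace_scale)
    then have "inverse (norm x)^2 * (x \<bullet> (A *v x)) \<le> ?c"
      by (simp add: matrix_vector_mult_scaleR power2_eq_square algebra_simps)
    then show ?thesis using False
      by (simp add: power_inverse divide_simps dot_square_norm)
  qed simp
  have key: "2 * t * a + t^2 * (w \<bullet> (A *v w)) \<le> ?c * t^2 * (w \<bullet> w)" for t
  proof -
    have "(v + t *\<^sub>R w) \<bullet> (A *v (v + t *\<^sub>R w)) \<le> ?c * ((v + t *\<^sub>R w) \<bullet> (v + t *\<^sub>R w))"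
      using S w by (intro hom) (auto simp: subspace_scale subspace_add)
    moreover have "v \<bullet> v = 1" using v by (simp add: dot_square_norm)
    moreover have "v \<bullet> w = 0" using w by (simp add: inner_commute)
    ultimately show ?thesis using w sw
      by (simp add: matrix_vector_right_distrib matrix_vector_mult_scaleR inner_add_left inner_add_right
          a_def[symmetric] power2_eq_square algebra_simps)
  qed
  define K where "K = \<bar>?c * (w \<bullet> w) - w \<bullet> (A *v w)\<bar> + 1"
  have K: "K > 0" "?c * (w \<bullet> w) - w \<bullet> (A *v w) < K" by (auto simp: K_def)
  \<comment> \<open>\<open>K\<close> exceeds the coefficient of the quadratic term, so at
    \<open>t = a/K\<close> the linear term wins: \<open>2 * a^2 / K \<le> a^2 / K\<close> forces
    \<open>a = 0\<close>.\<close>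
  have "2 * (a/K) * a \<le> (a/K)^2 * (?c * (w \<bullet> w) - w \<bullet> (A *v w))"
    using key[of "a/K"] by (simp add: algebra_simps)
  also have "\<dots> \<le> (a/K)^2 * K" using K by (intro mult_left_mono) auto
  also have "\<dots> = (a/K) * a" using K by (simp add: power2_eq_square field_simps)
  finally have "a * a \<le> 0" using K by (simp add: divide_simps)
  then show False using ne a_def by (metis mult_eq_0_iff not_square_less_zero order_le_less)
qed

text \<open>A maximiser of the quadratic form on the unit sphere of \<open>S\<close> is an
  eigenvector, and by symmetry its orthogonal complement in \<open>S\<close> is again invariant with
  dimension one less.\<close>

lemma symmetric_eigenbasis_subspace:
  fixes A :: "real^'n^'n"
  assumes sym: "transpose A = A"
  shows "subspace S \<Longrightarrow> (\<And>x. x \<in> S \<Longrightarrow> A *v x \<in> S) \<Longrightarrow> dim S = k \<Longrightarrow>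
    \<exists>B. B \<subseteq> S \<and> card B = k \<and> finite B \<and> pairwise orthogonal B \<and>
      (\<forall>x\<in>B. norm x = 1 \<and> (\<exists>c. A *v x = c *\<^sub>R x))"
proof (induction k arbitrary: S)
  case 0
  then show ?case by (intro exI[of _ "{}"]) auto
next
  case (Suc k)
  note S = Suc.prems(1)
  let ?K = "S \<inter> sphere 0 1"
  have comp: "compact ?K"
    by (intro closed_Int_compact closed_subspace S compact_sphere)
  obtain x where x: "x \<in> S" "x \<noteq> 0"
    using Suc.prems(3) S by (metis dim_eq_0 nat.distinct(1) subsetI singleton_iff)
  then have "inverse (norm x) *\<^sub>R x \<in> ?K" using S by (auto simp: subspace_scale)
  then have ne: "?K \<noteq> {}" by blast
  have "continuous_on ?K (\<lambda>x. x \<bullet> (A *v x))" by (intro continuous_intros)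
  from continuous_attains_sup[OF comp ne this] obtain v where
    v: "v \<in> S" "norm v = 1" and mx: "\<And>x. x \<in> S \<Longrightarrow> norm x = 1 \<Longrightarrow> x \<bullet> (A *v x) \<le> v \<bullet> (A *v v)"
    by auto
  have vv: "v \<bullet> v = 1" using v by (simp add: dot_square_norm)
  have orth: "w \<bullet> (A *v v) = 0" if "w \<in> S" "w \<bullet> v = 0" for w
    by (rule first_order_max_sphere[OF sym v(2) S v(1) mx that])
  define c where "c = v \<bullet> (A *v v)"
  have eig: "A *v v = c *\<^sub>R v"
  proof -
    \<comment> \<open>The residual \<open>z\<close> is itself an admissible direction orthogonal to
      \<open>v\<close>, so the first-order condition makes it orthogonal to itself.\<close>
    define z where "z = A *v v - c *\<^sub>R v"
    have zS: "z \<in> S" unfolding z_def using S v Suc.prems(2) by (auto simp: subspace_diff subspace_scale)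
    have zv: "z \<bullet> v = 0" unfolding z_def c_def using vv
      by (simp add: inner_diff_left inner_commute[of "A *v v" v])
    have "z \<bullet> z = z \<bullet> (A *v v) - c * (z \<bullet> v)" by (simp add: z_def inner_diff_right)
    also have "\<dots> = 0" using orth[OF zS zv] zv by simp
    finally show ?thesis by (simp add: z_def)
  qed
  define S' where "S' = S \<inter> {w. v \<bullet> w = 0}"
  have S': "subspace S'" unfolding S'_def by (intro subspace_inter S subspace_hyperplane)
  have inv: "A *v w \<in> S'" if "w \<in> S'" for w
  proof -
    have "v \<bullet> (A *v w) = w \<bullet> (A *v v)"
      by (metis dot_lmul_matrix inner_commute sym transpose_matrix_vector)
    also have "\<dots> = c * (v \<bullet> w)" by (simp add: eig inner_commute)
    finally show ?thesis using that Suc.prems(2) by (auto simp: S'_def)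
  qed
  have Seq: "S = span (insert v S')"
  proof
    show "S \<subseteq> span (insert v S')"
    proof
      fix x assume x: "x \<in> S"
      have "x - (v \<bullet> x) *\<^sub>R v \<in> S'" using x v vv S
        by (auto simp: S'_def subspace_diff subspace_scale inner_diff_right)
      then have "x - (v \<bullet> x) *\<^sub>R v \<in> span S'" by (simp add: span_base)
      then show "x \<in> span (insert v S')" by (auto simp: span_insert)
    qed
    show "span (insert v S') \<subseteq> S" using S v by (intro span_minimal) (auto simp: S'_def)
  qed
  have "v \<notin> span S'"
    using S' vv by (metis (mono_tags, lifting) IntD2 S'_def mem_Collect_eq span_eq_iff zero_neq_one)
  then have "dim (insert v S') = Suc (dim S')" by (simp add: dim_insert)
  then have "dim S' = k" using Suc.prems(3) Seq by (metis dim_span old.nat.inject)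
  from Suc.IH[OF S' inv this] obtain B where B: "B \<subseteq> S'" "card B = k" "finite B"
    "pairwise orthogonal B" "\<forall>x\<in>B. norm x = 1 \<and> (\<exists>c. A *v x = c *\<^sub>R x)" by blast
  have "v \<notin> B" using B(1) \<open>v \<notin> span S'\<close> span_base by blast
  then show ?case using B v eig
    by (intro exI[of _ "insert v B"])
       (auto simp: S'_def pairwise_insert orthogonal_def[of v] orthogonal_commute[of _ v])
qed

lemma symmetric_diagonalization:
  fixes A :: "real^'n^'n"
  assumes sym: "transpose A = A"
  obtains P d where "orthogonal_matrix P" "A = P ** (\<chi> i j. if i = j then d i else 0) ** transpose P"
proof -
  obtain B where B: "card B = CARD('n)" "finite B"
    "pairwise orthogonal B" "\<forall>x\<in>B. norm x = 1 \<and> (\<exists>c. A *v x = c *\<^sub>R x)"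
    using symmetric_eigenbasis_subspace[OF sym subspace_UNIV, of "CARD('n)"] by (auto simp: dim_UNIV)
  then obtain f where f: "bij_betw f (UNIV::'n set) B"
    using finite_same_card_bij[of "UNIV::'n set" B] by auto
  have fB: "f i \<in> B" for i using f by (auto simp: bij_betw_def)
  then have "\<forall>i. \<exists>c. A *v f i = c *\<^sub>R f i" using B(4) by blast
  then obtain d where d: "\<And>i. A *v f i = d i *\<^sub>R f i" by metis
  have on: "f i \<bullet> f j = (if i = j then 1 else 0)" for i j
  proof (cases "i = j")
    case True
    then show ?thesis using B(4) f by (metis UNIV_I bij_betwE dot_square_norm one_power2)
  next
    case False
    then have "f i \<noteq> f j" using f by (metis UNIV_I bij_betw_iff_bijections)
    then show ?thesis using B(3) f False by (metis UNIV_I bij_betwE orthogonal_def pairwiseD)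
  qed
  define P where "P = (\<chi> i j. f j $ i)"
  let ?D = "\<chi> i j. if i = j then d i else 0"
  have PtP: "transpose P ** P = mat 1"
    by (simp add: vec_eq_iff matrix_matrix_mult_def transpose_def P_def mat_def on[unfolded inner_vec_def, simplified])
  then have P: "orthogonal_matrix P" by (simp add: orthogonal_matrix)
  have "(A ** P) $ i $ j = (P ** ?D) $ i $ j" for i j
  proof -
    have "(A ** P) $ i $ j = (A *v f j) $ i"
      by (simp add: matrix_matrix_mult_def matrix_vector_mult_def P_def)
    also have "\<dots> = d j * f j $ i" by (simp add: d)
    also have "\<dots> = (P ** ?D) $ i $ j"
      by (simp add: matrix_matrix_mult_def P_def if_distrib[of "\<lambda>x. _ * x"] mult.commute cong: if_cong)
    finally show ?thesis .
  qed
  then have AP: "A ** P = P ** ?D" by (simp add: vec_eq_iff)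
  have "A = A ** (P ** transpose P)" using P by (simp add: orthogonal_matrix_def)
  also have "\<dots> = P ** ?D ** transpose P" by (metis AP matrix_mul_assoc)
  finally show ?thesis using P that by blast
qed

section \<open>Positive definite matrices, inverses and the linear bounds for the
  determinant\<close>

definition posdef_matrix :: "real^'n^'n \<Rightarrow> bool" where
  "posdef_matrix H \<longleftrightarrow> transpose H = H \<and> (\<forall>v. v \<noteq> 0 \<longrightarrow> 0 < v \<bullet> (H *v v))"

lemma posdef_imp_nonneg: "posdef_matrix H \<Longrightarrow> nonneg_matrix H"
  unfolding posdef_matrix_def nonneg_matrix_def
  by (metis inner_zero_left less_eq_real_def)

lemma quadratic_form_congruence:
  fixes A B :: "real^'n^'n"
  shows "v \<bullet> ((transpose B ** A ** B) *v v) = (B *v v) \<bullet> (A *v (B *v v))"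
  by (metis dot_lmul_matrix matrix_vector_mul_assoc transpose_matrix_vector transpose_transpose)

lemma nonneg_matrix_congruence:
  fixes A B :: "real^'n^'n"
  assumes "nonneg_matrix A" shows "nonneg_matrix (transpose B ** A ** B)"
  using assms unfolding nonneg_matrix_def quadratic_form_congruence
  by (auto simp: matrix_transpose_mul matrix_mul_assoc)

lemma quadratic_form_diag:
  "axis i 1 \<bullet> ((A::real^'n^'n) *v axis i 1) = A $ i $ i"
  by (simp add: inner_axis' matrix_vector_mul_component inner_axis)

lemma diag_conjugate:
  fixes P :: "real^'n^'n"
  assumes "orthogonal_matrix P" "A = P ** (\<chi> i j. if i = j then d i else 0) ** transpose P"
  shows "transpose P ** A ** P = (\<chi> i j. if i = j then d i else 0)"
proof -
  let ?D = "\<chi> i j. if i = j then d i else 0"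
  have "transpose P ** A ** P = (transpose P ** P) ** ?D ** (transpose P ** P)"
    unfolding assms(2) by (simp only: matrix_mul_assoc)
  then show ?thesis using assms(1) by (simp add: orthogonal_matrix_def)
qed

lemma det_diag: "det (\<chi> i j. if i = j then d i else 0 :: real^'n^'n) = prod d (UNIV::'n set)"
  by (subst det_diagonal) auto

lemma det_orthogonal_conjugate:
  fixes P :: "real^'n^'n"
  assumes "orthogonal_matrix P"
  shows "det (P ** D ** transpose P) = det D"
proof -
  have "det P * det P = 1"
    using assms det_mul[of P "transpose P"] by (simp add: orthogonal_matrix_def)
  then show ?thesis by (simp add: det_mul algebra_simps)
qed

lemma nonneg_matrix_diag_nonneg: "nonneg_matrix A \<Longrightarrow> 0 \<le> A $ i $ i"
  unfolding nonneg_matrix_def by (metis quadratic_form_diag)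

text \<open>The arithmetic-geometric mean inequality for the eigenvalues. The linear bounds and the
  superadditivity of \<open>monge_ampere\<close> descend from it by congruence.\<close>

lemma det_le_trace_power:
  fixes A :: "real^'n^'n"
  assumes A: "nonneg_matrix A"
  shows "0 \<le> det A" "root CARD('n) (det A) \<le> trace A / CARD('n)" "0 \<le> trace A"
proof -
  obtain P d where P: "orthogonal_matrix P" and
    Ad: "A = P ** (\<chi> i j. if i = j then d i else 0) ** transpose P"
    using symmetric_diagonalization[of A] A unfolding nonneg_matrix_def by blast
  let ?D = "\<chi> i j. if i = j then d i else 0"
  have "nonneg_matrix ?D"
    using nonneg_matrix_congruence[OF A, of P] diag_conjugate[OF P Ad] by simp
  then have d: "0 \<le> d i" for i using nonneg_matrix_diag_nonneg[of ?D i] by simp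
  have det: "det A = prod d UNIV" unfolding Ad det_orthogonal_conjugate[OF P] by (rule det_diag)
  show "0 \<le> det A" by (simp add: det d prod_nonneg)
  have tr: "trace A = sum d UNIV"
  proof -
    have "trace A = trace (transpose P ** (P ** ?D))" unfolding Ad by (rule trace_mul_sym)
    also have "\<dots> = trace ?D" using P by (simp add: matrix_mul_assoc orthogonal_matrix_def)
    finally show ?thesis by (simp add: trace_def)
  qed
  show "0 \<le> trace A" by (simp add: tr d sum_nonneg)
  have "root CARD('n) (prod d UNIV) \<le> (\<Sum>x\<in>UNIV. d x / real CARD('n))"
    using arith_geom_mean[of "UNIV::'n set" d] d
    by (simp add: sum_divide_distrib root_powr_inverse prod_nonneg)
  then show "root CARD('n) (det A) \<le> trace A / CARD('n)"
    by (simp add: det tr sum_divide_distrib)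
qed

lemma matrix_inv_unique:
  fixes A B :: "real^'n^'n"
  assumes "A ** B = mat 1" shows "matrix_inv A = B"
proof -
  have "B ** A = mat 1" by (rule iffD1[OF matrix_left_right_inverse assms])
  with assms have "A ** B = mat 1 \<and> B ** A = mat 1" ..
  from someI[of "\<lambda>A'. A ** A' = mat 1 \<and> A' ** A = mat 1", OF this]
  have "A ** matrix_inv A = mat 1" unfolding matrix_inv_def ..
  moreover have "matrix_inv A = (B ** A) ** matrix_inv A"
    unfolding \<open>B ** A = mat 1\<close> by (simp only: matrix_mul_lid)
  ultimately show ?thesis by (simp only: matrix_mul_assoc[symmetric] matrix_mul_rid)
qed

text \<open>\<open>B\<close> is the eigenvector matrix times the inverse square root of the
  eigenvalue matrix. Factoring the inverse as \<open>B ** transpose B\<close> turns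
  \<open>trace (matrix_inv H ** X)\<close> into the trace of \<open>transpose B ** X ** B\<close>,
  which inherits nonnegativity from \<open>X\<close>.\<close>

lemma posdef_inverse_factor:
  fixes H :: "real^'n^'n"
  assumes H: "posdef_matrix H"
  obtains B where "transpose B ** H ** B = mat 1" "B ** transpose B = matrix_inv H"
    "H ** (B ** transpose B) = mat 1" "det B * det B * det H = 1"
proof -
  obtain P d where P: "orthogonal_matrix P" and
    Hd: "H = P ** (\<chi> i j. if i = j then d i else 0) ** transpose P"
    using symmetric_diagonalization[of H] H unfolding posdef_matrix_def by blast
  let ?D = "\<chi> i j. if i = j then d i else 0"
  let ?R = "(\<chi> i j. if i = j then 1 / sqrt (d i) else 0) :: real^'n^'n"
  have PtP: "transpose P ** P = mat 1" using P by (simp add: orthogonal_matrix_def)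
  have d: "0 < d i" for i
  proof -
    have "P *v axis i 1 \<noteq> 0"
    proof
      assume "P *v axis i 1 = 0"
      then have "(transpose P ** P) *v axis i 1 = 0" by (simp flip: matrix_vector_mul_assoc)
      then show False by (simp add: PtP axis_eq_0_iff)
    qed
    then have "0 < axis i 1 \<bullet> ((transpose P ** H ** P) *v axis i 1)"
      using H unfolding quadratic_form_congruence posdef_matrix_def by blast
    then show ?thesis by (simp add: diag_conjugate[OF P Hd] quadratic_form_diag)
  qed
  define B where "B = P ** ?R"
  have Rt: "transpose ?R = ?R" by (auto simp: transpose_def vec_eq_iff)
  have RDR: "?R ** ?D ** ?R = mat 1"
  proof -
    have "?R ** ?D = (\<chi> i j. if i = j then d i / sqrt (d i) else 0)"
      by (simp add: vec_eq_iff matrix_matrix_mult_def if_distrib[of "\<lambda>x. _ * x"] cong: if_cong)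
    moreover have "(\<chi> i j. if i = j then d i / sqrt (d i) else 0) ** ?R = mat 1"
      using d by (simp add: vec_eq_iff matrix_matrix_mult_def mat_def if_distrib[of "\<lambda>x. _ * x"] less_imp_le
          real_div_sqrt less_imp_neq[symmetric] cong: if_cong)
    ultimately show ?thesis by simp
  qed
  have Bt: "transpose B = ?R ** transpose P" by (simp add: B_def matrix_transpose_mul Rt)
  have "transpose B ** H ** B = ?R ** (transpose P ** H ** P) ** ?R"
    unfolding Bt unfolding B_def by (simp only: matrix_mul_assoc)
  also have "\<dots> = mat 1" unfolding diag_conjugate[OF P Hd] by (rule RDR)
  finally have BHB: "transpose B ** H ** B = mat 1" .
  have HB: "B ** (transpose B ** H) = mat 1" by (rule iffD1[OF matrix_left_right_inverse BHB])
  then have inv: "(B ** transpose B) ** H = mat 1" by (simp add: matrix_mul_assoc)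
  have inv': "H ** (B ** transpose B) = mat 1" by (rule iffD1[OF matrix_left_right_inverse inv])
  have "B ** transpose B = matrix_inv H" using matrix_inv_unique[OF inv'] by simp
  moreover have "det B * det B * det H = 1"
    using arg_cong[OF BHB, of det] by (simp add: det_mul mult.commute mult.left_commute)
  ultimately show ?thesis using BHB inv' that by blast
qed

lemma posdef_left_inverse: assumes "posdef_matrix H" shows "matrix_inv H ** H = mat 1"
proof -
  obtain B where B: "transpose B ** H ** B = mat 1" "B ** transpose B = matrix_inv H"
    "H ** (B ** transpose B) = mat 1" "det B * det B * det H = 1"
    by (rule posdef_inverse_factor[OF assms])
  show ?thesis using iffD1[OF matrix_left_right_inverse B(3)] unfolding B(2) .
qed

lemma posdef_det_pos: assumes "posdef_matrix H" shows "0 < det H"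
proof -
  obtain B where "transpose B ** H ** B = mat 1" "B ** transpose B = matrix_inv H"
    "H ** (B ** transpose B) = mat 1" "det B * det B * det H = 1"
    by (rule posdef_inverse_factor[OF assms])
  then have "0 < (det B)^2 * det H" by (simp add: power2_eq_square)
  then show ?thesis by (simp add: zero_less_mult_iff)
qed

lemma monge_ampere_nonneg: "nonneg_matrix A \<Longrightarrow> 0 \<le> monge_ampere A"
  unfolding monge_ampere_def by (simp add: det_le_trace_power(1))

lemma monge_ampere_pos: "posdef_matrix A \<Longrightarrow> 0 < monge_ampere A"
  unfolding monge_ampere_def by (simp add: posdef_det_pos)

text \<open>The arithmetic-geometric mean inequality for \<open>transpose B ** X ** B\<close>, whose
  determinant is \<open>det X / det H\<close>. With \<open>trace_inverse_self\<close> it exhibits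
  \<open>monge_ampere\<close> as an infimum of linear functionals on nonnegative matrices.\<close>

lemma trace_inverse_ge:
  fixes H X :: "real^'n^'n"
  assumes H: "posdef_matrix H" and X: "nonneg_matrix X"
  shows "CARD('n) * monge_ampere X / monge_ampere H \<le> trace (matrix_inv H ** X)"
proof -
  obtain B where "transpose B ** H ** B = mat 1" and B: "B ** transpose B = matrix_inv H"
    and "H ** (B ** transpose B) = mat 1" and detB: "det B * det B * det H = 1"
    by (rule posdef_inverse_factor[OF H])
  let ?M = "transpose B ** X ** B"
  have tr: "trace ?M = trace (matrix_inv H ** X)"
    using trace_mul_sym[of "transpose B ** X" B] by (simp only: B[symmetric] matrix_mul_assoc)
  have "det B * det B = 1 / det H"
    using detB posdef_det_pos[OF H] by (simp add: field_simps)
  moreover have "det ?M = (det B * det B) * det X" by (simp add: det_mul)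
  ultimately have "det ?M = det X / det H" by simp
  then show ?thesis
    using det_le_trace_power(2)[OF nonneg_matrix_congruence[OF X, of B]] tr
    by (simp add: monge_ampere_def real_root_divide field_simps)
qed

lemma trace_inverse_self: assumes "posdef_matrix (H::real^'n^'n)" shows "trace (matrix_inv H ** H) = CARD('n)"
  by (simp add: posdef_left_inverse[OF assms] trace_I)

lemma continuous_on_monge_ampere [continuous_intros]:
  fixes A :: "'a::topological_space \<Rightarrow> real^'n^'n"
  assumes "continuous_on S A" shows "continuous_on S (\<lambda>x. monge_ampere (A x))"
  unfolding monge_ampere_def det_def by (intro continuous_intros assms)

text \<open>Reduces claims about degenerate matrices to positive definite ones, since a positive
  multiple of the identity makes a nonnegative matrix invertible.\<close>

lemma monge_ampere_perturbation_ge: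
  assumes "\<And>\<delta>. 0 < \<delta> \<Longrightarrow> L \<le> monge_ampere (A + \<delta> *\<^sub>R mat 1)"
  shows "L \<le> monge_ampere A"
proof -
  let ?F = "\<lambda>\<delta>. monge_ampere (A + \<delta> *\<^sub>R mat 1)"
  have "continuous_on UNIV ?F" by (intro continuous_intros)
  then have "(?F \<longlongrightarrow> ?F 0) (at_right 0)"
    by (metis UNIV_I continuous_on_def tendsto_within_subset top_greatest)
  moreover have "\<forall>\<^sub>F \<delta> in at_right 0. L \<le> ?F \<delta>"
    using assms by (simp add: eventually_at_filter)
  ultimately have "L \<le> ?F 0"
    by (intro tendsto_lowerbound[of ?F _ "at_right 0"]) auto
  then show ?thesis by simp
qed

lemma nonneg_matrix_id: "nonneg_matrix (mat 1)"
  by (simp add: nonneg_matrix_def transpose_mat)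

lemma transpose_add: "transpose (A + B) = transpose A + transpose (B::real^'n^'m)"
  by (simp add: transpose_def vec_eq_iff)

lemma transpose_scaleR: "transpose (c *\<^sub>R A) = c *\<^sub>R transpose (A::real^'n^'m)"
  by (simp add: transpose_def vec_eq_iff)

lemma quadratic_form_add:
  "v \<bullet> ((A + B) *v v) = v \<bullet> (A *v v) + v \<bullet> ((B::real^'n^'n) *v v)"
  by (simp add: matrix_vector_mult_add_rdistrib inner_add_right)

lemma quadratic_form_scaleR: "v \<bullet> ((c *\<^sub>R A) *v v) = c * (v \<bullet> ((A::real^'n^'n) *v v))"
  by (simp flip: scaleR_matrix_vector_assoc)

lemma nonneg_matrix_add: "nonneg_matrix A \<Longrightarrow> nonneg_matrix B \<Longrightarrow> nonneg_matrix (A + B)"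
  unfolding nonneg_matrix_def by (simp add: transpose_add quadratic_form_add)

lemma nonneg_matrix_scaleR: "nonneg_matrix A \<Longrightarrow> 0 \<le> c \<Longrightarrow> nonneg_matrix (c *\<^sub>R A)"
  unfolding nonneg_matrix_def by (simp add: transpose_scaleR quadratic_form_scaleR)

lemma posdef_add_id:
  assumes "nonneg_matrix A" "0 < c" shows "posdef_matrix (A + c *\<^sub>R mat 1)"
proof -
  have "0 < v \<bullet> ((A + c *\<^sub>R mat 1) *v v)" if "v \<noteq> 0" for v
    using assms that by (simp add: nonneg_matrix_def quadratic_form_add quadratic_form_scaleR add_nonneg_pos)
  moreover have "transpose (A + c *\<^sub>R mat 1) = A + c *\<^sub>R mat 1"
    using assms by (simp add: nonneg_matrix_def transpose_add transpose_scaleR)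
  ultimately show ?thesis by (simp add: posdef_matrix_def)
qed

lemma monge_ampere_scaleR:
  assumes "0 \<le> c" shows "monge_ampere (c *\<^sub>R A) = c * monge_ampere A"
proof -
  have "det (c *\<^sub>R A) = c ^ CARD('a) * det (A::real^'a^'a)"
  proof -
    have "c *\<^sub>R A = (\<chi> i. c *s A $ i)" by (simp add: vec_eq_iff)
    then show ?thesis using det_rows_mul[of "\<lambda>_. c" "\<lambda>i. A $ i"] by simp
  qed
  then show ?thesis using assms
    unfolding monge_ampere_def by (simp only: real_root_mult real_root_power_cancel zero_less_card_finite)
qed

lemma monge_ampere_id: "monge_ampere (mat 1 :: real^'n^'n) = 1"
  by (simp add: monge_ampere_def)

text \<open>Minkowski's determinant inequality. The linear functional belonging to \<open>H\<close>
  close to \<open>X + Y\<close> dominates the operator at both summands and is nearly exact at the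
  sum.\<close>

lemma monge_ampere_superadditive:
  fixes X Y :: "real^'n^'n"
  assumes X: "nonneg_matrix X" and Y: "nonneg_matrix Y"
  shows "monge_ampere X + monge_ampere Y \<le> monge_ampere (X + Y)"
proof -
  let ?H = "\<lambda>c. X + Y + c *\<^sub>R mat 1"
  have main: "monge_ampere X + monge_ampere Y \<le> monge_ampere (?H c)" if c: "0 < c" for c
  proof -
    let ?n = "real CARD('n)"
    have H: "posdef_matrix (?H c)" by (intro posdef_add_id nonneg_matrix_add X Y c)
    have I: "nonneg_matrix (c *\<^sub>R mat 1 :: real^'n^'n)"
      using c by (intro nonneg_matrix_scaleR nonneg_matrix_id) simp
    let ?K = "matrix_inv (?H c)"
    have "trace (?K ** (?H c)) = trace (?K ** X) + trace (?K ** Y) + trace (?K ** (c *\<^sub>R mat 1))"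
      by (simp add: matrix_add_ldistrib trace_add)
    moreover have "0 \<le> trace (?K ** (c *\<^sub>R mat 1))"
      using trace_inverse_ge[OF H I] monge_ampere_nonneg[OF I] monge_ampere_pos[OF H]
      by (smt (verit) divide_nonneg_pos mult_nonneg_nonneg of_nat_0_le_iff)
    ultimately have "?n * monge_ampere X / monge_ampere (?H c) + ?n * monge_ampere Y / monge_ampere (?H c) \<le> ?n"
      using trace_inverse_ge[OF H X] trace_inverse_ge[OF H Y] trace_inverse_self[OF H] by linarith
    then have "?n * (monge_ampere X + monge_ampere Y) \<le> ?n * monge_ampere (?H c)"
      using monge_ampere_pos[OF H] by (simp add: divide_simps algebra_simps)
    then show ?thesis by simp
  qed
  show ?thesis by (rule monge_ampere_perturbation_ge) (rule main)
qed

lemma monge_ampere_mono: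
  assumes "nonneg_matrix X" "nonneg_matrix (Y - X)"
  shows "monge_ampere X \<le> monge_ampere Y"
  using monge_ampere_superadditive[OF assms] monge_ampere_nonneg[OF assms(2)] by simp

lemma posdef_coercive:
  fixes H :: "real^'n^'n"
  assumes H: "posdef_matrix H"
  obtains c where "0 < c" "\<And>v. c * (norm v)^2 \<le> v \<bullet> (H *v v)"
proof -
  have ne: "sphere (0::real^'n) 1 \<noteq> {}" by (simp add: sphere_eq_empty)
  have "continuous_on (sphere 0 1) (\<lambda>v. v \<bullet> (H *v v))" by (intro continuous_intros)
  from continuous_attains_inf[OF compact_sphere ne this] obtain w where
    w: "norm w = 1" "\<And>v. norm v = 1 \<Longrightarrow> w \<bullet> (H *v w) \<le> v \<bullet> (H *v v)" by auto
  have "0 < w \<bullet> (H *v w)" using H w(1) unfolding posdef_matrix_def by (metis norm_zero zero_neq_one)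
  moreover have "w \<bullet> (H *v w) * (norm v)^2 \<le> v \<bullet> (H *v v)" for v
  proof (cases "v = 0")
    case False
    then have "w \<bullet> (H *v w) \<le> (inverse (norm v) *\<^sub>R v) \<bullet> (H *v (inverse (norm v) *\<^sub>R v))"
      by (intro w(2)) simp
    then show ?thesis using False
      by (simp add: matrix_vector_mult_scaleR power2_eq_square divide_simps algebra_simps)
  qed simp
  ultimately show ?thesis using that by blast
qed

text \<open>A zero eigenvalue would annihilate the determinant. In Perron's method this gives the
  room to lower a test function by a paraboloid without losing convexity.\<close>

lemma posdef_if_det_pos:
  fixes A :: "real^'n^'n"
  assumes A: "nonneg_matrix A" and det: "0 < det A"
  shows "posdef_matrix A"
proof -
  obtain P d where P: "orthogonal_matrix P" and
    Ad: "A = P ** (\<chi> i j. if i = j then d i else 0) ** transpose P"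
    using symmetric_diagonalization[of A] A unfolding nonneg_matrix_def by blast
  let ?D = "\<chi> i j. if i = j then d i else 0"
  have "nonneg_matrix ?D"
    using nonneg_matrix_congruence[OF A, of P] diag_conjugate[OF P Ad] by simp
  then have d0: "0 \<le> d i" for i using nonneg_matrix_diag_nonneg[of ?D i] by simp
  have "0 < prod d UNIV" using det unfolding Ad det_orthogonal_conjugate[OF P] det_diag .
  then have "d i \<noteq> 0" for i by (metis UNIV_I finite_code less_irrefl prod_zero)
  then have d: "0 < d i" for i using d0[of i] by (simp add: less_le)
  have "0 < v \<bullet> (A *v v)" if v: "v \<noteq> 0" for v
  proof -
    let ?w = "transpose P *v v"
    have "P *v ?w = v" using P by (simp only: matrix_vector_mul_assoc orthogonal_matrix_def matrix_vector_mul_lid)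
    then have "?w \<noteq> 0" using v by auto
    then obtain k where k: "?w $ k \<noteq> 0" by (auto simp: vec_eq_iff)
    have "v \<bullet> (A *v v) = ?w \<bullet> (?D *v ?w)"
      unfolding Ad using quadratic_form_congruence[of v "transpose P" ?D] by simp
    also have "\<dots> = (\<Sum>i\<in>UNIV. d i * (?w $ i)^2)"
      by (simp add: inner_vec_def matrix_vector_mult_def if_distrib if_distribR power2_eq_square
          mult.assoc mult.commute mult.left_commute cong: if_cong)
    also have "\<dots> > 0" using d k by (intro sum_pos2[of _ k]) (auto simp: less_imp_le)
    finally show ?thesis .
  qed
  then show ?thesis using A by (auto simp: posdef_matrix_def nonneg_matrix_def)
qed

section \<open>Second-order calculus and convolution\<close>

text \<open>Gradient and Hessian are carried as explicit functions, so that sums, multiples and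
  convolutions are formed by rules instead of being differentiated anew. On open sets this agrees
  with \<open>C2_on\<close>, with \<open>g\<close> and \<open>h\<close> equal to
  \<open>gradient\<close> and \<open>hessian\<close>.\<close>

definition C2_data ::
  "(real^'n) set \<Rightarrow> (real^'n \<Rightarrow> real) \<Rightarrow> (real^'n \<Rightarrow> real^'n) \<Rightarrow> (real^'n \<Rightarrow> real^'n^'n) \<Rightarrow> bool" where
  "C2_data S \<phi> g h \<longleftrightarrow>
     (\<forall>x\<in>S. (\<phi> has_derivative (\<lambda>v. g x \<bullet> v)) (at x)) \<and>
     (\<forall>x\<in>S. (g has_derivative (\<lambda>v. h x *v v)) (at x)) \<and>
     continuous_on S h"

lemma gradient_eq:
  assumes "(\<phi> has_derivative (\<lambda>v. g \<bullet> v)) (at x)" shows "gradient \<phi> x = g"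
proof -
  have "frechet_derivative \<phi> (at x) = (\<lambda>v. g \<bullet> v)"
    using frechet_derivative_at[OF assms] by simp
  then show ?thesis by (simp add: gradient_def vec_eq_iff inner_axis)
qed

lemma C2_data_gradient_hessian:
  assumes C: "C2_data S \<phi> g h" and S: "open S" and x: "x \<in> S"
  shows "gradient \<phi> x = g x" "hessian \<phi> x = h x"
    "(gradient \<phi> has_derivative (\<lambda>v. h x *v v)) (at x)"
proof -
  show gr: "gradient \<phi> x = g x" using C x by (auto simp: C2_data_def intro!: gradient_eq)
  have "(g has_derivative (\<lambda>v. h x *v v)) (at x)" using C x by (auto simp: C2_data_def)
  then show d: "(gradient \<phi> has_derivative (\<lambda>v. h x *v v)) (at x)"
    by (rule has_derivative_transform_within_open[OF _ S x])
       (use C in \<open>auto simp: C2_data_def intro!: gradient_eq[symmetric]\<close>)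
  then show "hessian \<phi> x = h x"
    unfolding hessian_def jacobian_def frechet_derivative_at[OF d, symmetric]
    by (metis matrix_of_matrix_vector_mul)
qed

lemma C2_data_imp_C2_on:
  assumes C: "C2_data S \<phi> g h" and S: "open S"
  shows "C2_on S \<phi>"
proof -
  have "continuous_on S (hessian \<phi>)"
    using C C2_data_gradient_hessian(2)[OF C S] by (auto simp: C2_data_def cong: continuous_on_cong)
  moreover have "\<phi> differentiable at x" if "x \<in> S" for x
    using C that by (auto simp: C2_data_def differentiable_def)
  ultimately show ?thesis
    using C2_data_gradient_hessian(3)[OF C S] by (auto simp: C2_on_def differentiable_def)
qed

lemma C2_on_imp_C2_data:
  assumes C: "C2_on S \<phi>" shows "C2_data S \<phi> (gradient \<phi>) (hessian \<phi>)"
proof -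
  have "(\<phi> has_derivative (\<lambda>v. gradient \<phi> x \<bullet> v)) (at x)" if x: "x \<in> S" for x
  proof -
    have d: "(\<phi> has_derivative frechet_derivative \<phi> (at x)) (at x)"
      using C x by (auto simp: C2_on_def frechet_derivative_works)
    have lin: "linear (frechet_derivative \<phi> (at x))" using d has_derivative_linear by blast
    have "frechet_derivative \<phi> (at x) v = gradient \<phi> x \<bullet> v" for v
    proof -
      have "frechet_derivative \<phi> (at x) (\<Sum>i\<in>UNIV. (v $ i) *s axis i 1)
          = (\<Sum>i\<in>UNIV. v $ i * frechet_derivative \<phi> (at x) (axis i 1))"
        using lin by (simp add: linear_sum linear_cmul scalar_mult_eq_scaleR)
      then show ?thesis
        by (simp add: basis_expansion gradient_def inner_vec_def mult.commute)
    qed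
    then have "frechet_derivative \<phi> (at x) = (\<lambda>v. gradient \<phi> x \<bullet> v)" by (rule ext)
    then show ?thesis using d by simp
  qed
  moreover have "(gradient \<phi> has_derivative (\<lambda>v. hessian \<phi> x *v v)) (at x)" if x: "x \<in> S" for x
  proof -
    have d: "(gradient \<phi> has_derivative frechet_derivative (gradient \<phi>) (at x)) (at x)"
      using C x by (auto simp: C2_on_def frechet_derivative_works)
    then show ?thesis unfolding hessian_def jacobian_def
      using matrix_works[of "frechet_derivative (gradient \<phi>) (at x)"] has_derivative_linear[OF d]
      by (simp add: linear_matrix_vector_mul_eq)
  qed
  ultimately show ?thesis using C by (auto simp: C2_data_def C2_on_def)
qed

lemma C2_data_subset: "C2_data S \<phi> g h \<Longrightarrow> T \<subseteq> S \<Longrightarrow> C2_data T \<phi> g h"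
  unfolding C2_data_def by (meson continuous_on_subset subsetD)

lemma C2_data_continuous:
  assumes "C2_data S \<phi> g h" shows "continuous_on S \<phi>" "continuous_on S g"
  using assms by (auto simp: C2_data_def intro!: continuous_at_imp_continuous_on has_derivative_continuous)

lemma C2_data_add:
  assumes "C2_data S \<phi> g h" "C2_data S \<phi>' g' h'"
  shows "C2_data S (\<lambda>x. \<phi> x + \<phi>' x) (\<lambda>x. g x + g' x) (\<lambda>x. h x + h' x)"
  using assms unfolding C2_data_def inner_add_left matrix_vector_mult_add_rdistrib
  by (auto intro!: has_derivative_add continuous_on_add)

lemma C2_data_scale:
  fixes c :: real
  assumes "C2_data S \<phi> g h"
  shows "C2_data S (\<lambda>x. c * \<phi> x) (\<lambda>x. c *\<^sub>R g x) (\<lambda>x. c *\<^sub>R h x)"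
  using assms unfolding C2_data_def inner_scaleR_left scaleR_matrix_vector_assoc[symmetric]
  by (auto intro!: has_derivative_mult_right has_derivative_scaleR_right continuous_intros)

lemma C2_data_diff:
  assumes "C2_data S \<phi> g h" "C2_data S \<phi>' g' h'"
  shows "C2_data S (\<lambda>x. \<phi> x - \<phi>' x) (\<lambda>x. g x - g' x) (\<lambda>x. h x - h' x)"
  using C2_data_add[OF assms(1) C2_data_scale[OF assms(2), of "-1"]] by simp

lemma C2_data_const: "C2_data S (\<lambda>x. c) (\<lambda>x. 0) (\<lambda>x. 0)"
  unfolding C2_data_def inner_zero_left matrix_vector_mult_0 by auto

lemma C2_data_square:
  "C2_data S (\<lambda>x. (norm (x - y))^2) (\<lambda>x. 2 *\<^sub>R (x - y)) (\<lambda>x. 2 *\<^sub>R mat 1)"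
proof -
  have "((\<lambda>x. (x - y) \<bullet> (x - y)) has_derivative (\<lambda>v. (2 *\<^sub>R (x - y)) \<bullet> v)) (at x)" for x
    by (auto intro!: derivative_eq_intros simp: inner_commute algebra_simps)
  moreover have "((\<lambda>x. 2 *\<^sub>R (x - y)) has_derivative (\<lambda>v. (2 *\<^sub>R mat 1) *v v)) (at x)" for x :: "real^'a"
    by (auto intro!: derivative_eq_intros simp: scaleR_matrix_vector_assoc[symmetric])
  ultimately show ?thesis unfolding C2_data_def power2_norm_eq_inner using continuous_on_const by blast
qed

text \<open>The error is controlled by differentiability of \<open>g\<close> at the single point
  \<open>x\<close>; the mean value theorem on the segment from \<open>x\<close> to
  \<open>x + v\<close> transports it to \<open>\<phi>\<close>.\<close>

lemma taylor_second_order: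
  fixes \<phi> :: "real^'n \<Rightarrow> real"
  assumes C: "C2_data S \<phi> g h" and S: "open S" and x: "x \<in> S" and e: "0 < e"
  shows "\<exists>d>0. ball x d \<subseteq> S \<and>
    (\<forall>v. norm v < d \<longrightarrow> \<bar>\<phi> (x + v) - \<phi> x - g x \<bullet> v - (v \<bullet> (h x *v v)) / 2\<bar> \<le> e * (norm v)^2)"
proof -
  have gd: "(g has_derivative (\<lambda>v. h x *v v)) (at x)" using C x by (auto simp: C2_data_def)
  obtain d1 where d1: "0 < d1" "\<And>y. norm (y - x) < d1 \<Longrightarrow> norm (g y - g x - h x *v (y - x)) \<le> e * norm (y - x)"
    using gd[unfolded has_derivative_at_alt] e by blast
  obtain d2 where d2: "0 < d2" "ball x d2 \<subseteq> S" using S x by (meson open_contains_ball)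
  define d where "d = min d1 d2"
  have "\<bar>\<phi> (x + v) - \<phi> x - g x \<bullet> v - (v \<bullet> (h x *v v)) / 2\<bar> \<le> e * (norm v)^2" if v: "norm v < d" for v
  proof -
    \<comment> \<open>Linear and quadratic terms are removed along the segment, so
      \<open>F 1 - F 0\<close> is exactly the Taylor remainder.\<close>
    define F where "F s = \<phi> (x + s *\<^sub>R v) - s * (g x \<bullet> v) - s^2 * ((v \<bullet> (h x *v v)) / 2)" for s
    have in_S: "x + s *\<^sub>R v \<in> S" if "0 \<le> s" "s \<le> 1" for s
    proof -
      have "norm (s *\<^sub>R v) \<le> norm v" using that by (simp add: mult_left_le_one_le)
      then show ?thesis using v d2 by (auto simp: d_def dist_norm subset_iff)
    qed
    have dF: "(F has_derivative (\<lambda>t. t * ((g (x + s *\<^sub>R v) - g x - s *\<^sub>R (h x *v v)) \<bullet> v))) (at s)"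
      if "0 \<le> s" "s \<le> 1" for s
    proof -
      have "(\<phi> has_derivative (\<lambda>w. g (x + s *\<^sub>R v) \<bullet> w)) (at (x + s *\<^sub>R v))"
        using C in_S[OF that] by (auto simp: C2_data_def)
      moreover have "((\<lambda>s. x + s *\<^sub>R v) has_derivative (\<lambda>t. t *\<^sub>R v)) (at s)"
        by (auto intro!: derivative_eq_intros)
      ultimately have "((\<lambda>s. \<phi> (x + s *\<^sub>R v)) has_derivative (\<lambda>t. g (x + s *\<^sub>R v) \<bullet> (t *\<^sub>R v))) (at s)"
        by (rule has_derivative_compose[rotated])
      then show ?thesis unfolding F_def
        by (auto intro!: derivative_eq_intros simp: algebra_simps inner_diff_left inner_commute power2_eq_square)
    qed
    have "\<exists>s>0. s < 1 \<and> F 1 - F 0 = (1 - 0) * ((g (x + s *\<^sub>R v) - g x - s *\<^sub>R (h x *v v)) \<bullet> v)"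
      by (rule MVT2) (auto intro!: has_derivative_imp_has_field_derivative[OF dF])
    then obtain s where s: "0 < s" "s < 1"
      "F 1 - F 0 = (g (x + s *\<^sub>R v) - g x - s *\<^sub>R (h x *v v)) \<bullet> v" by auto
    have sv: "norm (s *\<^sub>R v) \<le> norm v" using s by (simp add: mult_left_le_one_le)
    have "\<bar>F 1 - F 0\<bar> \<le> norm (g (x + s *\<^sub>R v) - g x - s *\<^sub>R (h x *v v)) * norm v"
      unfolding s(3) by (rule Cauchy_Schwarz_ineq2)
    also have "\<dots> \<le> (e * norm v) * norm v"
    proof (rule mult_right_mono)
      have "norm (g (x + s *\<^sub>R v) - g x - h x *v (x + s *\<^sub>R v - x)) \<le> e * norm (x + s *\<^sub>R v - x)"
        by (rule d1(2)) (use sv v in \<open>auto simp: d_def\<close>)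
      also have "\<dots> \<le> e * norm v" using sv e by (auto intro!: mult_left_mono)
      finally show "norm (g (x + s *\<^sub>R v) - g x - s *\<^sub>R (h x *v v)) \<le> e * norm v"
        by (simp add: matrix_vector_mult_scaleR)
    qed simp
    finally show ?thesis by (simp add: F_def power2_eq_square algebra_simps)
  qed
  moreover have "ball x d \<subseteq> S" using d2 by (auto simp: d_def)
  ultimately show ?thesis using d1 d2 by (intro exI[of _ d]) (auto simp: d_def)
qed

text \<open>The first-order terms at \<open>x + v\<close> and \<open>x - v\<close> cancel, leaving
  the quadratic form and an arbitrarily small multiple of \<open>(norm v)^2\<close>. As the
  hypothesis concerns one centre only, it fits touching points as well as convex functions.\<close>

lemma second_difference_nonneg:
  fixes \<phi> :: "real^'n \<Rightarrow> real"
  assumes C: "C2_data S \<phi> g h" and S: "open S" and x: "x \<in> S" and r: "0 < r"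
    and nn: "\<And>v. norm v < r \<Longrightarrow> 2 * \<phi> x \<le> \<phi> (x + v) + \<phi> (x - v)"
  shows "0 \<le> v \<bullet> (h x *v v)"
proof (cases "v = 0")
  case False
  have "- (v \<bullet> (h x *v v)) \<le> 2 * e * (norm v)^2" if e: "0 < e" for e
  proof -
    obtain d where d: "0 < d" "ball x d \<subseteq> S"
      "\<And>v. norm v < d \<Longrightarrow> \<bar>\<phi> (x + v) - \<phi> x - g x \<bullet> v - (v \<bullet> (h x *v v)) / 2\<bar> \<le> e * (norm v)^2"
      using taylor_second_order[OF C S x e] by blast
    define t where "t = min d r / (2 * norm v)"
    have t: "0 < t" using d r False by (simp add: t_def)
    define w where "w = t *\<^sub>R v"
    have w: "norm w < d" "norm w < r" using False d r by (auto simp: w_def t_def)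
    have "0 \<le> w \<bullet> (h x *v w) + 2 * e * (norm w)^2"
      using d(3)[OF w(1)] d(3)[of "-w"] w nn[OF w(2)]
      by (simp add: linear_neg[OF matrix_vector_mul_linear] abs_le_iff)
    then have "0 \<le> t^2 * (v \<bullet> (h x *v v) + 2 * e * (norm v)^2)"
      by (simp add: w_def matrix_vector_mult_scaleR power2_eq_square algebra_simps)
    then show ?thesis using t by (simp add: zero_le_mult_iff)
  qed
  note this[of "E / (2 * (norm v)^2)" for E]
  then have "- (v \<bullet> (h x *v v)) \<le> E" if "0 < E" for E using that False by (simp add: divide_simps mult.commute)
  then show ?thesis using field_le_epsilon[of "- (v \<bullet> (h x *v v))" 0] by simp
qed simp

text \<open>Schwarz's theorem: the mixed second difference is symmetric in \<open>u\<close> and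
  \<open>v\<close>, and it equals \<open>s^2 * (u \<bullet> (h x *v v))\<close> up to an error small
  compared with \<open>s^2\<close>. Symmetry is part of \<open>nonneg_matrix\<close>, so it has to
  be supplied whenever a Hessian is shown to be nonnegative.\<close>

lemma hessian_symmetric:
  fixes \<phi> :: "real^'n \<Rightarrow> real"
  assumes C: "C2_data S \<phi> g h" and S: "open S" and x: "x \<in> S"
  shows "transpose (h x) = h x"
proof -
  have gd: "(g has_derivative (\<lambda>v. h x *v v)) (at x)" using C x by (auto simp: C2_data_def)
  have main: "\<exists>d>0. \<forall>s. 0 < s \<and> s < d \<longrightarrow>
      \<bar>\<phi> (x + s *\<^sub>R (u + v)) - \<phi> (x + s *\<^sub>R u) - \<phi> (x + s *\<^sub>R v) + \<phi> x - s^2 * (u \<bullet> (h x *v v))\<bar>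
        \<le> s^2 * (e * (2 * (norm u + norm v) * norm u))" if e: "0 < e" for u v e
  proof -
    obtain d1 where d1: "0 < d1" "\<And>y. norm (y - x) < d1 \<Longrightarrow> norm (g y - g x - h x *v (y - x)) \<le> e * norm (y - x)"
      using gd[unfolded has_derivative_at_alt] e by blast
    obtain d2 where d2: "0 < d2" "ball x d2 \<subseteq> S" using S x by (meson open_contains_ball)
    define N where "N = norm u + norm v + 1"
    have N: "0 < N" by (simp add: N_def add_nonneg_pos)
    define d where "d = min d1 d2 / N"
    have "\<bar>\<phi> (x + s *\<^sub>R (u + v)) - \<phi> (x + s *\<^sub>R u) - \<phi> (x + s *\<^sub>R v) + \<phi> x - s^2 * (u \<bullet> (h x *v v))\<bar>
        \<le> s^2 * (e * (2 * (norm u + norm v) * norm u))" if s: "0 < s" "s < d" for s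
    proof -
      have sN: "s * N < min d1 d2" using s N by (simp add: d_def pos_less_divide_eq)
      have nw: "norm (t *\<^sub>R u + r *\<^sub>R v) \<le> s * (norm u + norm v)"
        if "0 \<le> t" "t \<le> s" "0 \<le> r" "r \<le> s" for t r
      proof -
        have "norm (t *\<^sub>R u + r *\<^sub>R v) \<le> t * norm u + r * norm v"
          using norm_triangle_ineq[of "t *\<^sub>R u" "r *\<^sub>R v"] that by simp
        also have "\<dots> \<le> s * norm u + s * norm v" using that by (intro add_mono mult_right_mono) auto
        finally show ?thesis by (simp add: algebra_simps)
      qed
      have sN': "s * (norm u + norm v) < min d1 d2" 
        using sN s by (simp add: N_def algebra_simps)
      have in_S: "x + t *\<^sub>R u + r *\<^sub>R v \<in> S" if "0 \<le> t" "t \<le> s" "0 \<le> r" "r \<le> s" for t r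
        using nw[OF that] sN' d2 by (auto simp: subset_iff dist_norm add.assoc norm_minus_commute)
      define F where "F t = \<phi> (x + t *\<^sub>R u + s *\<^sub>R v) - \<phi> (x + t *\<^sub>R u + 0 *\<^sub>R v)" for t
      have dp: "((\<lambda>t. \<phi> (x + t *\<^sub>R u + r *\<^sub>R v)) has_derivative (\<lambda>k. g (x + t *\<^sub>R u + r *\<^sub>R v) \<bullet> (k *\<^sub>R u))) (at t)"
        if "0 \<le> t" "t \<le> s" "0 \<le> r" "r \<le> s" for t r
      proof -
        have "(\<phi> has_derivative (\<lambda>w. g (x + t *\<^sub>R u + r *\<^sub>R v) \<bullet> w)) (at (x + t *\<^sub>R u + r *\<^sub>R v))"
          using C in_S[OF that] by (auto simp: C2_data_def)
        moreover have "((\<lambda>t. x + t *\<^sub>R u + r *\<^sub>R v) has_derivative (\<lambda>k. k *\<^sub>R u)) (at t)"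
          by (auto intro!: derivative_eq_intros)
        ultimately show ?thesis by (rule has_derivative_compose[rotated])
      qed
      have dF: "(F has_derivative (\<lambda>k. k * ((g (x + t *\<^sub>R u + s *\<^sub>R v) - g (x + t *\<^sub>R u + 0 *\<^sub>R v)) \<bullet> u))) (at t)"
        if "0 \<le> t" "t \<le> s" for t
        unfolding F_def using has_derivative_diff[OF dp[OF that, of s] dp[OF that, of 0]] s
        by (simp add: inner_diff_left right_diff_distrib)
      have "\<exists>t>0. t < s \<and> F s - F 0 = (s - 0) * ((g (x + t *\<^sub>R u + s *\<^sub>R v) - g (x + t *\<^sub>R u + 0 *\<^sub>R v)) \<bullet> u)"
        by (rule MVT2[OF s(1)]) (auto intro!: has_derivative_imp_has_field_derivative[OF dF])
      then obtain t where t: "0 < t" "t < s"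
        "F s - F 0 = s * ((g (x + t *\<^sub>R u + s *\<^sub>R v) - g (x + t *\<^sub>R u)) \<bullet> u)" by auto
      define R where "R w = g (x + w) - g x - h x *v w" for w
      have R: "norm (R (t *\<^sub>R u + r *\<^sub>R v)) \<le> e * (s * (norm u + norm v))" if "0 \<le> r" "r \<le> s" for r
      proof -
        have n: "norm (t *\<^sub>R u + r *\<^sub>R v) \<le> s * (norm u + norm v)" using t that by (intro nw) auto
        then have "norm (R (t *\<^sub>R u + r *\<^sub>R v)) \<le> e * norm (t *\<^sub>R u + r *\<^sub>R v)"
          using d1(2)[of "x + (t *\<^sub>R u + r *\<^sub>R v)"] sN' by (simp add: R_def)
        then show ?thesis using n e by (meson mult_left_mono less_imp_le order_trans)
      qed
      have diff: "(g (x + t *\<^sub>R u + s *\<^sub>R v) - g (x + t *\<^sub>R u))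
          = s *\<^sub>R (h x *v v) + (R (t *\<^sub>R u + s *\<^sub>R v) - R (t *\<^sub>R u + 0 *\<^sub>R v))"
        by (simp add: R_def matrix_vector_right_distrib matrix_vector_mult_scaleR algebra_simps)
      have eq: "F s - F 0 - s^2 * (u \<bullet> (h x *v v))
          = s * ((R (t *\<^sub>R u + s *\<^sub>R v) - R (t *\<^sub>R u + 0 *\<^sub>R v)) \<bullet> u)"
        unfolding t(3) diff by (simp add: inner_add_left inner_commute[of u] power2_eq_square distrib_left)
      have "\<bar>(R (t *\<^sub>R u + s *\<^sub>R v) - R (t *\<^sub>R u + 0 *\<^sub>R v)) \<bullet> u\<bar>
          \<le> norm (R (t *\<^sub>R u + s *\<^sub>R v) - R (t *\<^sub>R u + 0 *\<^sub>R v)) * norm u"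
        by (rule Cauchy_Schwarz_ineq2)
      also have "\<dots> \<le> (2 * (e * (s * (norm u + norm v)))) * norm u"
        using R[of s] R[of 0] s norm_triangle_ineq4[of "R (t *\<^sub>R u + s *\<^sub>R v)" "R (t *\<^sub>R u + 0 *\<^sub>R v)"]
        by (intro mult_right_mono) auto
      finally have "\<bar>F s - F 0 - s^2 * (u \<bullet> (h x *v v))\<bar> \<le> s * ((2 * (e * (s * (norm u + norm v)))) * norm u)"
        unfolding eq using s by (simp add: abs_mult)
      then show ?thesis unfolding F_def by (simp add: scaleR_add_right power2_eq_square algebra_simps)
    qed
    then show ?thesis using d1 d2 N by (intro exI[of _ d]) (auto simp: d_def)
  qed
  have sym: "u \<bullet> (h x *v v) = v \<bullet> (h x *v u)" for u v
  proof (rule ccontr)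
    let ?M = "(norm u + norm v) * (norm u + norm v)"
    assume ne: "u \<bullet> (h x *v v) \<noteq> v \<bullet> (h x *v u)"
    define D where "D = \<bar>u \<bullet> (h x *v v) - v \<bullet> (h x *v u)\<bar>"
    have D: "0 < D" using ne by (simp add: D_def)
    \<comment> \<open>With this choice the two errors together are at most half of the asymmetry
      \<open>D\<close>; the summand 1 keeps the denominator positive.\<close>
    define e where "e = D / (4 * (?M + 1))"
    have M: "0 \<le> ?M" by simp
    have e: "0 < e" using D M by (simp add: e_def add_nonneg_pos)
    obtain d1 where d1: "d1 > 0" "\<And>s. 0 < s \<and> s < d1 \<Longrightarrow> \<bar>\<phi> (x + s *\<^sub>R (u + v)) - \<phi> (x + s *\<^sub>R u) - \<phi> (x + s *\<^sub>R v) + \<phi> x - s^2 * (u \<bullet> (h x *v v))\<bar>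
        \<le> s^2 * (e * (2 * (norm u + norm v) * norm u))" using main[OF e] by meson
    obtain d2 where d2: "d2 > 0" "\<And>s. 0 < s \<and> s < d2 \<Longrightarrow> \<bar>\<phi> (x + s *\<^sub>R (v + u)) - \<phi> (x + s *\<^sub>R v) - \<phi> (x + s *\<^sub>R u) + \<phi> x - s^2 * (v \<bullet> (h x *v u))\<bar>
        \<le> s^2 * (e * (2 * (norm v + norm u) * norm v))" using main[OF e] by meson
    define s where "s = min d1 d2 / 2"
    have s: "0 < s" "s < d1" "s < d2" using d1 d2 by (auto simp: s_def)
    have "\<bar>s^2 * (u \<bullet> (h x *v v)) - s^2 * (v \<bullet> (h x *v u))\<bar>
       \<le> s^2 * (e * (2 * (norm u + norm v) * norm u)) + s^2 * (e * (2 * (norm v + norm u) * norm v))"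
      using d1(2)[of s] d2(2)[of s] s by (simp add: add.commute[of v u])
    also have "\<dots> = s^2 * (2 * e * ?M)" by (simp add: algebra_simps)
    finally have "s^2 * D \<le> s^2 * (2 * e * ?M)"
      by (simp add: D_def abs_mult flip: right_diff_distrib)
    then have "D \<le> 2 * e * ?M" using s by simp
    also have "\<dots> \<le> 2 * e * (?M + 1)" using e by simp
    also have "\<dots> = D / 2"
    proof -
      define q where "q = ?M + 1"
      have "q \<noteq> 0" using M unfolding q_def by linarith
      then show ?thesis unfolding e_def q_def[symmetric] by simp
    qed
    finally show False using D by simp
  qed
  have "transpose (h x) $ i $ j = h x $ i $ j" for i j
    using sym[of "axis j 1" "axis i 1"]
    by (simp add: transpose_def inner_axis' matrix_vector_mul_component inner_axis)
  then show ?thesis by (simp add: vec_eq_iff)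
qed

lemma touching_C2:
  fixes \<phi> \<zeta> :: "real^'n \<Rightarrow> real"
  assumes C: "C2_data S \<phi> g h" and C': "C2_data S \<zeta> g' h'" and S: "open S" and x: "x \<in> S"
    and r: "0 < r" and le: "\<And>y. dist y x < r \<Longrightarrow> \<phi> x - \<zeta> x \<le> \<phi> y - \<zeta> y"
  shows "g x = g' x" "nonneg_matrix (h x - h' x)"
proof -
  note D = C2_data_diff[OF C C']
  have "(\<lambda>v. (g x - g' x) \<bullet> v) = (\<lambda>v. 0)"
    using differential_zero_maxmin[of x "ball x r" "\<lambda>y. \<phi> y - \<zeta> y" "\<lambda>v. (g x - g' x) \<bullet> v"] D x r le
    by (auto simp: C2_data_def dist_commute)
  then have "(g x - g' x) \<bullet> (g x - g' x) = 0" by metis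
  then show "g x = g' x" by simp
  have "0 \<le> v \<bullet> ((h x - h' x) *v v)" for v
    using second_difference_nonneg[OF D S x r] le[of "x + _"] le[of "x - _"] by (smt (verit) dist_norm add_diff_cancel_left' norm_minus_cancel minus_diff_eq diff_diff_eq2 diff_self)
  then show "nonneg_matrix (h x - h' x)"
    using hessian_symmetric[OF D S x] by (simp add: nonneg_matrix_def)
qed


section \<open>Differentiation under the convolution integral\<close>

lemma continuous_on_convolution_integrand:
  fixes k :: "real^'n \<Rightarrow> 'b::real_normed_vector" and E :: "real^'n \<Rightarrow> real"
  assumes "continuous_on (cbox a b) E" "continuous_on UNIV k"
  shows "continuous_on (S \<times> cbox a b) (\<lambda>(x, y). E y *\<^sub>R k (x - y))"
proof -
  have "continuous_on (S \<times> cbox a b) (\<lambda>z. E (snd z))"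
    by (rule continuous_on_compose2[OF assms(1)]) (auto intro!: continuous_intros)
  moreover have "continuous_on (S \<times> cbox a b) (\<lambda>z. k (fst z - snd z))"
    by (rule continuous_on_compose2[OF assms(2)]) (auto intro!: continuous_intros)
  ultimately show ?thesis by (auto simp: split_beta intro!: continuous_intros)
qed

lemma convolution_integrable:
  fixes k :: "real^'n \<Rightarrow> 'b::euclidean_space" and E :: "real^'n \<Rightarrow> real"
  assumes "continuous_on (cbox a b) E" "continuous_on UNIV k"
  shows "(\<lambda>y. E y *\<^sub>R k (x - y)) integrable_on cbox a b"
proof (rule integrable_continuous)
  show "continuous_on (cbox a b) (\<lambda>y. E y *\<^sub>R k (x - y))"
    by (intro continuous_intros assms continuous_on_compose2[OF assms(2)]) auto
qed

lemma convolution_has_derivative: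
  fixes k :: "real^'n \<Rightarrow> real" and E :: "real^'n \<Rightarrow> real"
  assumes E: "continuous_on (cbox a b) E" and k1: "continuous_on UNIV k1"
    and k: "\<And>z. (k has_derivative (\<lambda>v. k1 z \<bullet> v)) (at z)"
  shows "((\<lambda>x. integral (cbox a b) (\<lambda>y. E y *\<^sub>R k (x - y))) has_derivative
    (\<lambda>v. integral (cbox a b) (\<lambda>y. E y *\<^sub>R k1 (x - y)) \<bullet> v)) (at x)"
proof -
  have ck: "continuous_on UNIV k" using k by (intro continuous_at_imp_continuous_on) (auto intro: has_derivative_continuous)
  let ?fx = "\<lambda>x y. blinfun_inner_left (E y *\<^sub>R k1 (x - y))"
  have "((\<lambda>x. integral (cbox a b) (\<lambda>y. E y *\<^sub>R k (x - y))) has_derivative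
      blinfun_apply (integral (cbox a b) (?fx x))) (at x within UNIV)"
  proof (rule leibniz_rule)
    fix x y :: "real^'n"
    have "((\<lambda>x. k (x - y)) has_derivative (\<lambda>v. k1 (x - y) \<bullet> v)) (at x)"
      by (rule has_derivative_compose[OF _ k, where f="\<lambda>x. x - y"]) (auto intro!: derivative_eq_intros)
    then show "((\<lambda>x. E y *\<^sub>R k (x - y)) has_derivative blinfun_apply (?fx x y)) (at x within UNIV)"
      by (auto intro!: derivative_eq_intros simp: inner_commute)
  next
    show "continuous_on (UNIV \<times> cbox a b) (\<lambda>(x, y). ?fx x y)"
      using continuous_on_convolution_integrand[OF E k1, of UNIV]
      by (auto simp: split_beta intro!: continuous_intros)
  qed (auto intro!: convolution_integrable[OF E ck, simplified])
  moreover have "integral (cbox a b) (?fx x) = blinfun_inner_left (integral (cbox a b) (\<lambda>y. E y *\<^sub>R k1 (x - y)))"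
    using integral_linear[OF convolution_integrable[OF E k1] bounded_linear_blinfun_inner_left, of x]
    by (simp add: o_def)
  ultimately show ?thesis by (simp add: inner_commute)
qed

lemma convolution_C2_data:
  fixes k :: "real^'n \<Rightarrow> real" and E :: "real^'n \<Rightarrow> real"
  assumes E: "continuous_on (cbox a b) E" and k: "C2_data UNIV k k1 k2"
  shows "C2_data UNIV (\<lambda>x. integral (cbox a b) (\<lambda>y. E y * k (x - y)))
    (\<lambda>x. integral (cbox a b) (\<lambda>y. E y *\<^sub>R k1 (x - y)))
    (\<lambda>x. integral (cbox a b) (\<lambda>y. E y *\<^sub>R k2 (x - y)))"
proof -
  have kd: "(k has_derivative (\<lambda>v. k1 z \<bullet> v)) (at z)" and k1d: "(k1 has_derivative (\<lambda>v. k2 z *v v)) (at z)" for z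
    using k by (auto simp: C2_data_def)
  have k2c: "continuous_on UNIV k2" using k by (simp add: C2_data_def)
  have k1c: "continuous_on UNIV k1" using k1d by (intro continuous_at_imp_continuous_on) (auto intro: has_derivative_continuous)
  have "((\<lambda>x. integral (cbox a b) (\<lambda>y. E y *\<^sub>R k1 (x - y))) has_derivative
      (\<lambda>v. integral (cbox a b) (\<lambda>y. E y *\<^sub>R k2 (x - y)) *v v)) (at x)" for x
  proof -
    \<comment> \<open>The rule for scalar kernels is applied once more, to each component of the
      gradient kernel \<open>k1\<close>.\<close>
    have "((\<lambda>x. integral (cbox a b) (\<lambda>y. E y *\<^sub>R k1 (x - y)) $ i) has_derivative
      (\<lambda>v. (integral (cbox a b) (\<lambda>y. E y *\<^sub>R k2 (x - y)) *v v) $ i)) (at x)" for i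
    proof -
      have "((\<lambda>z. k1 z $ i) has_derivative (\<lambda>v. k2 z $ i \<bullet> v)) (at z)" for z
        using bounded_linear.has_derivative[OF bounded_linear_vec_nth k1d, of i z]
        by (simp add: matrix_vector_mul_component)
      moreover have "continuous_on UNIV (\<lambda>z. k2 z $ i)" by (intro continuous_intros k2c)
      ultimately have "((\<lambda>x. integral (cbox a b) (\<lambda>y. E y *\<^sub>R (k1 (x - y) $ i))) has_derivative
        (\<lambda>v. integral (cbox a b) (\<lambda>y. E y *\<^sub>R (k2 (x - y) $ i)) \<bullet> v)) (at x)"
        by (intro convolution_has_derivative[OF E]) 
      moreover have "integral (cbox a b) (\<lambda>y. E y *\<^sub>R k1 (x - y)) $ i = integral (cbox a b) (\<lambda>y. E y *\<^sub>R (k1 (x - y) $ i))" for x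
        using integral_linear[OF convolution_integrable[OF E k1c, of x] bounded_linear_vec_nth[of i]] by (simp add: o_def)
      moreover have "integral (cbox a b) (\<lambda>y. E y *\<^sub>R k2 (x - y)) $ i = integral (cbox a b) (\<lambda>y. E y *\<^sub>R (k2 (x - y) $ i))" for x
        using integral_linear[OF convolution_integrable[OF E k2c, of x] bounded_linear_vec_nth[of i]] by (simp add: o_def)
      ultimately show ?thesis by (simp add: matrix_vector_mul_component)
    qed
    then show ?thesis
      by (subst has_derivative_componentwise_within) (auto simp: Basis_vec_def inner_axis)
  qed
  moreover have "continuous_on UNIV (\<lambda>x. integral (cbox a b) (\<lambda>y. E y *\<^sub>R k2 (x - y)))"
    by (rule integral_continuous_on_param[OF continuous_on_convolution_integrand[OF E k2c]])
  ultimately show ?thesis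
    using convolution_has_derivative[OF E k1c kd] by (auto simp: C2_data_def)
qed

section \<open>Anisotropic heat kernels\<close>

lemma integrable_exp_minus_square:
  fixes c :: real assumes c: "0 < c" shows "integrable lborel (\<lambda>x::real. exp (- c * x^2))"
proof -
  define f :: "real \<Rightarrow> real" where "f x = indicator {0..} x * exp (- x)" for x
  have [measurable]: "f \<in> borel_measurable borel" unfolding f_def by measurable
  have "set_integrable lebesgue {0..} (\<lambda>x::real. exp (- 1 * x))"
    by (intro nonnegative_absolutely_integrable_1 integrable_on_exp_minus_to_infinity) auto
  then have "integrable lebesgue f" by (simp add: set_integrable_def f_def[abs_def])
  then have f: "integrable lborel f" by (simp add: integrable_completion)
  then have f': "integrable lborel (\<lambda>x. f (- x))"
    using lborel_integrable_real_affine[of f "-1" 0] by simp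
  have "integrable lborel (\<lambda>x. exp (1 / (4 * c)) * (f x + f (- x)))"
    by (intro integrable_mult_right Bochner_Integration.integrable_add f f')
  then show ?thesis
  proof (rule Bochner_Integration.integrable_bound)
    show "AE x in lborel. norm (exp (- c * x\<^sup>2)) \<le> norm (exp (1 / (4 * c)) * (f x + f (- x)))"
    proof (intro always_eventually allI)
      fix x :: real
      \<comment> \<open>Completing the square gives
        \<open>\<bar>x\<bar> \<le> 1 / (4 * c) + c * x^2\<close>, so a two-sided exponential
        dominates the Gaussian.\<close>
      have "0 \<le> (2 * c * \<bar>x\<bar> - 1)^2" by simp
      then have "\<bar>x\<bar> * (4 * c) \<le> 1 + 4 * c * c * x^2" by (simp add: power2_eq_square algebra_simps abs_mult_self_eq)
      then have "\<bar>x\<bar> \<le> (1 + 4 * c * c * x^2) / (4 * c)" using c by (simp add: pos_le_divide_eq)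
      also have "\<dots> = 1 / (4 * c) + c * x^2" using c by (simp add: field_simps)
      finally have "exp (- c * x\<^sup>2) \<le> exp (1 / (4 * c)) * exp (- \<bar>x\<bar>)" by (simp flip: exp_add)
      also have "\<dots> \<le> exp (1 / (4 * c)) * (f x + f (- x))"
        by (cases "0 \<le> x") (auto simp: f_def)
      finally show "norm (exp (- c * x\<^sup>2)) \<le> norm (exp (1 / (4 * c)) * (f x + f (- x)))"
        by (simp add: f_def)
    qed
  qed simp
qed

lemma integrable_exp_minus_norm_square:
  fixes c :: real assumes c: "0 < c"
  shows "integrable lborel (\<lambda>w::'a::euclidean_space. exp (- c * (norm w)^2))"
proof (rule integrableI_nonneg)
  have "(\<integral>\<^sup>+ x. ennreal (exp (- c * x^2)) \<partial>lborel) < \<infinity>"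
    using integrable_exp_minus_square[OF c] by (simp add: integrable_iff_bounded)
  then have fin: "(\<integral>\<^sup>+ x. ennreal (exp (- c * x^2)) \<partial>lborel) ^ DIM('a) < \<infinity>"
    by (simp add: power_less_top_ennreal)
  have eq: "exp (- c * (norm w)^2) = (\<Prod>b\<in>Basis. exp (- c * (w \<bullet> b)^2))" for w :: 'a
    by (simp add: exp_sum[symmetric] sum_distrib_left[symmetric] norm_eq_sqrt_inner
        euclidean_inner[of w w] power2_eq_square sum_negf sum_nonneg)
  have "(\<integral>\<^sup>+ w. ennreal (exp (- c * (norm (w::'a))^2)) \<partial>lborel)
      = (\<integral>\<^sup>+ w. (\<Prod>b\<in>Basis. ennreal (exp (- c * ((w::'a) \<bullet> b)^2))) \<partial>lborel)"
    unfolding eq by (simp add: prod_ennreal)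
  also have "\<dots> = (\<Prod>b\<in>(Basis::'a set). (\<integral>\<^sup>+ x. ennreal (exp (- c * x^2)) \<partial>lborel))"
    by (rule nn_integral_lborel_prod) auto
  finally show "(\<integral>\<^sup>+ w. ennreal (exp (- c * (norm (w::'a))^2)) \<partial>lborel) < \<infinity>" using fin by simp
qed auto

lemma lborel_integral_affine:
  fixes f :: "'a::euclidean_space \<Rightarrow> real"
  assumes c: "c \<noteq> 0" and [measurable]: "f \<in> borel_measurable borel"
  shows "(\<integral>y. f y \<partial>lborel) = \<bar>c\<bar> ^ DIM('a) * (\<integral>w. f (t + c *\<^sub>R w) \<partial>lborel)"
proof -
  have "(\<integral>y. f y \<partial>lborel) = (\<integral>y. f y \<partial>density (distr lborel borel (\<lambda>x. t + c *\<^sub>R x)) (\<lambda>_. ennreal (\<bar>c\<bar> ^ DIM('a))))"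
    using lborel_affine[OF c, of t] by simp
  also have "\<dots> = \<bar>c\<bar> ^ DIM('a) * (\<integral>w. f (t + c *\<^sub>R w) \<partial>lborel)"
    by (subst integral_density) (auto simp: integral_distr)
  finally show ?thesis .
qed

text \<open>Up to its mass, for positive definite \<open>H\<close>, the normal density with
  covariance \<open>2 *\<^sub>R matrix_inv H\<close>. This is the heat kernel of the driftless
  operator at time 1, whence the factor 4.\<close>

definition gaussian :: "real^'n^'n \<Rightarrow> real^'n \<Rightarrow> real" where
  "gaussian H w = exp (- (w \<bullet> (H *v w)) / 4)"

definition gaussian_mass :: "real^'n^'n \<Rightarrow> real" where
  "gaussian_mass H = (\<integral>w. gaussian H w \<partial>lborel)"

lemma gaussian_pos: "0 < gaussian H w" by (simp add: gaussian_def)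

lemma continuous_on_gaussian: "continuous_on S (gaussian H)"
  unfolding gaussian_def[abs_def] by (intro continuous_intros) auto

lemma measurable_gaussian [measurable]: "gaussian H \<in> borel_measurable borel"
  by (intro borel_measurable_continuous_onI continuous_on_gaussian)

lemma gaussian_even: "gaussian H (- w) = gaussian H w"
  by (simp add: gaussian_def linear_neg[OF matrix_vector_mul_linear])

lemma integrable_norm_power_gaussian:
  fixes H :: "real^'n^'n"
  assumes H: "posdef_matrix H" and s: "0 < s"
  shows "integrable lborel (\<lambda>w. norm w ^ j * exp (- s * (w \<bullet> (H *v w))))"
proof -
  obtain c where c: "0 < c" "\<And>v. c * (norm v)^2 \<le> v \<bullet> (H *v v)" using posdef_coercive[OF H] by blast
  \<comment> \<open>Half of the decay absorbs the factor \<open>norm w ^ j\<close>; the other half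
    remains as an integrable majorant.\<close>
  define d where "d = s * c / 2"
  have d: "0 < d" using s c by (simp add: d_def)
  obtain C where C: "\<And>x. 0 \<le> x \<Longrightarrow> x ^ j * exp (- d * x^2) \<le> C"
  proof -
    have "((\<lambda>x. x ^ j * exp (- d * x^2)) \<longlongrightarrow> 0) at_top" using d by real_asymp
    then have "\<forall>\<^sub>F x in at_top. x ^ j * exp (- d * x^2) < 1" by (rule order_tendstoD) simp
    then obtain X where X: "\<And>x. X \<le> x \<Longrightarrow> x ^ j * exp (- d * x^2) < 1" by (auto simp: eventually_at_top_linorder)
    have "x ^ j * exp (- d * x^2) \<le> max 1 (\<bar>X\<bar> ^ j)" if x: "0 \<le> x" for x
    proof (cases "X \<le> x")
      case False
      then have "x ^ j \<le> \<bar>X\<bar> ^ j" using x by (intro power_mono) auto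
      moreover have "x ^ j * exp (- d * x^2) \<le> x ^ j * 1" using x d by (intro mult_left_mono) auto
      ultimately show ?thesis by simp
    qed (use X in \<open>auto simp: less_imp_le max.coboundedI1\<close>)
    then show ?thesis using that by blast
  qed
  have "integrable lborel (\<lambda>w::real^'n. C * exp (- d * (norm w)^2))"
    by (intro integrable_mult_right integrable_exp_minus_norm_square d)
  then show ?thesis
  proof (rule Bochner_Integration.integrable_bound)
    show "(\<lambda>w. norm w ^ j * exp (- s * (w \<bullet> (H *v w)))) \<in> borel_measurable lborel"
      by (simp, intro borel_measurable_continuous_onI continuous_intros)
    show "AE w in lborel. norm (norm w ^ j * exp (- s * (w \<bullet> (H *v w)))) \<le> norm (C * exp (- d * (norm w)^2))"
    proof (intro always_eventually allI)
      fix w :: "real^'n"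
      have "- s * (w \<bullet> (H *v w)) \<le> - d * (norm w)^2 + - d * (norm w)^2"
        using mult_left_mono[OF c(2)[of w], of s] s by (simp add: d_def)
      then have "exp (- s * (w \<bullet> (H *v w))) \<le> exp (- d * (norm w)^2) * exp (- d * (norm w)^2)"
        by (simp only: exp_add[symmetric] exp_le_cancel_iff)
      then have "norm w ^ j * exp (- s * (w \<bullet> (H *v w))) \<le> norm w ^ j * (exp (- d * (norm w)^2) * exp (- d * (norm w)^2))"
        by (rule mult_left_mono) simp
      also have "\<dots> \<le> C * exp (- d * (norm w)^2)"
        unfolding mult.assoc[symmetric] by (intro mult_right_mono C) auto
      finally show "norm (norm w ^ j * exp (- s * (w \<bullet> (H *v w)))) \<le> norm (C * exp (- d * (norm w)^2))"
        by (smt (verit) exp_gt_zero mult_nonneg_nonneg norm_ge_zero real_norm_def zero_le_power)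
    qed
  qed
qed

lemma integrable_norm_power_mult_gaussian:
  assumes "posdef_matrix H" shows "integrable lborel (\<lambda>w. norm w ^ j * gaussian H w)"
  using integrable_norm_power_gaussian[OF assms, of "1/4" j] by (simp add: gaussian_def)

lemma integrable_gaussian:
  assumes "posdef_matrix H" shows "integrable lborel (gaussian H)"
  using integrable_norm_power_mult_gaussian[OF assms, of 0] by simp

lemma gaussian_mass_pos:
  assumes "posdef_matrix H" shows "0 < gaussian_mass H"
proof -
  have "emeasure lborel (space lborel :: (real^'a) set) \<noteq> 0" by simp
  moreover have "gaussian_mass H \<noteq> 0 \<and> 0 \<le> gaussian_mass H"
    unfolding gaussian_mass_def
    using integral_nonneg_eq_0_iff_AE[OF integrable_gaussian[OF assms]] gaussian_pos[of H]
    by (auto simp: less_imp_le less_imp_neq[THEN not_sym] AE_iff_measurable[OF _ refl])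
  ultimately show ?thesis by simp
qed

lemma trace_scaleR_right: "trace (A ** (c *\<^sub>R B)) = c * trace (A ** (B::real^'n^'n))"
  by (simp add: trace_def matrix_matrix_mult_def sum_distrib_left mult_ac)

lemma trace_diff_right: "trace (A ** (B - C)) = trace (A ** B) - trace (A ** (C::real^'n^'n))"
  by (simp add: trace_def matrix_matrix_mult_def algebra_simps sum_subtractf)

text \<open>The transition density of the operator \<open>tr (H\<inverse> D\<^sup>2) - \<beta> \<bullet> D\<close>, up to the constant factor
  \<open>gaussian_mass H\<close>.\<close>

definition heat_kernel :: "real^'n^'n \<Rightarrow> real^'n \<Rightarrow> real \<Rightarrow> real^'n \<Rightarrow> real" where
  "heat_kernel H \<beta> t z = exp (- ((z - t *\<^sub>R \<beta>) \<bullet> (H *v (z - t *\<^sub>R \<beta>))) / (4 * t)) / sqrt t ^ CARD('n)"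

definition heat_kernel_grad :: "real^'n^'n \<Rightarrow> real^'n \<Rightarrow> real \<Rightarrow> real^'n \<Rightarrow> real^'n" where
  "heat_kernel_grad H \<beta> t z = (- heat_kernel H \<beta> t z / (2 * t)) *\<^sub>R (H *v (z - t *\<^sub>R \<beta>))"

definition outer_product :: "real^'n \<Rightarrow> real^'n \<Rightarrow> real^'n^'n" where
  "outer_product p q = (\<chi> i j. p $ i * q $ j)"

definition heat_kernel_hess :: "real^'n^'n \<Rightarrow> real^'n \<Rightarrow> real \<Rightarrow> real^'n \<Rightarrow> real^'n^'n" where
  "heat_kernel_hess H \<beta> t z = heat_kernel H \<beta> t z *\<^sub>R
     ((1 / (4 * t^2)) *\<^sub>R outer_product (H *v (z - t *\<^sub>R \<beta>)) (H *v (z - t *\<^sub>R \<beta>)) - (1 / (2 * t)) *\<^sub>R H)"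

lemma continuous_on_matrix_vector [continuous_intros]:
  "continuous_on S f \<Longrightarrow> continuous_on S (\<lambda>x. (A::real^'n^'m) *v f x)"
  by (rule bounded_linear.continuous_on[OF matrix_vector_mul_bounded_linear])

lemma outer_product_mult_vec: "outer_product p q *v v = (q \<bullet> v) *\<^sub>R p"
  by (simp add: vec_eq_iff matrix_vector_mult_def outer_product_def inner_vec_def sum_distrib_right sum_distrib_left mult_ac)

lemma symmetric_inner: "transpose H = H \<Longrightarrow> u \<bullet> (H *v v) = v \<bullet> ((H::real^'n^'n) *v u)"
  by (metis dot_lmul_matrix inner_commute transpose_matrix_vector)

lemma symmetric_inner': "transpose H = H \<Longrightarrow> (H *v v) \<bullet> u = v \<bullet> ((H::real^'n^'n) *v u)"
  by (metis inner_commute symmetric_inner)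

lemma continuous_on_heat_kernel:
  "continuous_on ({0<..} \<times> UNIV) (\<lambda>(t, z). heat_kernel H \<beta> t z)"
  unfolding heat_kernel_def split_beta by (intro continuous_intros) auto

lemma heat_kernel_C2_data:
  assumes H: "transpose H = H" and t: "0 < t"
  shows "C2_data UNIV (heat_kernel H \<beta> t) (heat_kernel_grad H \<beta> t) (heat_kernel_hess H \<beta> t)"
proof -
  have q: "((\<lambda>z. (z - t *\<^sub>R \<beta>) \<bullet> (H *v (z - t *\<^sub>R \<beta>))) has_derivative
      (\<lambda>v. 2 * ((H *v (z - t *\<^sub>R \<beta>)) \<bullet> v))) (at z)" for z
    by (auto intro!: derivative_eq_intros bounded_linear.has_derivative[OF matrix_vector_mul_bounded_linear]
        simp: symmetric_inner'[OF H] symmetric_inner[OF H, of "z - t *\<^sub>R \<beta>"])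
  define Q where "Q z = (z - t *\<^sub>R \<beta>) \<bullet> (H *v (z - t *\<^sub>R \<beta>))" for z
  have q': "(Q has_derivative (\<lambda>v. 2 * ((H *v (z - t *\<^sub>R \<beta>)) \<bullet> v))) (at z)" for z
    using q by (simp add: Q_def[abs_def])
  have d0: "(heat_kernel H \<beta> t has_derivative (\<lambda>v. heat_kernel_grad H \<beta> t z \<bullet> v)) (at z)" for z
    unfolding heat_kernel_def[abs_def] heat_kernel_grad_def Q_def[symmetric]
    using t by (auto intro!: derivative_eq_intros q' simp: field_simps)
  have d1: "(heat_kernel_grad H \<beta> t has_derivative (\<lambda>v. heat_kernel_hess H \<beta> t z *v v)) (at z)" for z
  proof -
    have dc: "((\<lambda>z. - heat_kernel H \<beta> t z / (2 * t)) has_derivative (\<lambda>v. - (heat_kernel_grad H \<beta> t z \<bullet> v) / (2 * t))) (at z)"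
      using t by (auto intro!: derivative_eq_intros d0)
    have dv: "((\<lambda>z. H *v (z - t *\<^sub>R \<beta>)) has_derivative (\<lambda>v. H *v v)) (at z)"
      by (rule bounded_linear.has_derivative[OF matrix_vector_mul_bounded_linear]) (auto intro!: derivative_eq_intros)
    define w where "w = H *v (z - t *\<^sub>R \<beta>)"
    define k where "k = heat_kernel H \<beta> t z"
    have "(- k / (2 * t)) *\<^sub>R (H *v v) + (- (((- k / (2 * t)) *\<^sub>R w) \<bullet> v) / (2 * t)) *\<^sub>R w
        = heat_kernel_hess H \<beta> t z *v v" for v
      unfolding heat_kernel_hess_def w_def[symmetric] k_def[symmetric]
      by (simp add: matrix_vector_mult_diff_rdistrib scaleR_matrix_vector_assoc[symmetric] outer_product_mult_vec
          scaleR_diff_right power2_eq_square)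
    then show ?thesis unfolding heat_kernel_grad_def[of H \<beta> t, abs_def]
      using has_derivative_scaleR[OF dc dv]
      by (simp only: heat_kernel_grad_def w_def k_def)
  qed
  have "continuous_on UNIV (heat_kernel H \<beta> t)" using d0
    by (intro continuous_at_imp_continuous_on) (auto intro: has_derivative_continuous)
  then have "continuous_on UNIV (heat_kernel_hess H \<beta> t)"
    unfolding heat_kernel_hess_def[abs_def] outer_product_def by (intro continuous_intros)
  then show ?thesis using d0 d1 by (simp add: C2_data_def)
qed

text \<open>In the trace, the inverse cancels one factor \<open>H\<close> of the outer product. What
  is left is the quadratic form that the time derivative of the exponent produces; the term with
  \<open>CARD('n)\<close> matches the power of \<open>sqrt t\<close>.\<close>

lemma heat_kernel_time_derivative:
  fixes H :: "real^'n^'n"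
  assumes H: "posdef_matrix H" and t: "0 < t"
  shows "((\<lambda>t. heat_kernel H \<beta> t z) has_real_derivative
    (trace (matrix_inv H ** heat_kernel_hess H \<beta> t z) - \<beta> \<bullet> heat_kernel_grad H \<beta> t z)) (at t)"
proof -
  define \<zeta> where "\<zeta> = z - t *\<^sub>R \<beta>"
  define k where "k = heat_kernel H \<beta> t z"
  have sym: "transpose H = H" using H by (simp add: posdef_matrix_def)
  have tro: "trace (A ** outer_product p q) = q \<bullet> (A *v p)" for A and p q :: "real^'n"
    by (simp add: trace_def matrix_matrix_mult_def outer_product_def inner_vec_def matrix_vector_mult_def
        sum_distrib_left sum_distrib_right mult_ac)
  have "trace (matrix_inv H ** heat_kernel_hess H \<beta> t z)
     = k * (((H *v \<zeta>) \<bullet> (matrix_inv H *v (H *v \<zeta>))) / (4 * t^2) - CARD('n) / (2 * t))"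
    unfolding heat_kernel_hess_def trace_scaleR_right trace_diff_right tro trace_inverse_self[OF H] by (simp add: k_def \<zeta>_def)
  also have "matrix_inv H *v (H *v \<zeta>) = \<zeta>" by (simp add: matrix_vector_mul_assoc posdef_left_inverse[OF H])
  finally have L: "trace (matrix_inv H ** heat_kernel_hess H \<beta> t z) - \<beta> \<bullet> heat_kernel_grad H \<beta> t z
     = k * ((\<zeta> \<bullet> (H *v \<zeta>)) / (4 * t^2) - CARD('n) / (2 * t) + (\<beta> \<bullet> (H *v \<zeta>)) / (2 * t))"
    unfolding heat_kernel_grad_def by (simp add: k_def[symmetric] \<zeta>_def[symmetric] inner_commute algebra_simps)
  have dq: "((\<lambda>t. (z - t *\<^sub>R \<beta>) \<bullet> (H *v (z - t *\<^sub>R \<beta>))) has_real_derivative - 2 * (\<beta> \<bullet> (H *v \<zeta>))) (at t)"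
    unfolding has_field_derivative_def \<zeta>_def
    by (auto intro!: derivative_eq_intros bounded_linear.has_derivative[OF matrix_vector_mul_bounded_linear]
        simp: symmetric_inner[OF sym, of "z - t *\<^sub>R \<beta>" \<beta>] matrix_vector_mult_scaleR fun_eq_iff linear_neg[OF matrix_vector_mul_linear])
  define q where "q t = (z - t *\<^sub>R \<beta>) \<bullet> (H *v (z - t *\<^sub>R \<beta>))" for t
  have qt: "q t = \<zeta> \<bullet> (H *v \<zeta>)" by (simp add: q_def \<zeta>_def)
  have dq': "(q has_real_derivative - 2 * (\<beta> \<bullet> (H *v \<zeta>))) (at t)" using dq by (simp add: q_def[abs_def])
  \<comment> \<open>Writing the power of \<open>sqrt t\<close> with a logarithm puts the whole time
    dependence into one exponent.\<close>
  have kq: "heat_kernel H \<beta> t z = exp (- q t / (4 * t) - CARD('n) / 2 * ln t)" if "0 < t" for t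
    using that by (simp add: heat_kernel_def q_def exp_diff exp_of_nat_mult[symmetric] powr_half_sqrt[symmetric] powr_def
        exp_of_nat_mult)
  have kk: "k = exp (- (\<zeta> \<bullet> (H *v \<zeta>)) / (4 * t) - CARD('n) / 2 * ln t)"
    using kq[OF t] by (simp add: k_def qt)
  have "((\<lambda>t. exp (- q t / (4 * t) - CARD('n) / 2 * ln t)) has_real_derivative
     k * ((\<zeta> \<bullet> (H *v \<zeta>)) / (4 * t^2) - CARD('n) / (2 * t) + (\<beta> \<bullet> (H *v \<zeta>)) / (2 * t))) (at t)"
    using t by (auto intro!: derivative_eq_intros dq' simp: kk qt field_simps power2_eq_square)
  then have "((\<lambda>t. heat_kernel H \<beta> t z) has_real_derivative
     k * ((\<zeta> \<bullet> (H *v \<zeta>)) / (4 * t^2) - CARD('n) / (2 * t) + (\<beta> \<bullet> (H *v \<zeta>)) / (2 * t))) (at t)"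
    by (rule has_field_derivative_transform_within_open[of _ _ _ "{0<..}"]) (use t kq in auto)
  then show ?thesis unfolding L .
qed

section \<open>The heat mean value inequality\<close>

lemma bounded_linear_trace_mult: "bounded_linear (\<lambda>X::real^'n^'n. trace (A ** X))"
proof -
  have "linear (\<lambda>X::real^'n^'n. trace (A ** X))"
    by (rule linearI) (simp_all add: matrix_add_ldistrib trace_add trace_scaleR_right)
  then show ?thesis by (simp add: linear_conv_bounded_linear)
qed

text \<open>Cutting \<open>E\<close> off by zero outside the box turns convolutions over the box
  into integrals over the whole space, where translations, scalings and reflections act freely. The
  cut-off function is bounded and measurable, but in general discontinuous.\<close>

locale bounded_extension =
  fixes a b :: "real^'n" and E :: "real^'n \<Rightarrow> real" and M :: real
  assumes E: "continuous_on (cbox a b) E"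
    and bound: "\<And>y. y \<in> cbox a b \<Longrightarrow> \<bar>E y\<bar> \<le> M" and M: "0 \<le> M"
begin

definition zero_ext where "zero_ext y = indicator (cbox a b) y * E y"

lemma measurable_zero_ext [measurable]: "zero_ext \<in> borel_measurable borel"
proof -
  have "(\<lambda>y. indicator (cbox a b) y *\<^sub>R E y) \<in> borel_measurable borel"
    by (intro borel_measurable_continuous_on_indicator E) auto
  then show ?thesis by (simp add: zero_ext_def[abs_def])
qed

lemma zero_ext_bound: "\<bar>zero_ext y\<bar> \<le> M"
  using bound[of y] M by (auto simp: zero_ext_def indicator_def)

end

text \<open>In the application \<open>H\<close> is the enlarged Hessian of a mollification at one
  point and \<open>\<beta>\<close> a multiple of the gradient of \<open>|q|^p\<close>, so the
  evolution of \<open>E\<close> has constant coefficients.\<close>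

locale heat_extension = bounded_extension a b E M
  for a b :: "real^'n" and E :: "real^'n \<Rightarrow> real" and M :: real +
  fixes H :: "real^'n^'n" and \<beta> :: "real^'n"
  assumes H: "posdef_matrix H"
begin

definition heat_ext where
  "heat_ext t x = (1 / gaussian_mass H) * integral (cbox a b) (\<lambda>y. E y * heat_kernel H \<beta> t (x - y))"

definition heat_ext_grad where
  "heat_ext_grad t x = (1 / gaussian_mass H) *\<^sub>R integral (cbox a b) (\<lambda>y. E y *\<^sub>R heat_kernel_grad H \<beta> t (x - y))"

definition heat_ext_hess where
  "heat_ext_hess t x = (1 / gaussian_mass H) *\<^sub>R integral (cbox a b) (\<lambda>y. E y *\<^sub>R heat_kernel_hess H \<beta> t (x - y))"

lemma kernel: "0 < t \<Longrightarrow> C2_data UNIV (heat_kernel H \<beta> t) (heat_kernel_grad H \<beta> t) (heat_kernel_hess H \<beta> t)"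
  using H by (intro heat_kernel_C2_data) (auto simp: posdef_matrix_def)

lemma heat_ext_C2_data: "0 < t \<Longrightarrow> C2_data UNIV (heat_ext t) (heat_ext_grad t) (heat_ext_hess t)"
  unfolding heat_ext_def[abs_def] heat_ext_grad_def[abs_def] heat_ext_hess_def[abs_def]
  by (intro C2_data_scale convolution_C2_data[OF E] kernel)

lemma kernel_continuous:
  assumes "0 < t"
  shows "continuous_on UNIV (heat_kernel H \<beta> t)" "continuous_on UNIV (heat_kernel_grad H \<beta> t)"
    "continuous_on UNIV (heat_kernel_hess H \<beta> t)"
  using kernel[OF assms] C2_data_continuous[OF kernel[OF assms]] by (auto simp: C2_data_def)

definition generator where
  "generator g h = trace (matrix_inv H ** h) - \<beta> \<bullet> g"

lemma bounded_linear_generator: "bounded_linear (\<lambda>(g, h). generator g h)"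
proof -
  have "bounded_linear (\<lambda>p. trace (matrix_inv H ** snd p) - \<beta> \<bullet> fst p)"
    by (intro bounded_linear_sub bounded_linear_compose[OF bounded_linear_trace_mult]
        bounded_linear_compose[OF bounded_linear_inner_right] bounded_linear_fst bounded_linear_snd)
  then show ?thesis unfolding generator_def case_prod_unfold .
qed

lemma continuous_on_kernel_joint:
  "continuous_on (({0<..} \<times> UNIV) \<times> cbox a b) (\<lambda>(p, y). E y * heat_kernel H \<beta> (fst p) (snd p - y))"
proof -
  have "continuous_on (({0<..} \<times> UNIV) \<times> cbox a b) (\<lambda>q. E (snd q))"
    by (rule continuous_on_compose2[OF E]) (auto intro!: continuous_intros)
  moreover have "continuous_on (({0<..} \<times> UNIV) \<times> cbox a b)
      (\<lambda>q. case (fst (fst q), snd (fst q) - snd q) of (t, z) \<Rightarrow> heat_kernel H \<beta> t z)"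
    by (rule continuous_on_compose2[OF continuous_on_heat_kernel]) (auto intro!: continuous_intros)
  ultimately show ?thesis by (auto simp: split_beta intro!: continuous_intros)
qed

lemma continuous_on_heat_ext: "continuous_on ({0<..} \<times> UNIV) (\<lambda>(t, x). heat_ext t x)"
  unfolding heat_ext_def split_beta
  using integral_continuous_on_param[OF continuous_on_kernel_joint]
  by (intro continuous_intros) 

lemma heat_ext_time_derivative:
  assumes t: "0 < t"
  shows "((\<lambda>t. heat_ext t x) has_real_derivative generator (heat_ext_grad t x) (heat_ext_hess t x)) (at t)"
proof -
  let ?d = "\<lambda>t y. E y * generator (heat_kernel_grad H \<beta> t (x - y)) (heat_kernel_hess H \<beta> t (x - y))"
  have "((\<lambda>t. integral (cbox a b) (\<lambda>y. E y * heat_kernel H \<beta> t (x - y))) has_field_derivative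
      integral (cbox a b) (?d t)) (at t within {0<..})"
  proof (rule leibniz_rule_field_derivative)
    fix s y assume s: "s \<in> {0::real<..}"
    have "((\<lambda>t. heat_kernel H \<beta> t (x - y)) has_real_derivative
        generator (heat_kernel_grad H \<beta> s (x - y)) (heat_kernel_hess H \<beta> s (x - y))) (at s within {0<..})"
      unfolding generator_def
      by (rule has_field_derivative_at_within, rule heat_kernel_time_derivative[OF H]) (use s in simp)
    then show "((\<lambda>t. E y * heat_kernel H \<beta> t (x - y)) has_field_derivative ?d s y) (at s within {0<..})"
      by (rule DERIV_cmult)
  next
    fix s assume s: "s \<in> {0::real<..}"
    show "(\<lambda>y. E y * heat_kernel H \<beta> s (x - y)) integrable_on cbox a b"
      using convolution_integrable[OF E kernel_continuous(1), of s x] s by simp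
  next
    have cE: "continuous_on ({0<..} \<times> cbox a b) (\<lambda>q. E (snd q))"
      by (rule continuous_on_compose2[OF E]) (auto intro!: continuous_intros)
    have ck: "continuous_on ({0<..} \<times> cbox a b) (\<lambda>q. heat_kernel H \<beta> (fst q) (x - snd q))"
    proof -
      have "continuous_on ({0<..} \<times> cbox a b) (\<lambda>q. case (fst q, x - snd q) of (t, z) \<Rightarrow> heat_kernel H \<beta> t z)"
        by (rule continuous_on_compose2[OF continuous_on_heat_kernel]) (auto intro!: continuous_intros)
      then show ?thesis by simp
    qed
    have cg: "continuous_on ({0<..} \<times> cbox a b) (\<lambda>q. heat_kernel_grad H \<beta> (fst q) (x - snd q))"
      unfolding heat_kernel_grad_def by (intro continuous_intros ck) auto
    have ch: "continuous_on ({0<..} \<times> cbox a b) (\<lambda>q. heat_kernel_hess H \<beta> (fst q) (x - snd q))"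
      unfolding heat_kernel_hess_def outer_product_def by (intro continuous_intros ck) auto
    show "continuous_on ({0<..} \<times> cbox a b) (\<lambda>(t, y). ?d t y)"
      using bounded_linear.continuous_on[OF bounded_linear_generator continuous_on_Pair[OF cg ch]] cE
      by (auto simp: split_beta intro!: continuous_intros)
  qed (use t in auto)
  then have d: "((\<lambda>t. integral (cbox a b) (\<lambda>y. E y * heat_kernel H \<beta> t (x - y))) has_field_derivative
      integral (cbox a b) (?d t)) (at t)"
    using t by (simp add: at_within_open[of _ "{0<..}"])
  have ci: "(\<lambda>y. E y *\<^sub>R heat_kernel_grad H \<beta> t (x - y)) integrable_on cbox a b"
    "(\<lambda>y. E y *\<^sub>R heat_kernel_hess H \<beta> t (x - y)) integrable_on cbox a b"
    by (intro convolution_integrable[OF E] kernel_continuous t)+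
  have "integral (cbox a b) (?d t) = generator (integral (cbox a b) (\<lambda>y. E y *\<^sub>R heat_kernel_grad H \<beta> t (x - y)))
      (integral (cbox a b) (\<lambda>y. E y *\<^sub>R heat_kernel_hess H \<beta> t (x - y)))"
  proof -
    have "integral (cbox a b) (?d t) = integral (cbox a b) (\<lambda>y. trace (matrix_inv H ** (E y *\<^sub>R heat_kernel_hess H \<beta> t (x - y))))
        - integral (cbox a b) (\<lambda>y. \<beta> \<bullet> (E y *\<^sub>R heat_kernel_grad H \<beta> t (x - y)))"
      using integrable_linear[OF ci(1) bounded_linear_inner_right[of \<beta>]]
        integrable_linear[OF ci(2) bounded_linear_trace_mult[of "matrix_inv H"]]
      by (subst integral_diff[symmetric]) (auto simp: o_def generator_def trace_scaleR_right algebra_simps)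
    then show ?thesis
      using integral_linear[OF ci(1) bounded_linear_inner_right[of \<beta>]]
        integral_linear[OF ci(2) bounded_linear_trace_mult[of "matrix_inv H"]]
      by (simp add: o_def generator_def)
  qed
  then have "generator (heat_ext_grad t x) (heat_ext_hess t x) = (1 / gaussian_mass H) * integral (cbox a b) (?d t)"
    by (simp add: generator_def heat_ext_grad_def heat_ext_hess_def trace_scaleR_right diff_divide_distrib)
  then show ?thesis unfolding heat_ext_def using DERIV_cmult[OF d] by (simp only:)
qed

lemma integrable_bounded_gaussian:
  assumes [measurable]: "f \<in> borel_measurable borel" and f: "\<And>w. \<bar>f w\<bar> \<le> K"
  shows "integrable lborel (\<lambda>w. f w * gaussian H w)"
proof (rule Bochner_Integration.integrable_bound)
  show "integrable lborel (\<lambda>w. K * gaussian H w)" by (intro integrable_mult_right integrable_gaussian H)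
  show "AE w in lborel. norm (f w * gaussian H w) \<le> norm (K * gaussian H w)"
    using f by (intro always_eventually) (auto simp: abs_mult intro!: mult_right_mono order_trans[OF f abs_ge_self])
qed measurable

text \<open>The substitution \<open>y = x - t *\<^sub>R \<beta> - sqrt t *\<^sub>R w\<close> moves
  all dependence on time and place into the argument of \<open>zero_ext\<close> and leaves a fixed
  even weight.\<close>

lemma heat_ext_gaussian:
  assumes t: "0 < t"
  shows "heat_ext t x = (\<integral>w. zero_ext (x - t *\<^sub>R \<beta> - sqrt t *\<^sub>R w) * gaussian H w \<partial>lborel) / gaussian_mass H"
proof -
  let ?f = "\<lambda>y. zero_ext y * heat_kernel H \<beta> t (x - y)"
  have ck: "continuous_on S (\<lambda>y. heat_kernel H \<beta> t (x - y))" for S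
    by (rule continuous_on_compose2[OF kernel_continuous(1)[OF t]]) (auto intro!: continuous_intros)
  have [measurable]: "(\<lambda>y. heat_kernel H \<beta> t (x - y)) \<in> borel_measurable borel"
    by (intro borel_measurable_continuous_onI ck)
  have si: "set_integrable lborel (cbox a b) (\<lambda>y. E y * heat_kernel H \<beta> t (x - y))"
    unfolding set_integrable_def by (intro borel_integrable_compact compact_cbox continuous_intros E ck)
  have "integral (cbox a b) (\<lambda>y. E y * heat_kernel H \<beta> t (x - y)) = (\<integral>y. ?f y \<partial>lborel)"
    using set_borel_integral_eq_integral(2)[OF si] by (simp add: set_lebesgue_integral_def zero_ext_def mult.assoc)
  also have "\<dots> = sqrt t ^ CARD('n) * (\<integral>w. ?f (x - t *\<^sub>R \<beta> + (- sqrt t) *\<^sub>R w) \<partial>lborel)"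
    using t lborel_integral_affine[of "- sqrt t" ?f "x - t *\<^sub>R \<beta>"] by simp
  also have "\<dots> = (\<integral>w. sqrt t ^ CARD('n) * ?f (x - t *\<^sub>R \<beta> + (- sqrt t) *\<^sub>R w) \<partial>lborel)"
    by simp
  also have "\<dots> = (\<integral>w. zero_ext (x - t *\<^sub>R \<beta> - sqrt t *\<^sub>R w) * gaussian H w \<partial>lborel)"
  proof (rule Bochner_Integration.integral_cong)
    fix w
    have "heat_kernel H \<beta> t (t *\<^sub>R \<beta> + sqrt t *\<^sub>R w) = gaussian H w / sqrt t ^ CARD('n)"
      using t by (simp add: heat_kernel_def gaussian_def matrix_vector_mult_scaleR flip: mult.assoc)
    then show "sqrt t ^ CARD('n) * ?f (x - t *\<^sub>R \<beta> + (- sqrt t) *\<^sub>R w)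
        = zero_ext (x - t *\<^sub>R \<beta> - sqrt t *\<^sub>R w) * gaussian H w"
      using t by (simp add: algebra_simps)
  qed simp
  finally show ?thesis by (simp add: heat_ext_def)
qed

lemma heat_ext_lower_bound:
  assumes sub: "\<Omega> \<subseteq> cbox a b" and conv: "convex_on \<Omega> E" and r: "0 < r"
    and D: "\<And>x. x \<in> D \<Longrightarrow> ball x r \<subseteq> \<Omega>"
  shows "\<exists>C T. 0 \<le> C \<and> 0 < T \<and> (\<forall>t x. 0 < t \<and> t \<le> T \<and> x \<in> D \<longrightarrow> E x - C * t \<le> heat_ext t x)"
proof -
  define N where "N = norm \<beta> + 1"
  define \<rho> where "\<rho> = r / (2 * N)"
  have nb: "0 < N" by (simp add: N_def add_nonneg_pos)
  have \<rho>: "0 < \<rho>" using r nb by (simp add: \<rho>_def)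
  have \<rho>\<beta>: "\<rho> * norm \<beta> < r / 2" 
  proof -
    have "\<rho> * norm \<beta> < \<rho> * N" using \<rho> by (simp add: N_def)
    also have "\<dots> = r / 2" using nb by (simp add: \<rho>_def)
    finally show ?thesis .
  qed
  define m2 where "m2 = (\<integral>w. norm w ^ 2 * gaussian H w \<partial>lborel)"
  let ?Z = "gaussian_mass H"
  have Z: "0 < ?Z" by (rule gaussian_mass_pos[OF H])
  have m2: "0 \<le> m2" unfolding m2_def by (intro Bochner_Integration.integral_nonneg) (auto simp: gaussian_def)
  \<comment> \<open>For \<open>norm h \<ge> r / 2\<close> the term \<open>C2 * (norm h)^2\<close> is
    at least \<open>2 * M\<close>, the largest oscillation that the cut-off function can
    have.\<close>
  define C2 where "C2 = 8 * M / r^2"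
  have C2: "0 \<le> C2" using M by (simp add: C2_def)
  define C where "C = 2 * M / \<rho> + C2 * m2 / ?Z"
  have C: "0 \<le> C" using M \<rho> m2 C2 Z by (simp add: C_def)
  have "E x - C * t \<le> heat_ext t x" if t: "0 < t" "t \<le> \<rho>" and x: "x \<in> D" for t x
  proof -
    define c where "c = x - t *\<^sub>R \<beta>"
    have xball: "ball x r \<subseteq> \<Omega>" by (rule D[OF x])
    have cx: "dist x c < r / 2"
    proof -
      have "dist x c = t * norm \<beta>" using t by (simp add: c_def dist_norm)
      also have "\<dots> \<le> \<rho> * norm \<beta>" using t by (intro mult_right_mono) auto
      finally show ?thesis using \<rho>\<beta> by simp
    qed
    have inO: "c + h \<in> \<Omega>" if "norm h < r / 2" for h
    proof -
      have "dist x (c + h) \<le> dist x c + dist c (c + h)" by (rule dist_triangle)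
      also have "dist c (c + h) = norm h" by (simp add: dist_norm)
      also have "dist x c + norm h < r" using cx that by simp
      finally show ?thesis using xball by auto
    qed
    have cO: "c \<in> \<Omega>" using inO[of 0] r by simp
    have xO: "x \<in> \<Omega>" using xball r by auto
    have i: "E x - 2 * M / \<rho> * t \<le> E c"
    proof -
      \<comment> \<open>The point \<open>e\<close> lies beyond \<open>x\<close> as seen from the
        displaced centre \<open>c\<close>, so convexity bounds \<open>E x - E c\<close> by
        \<open>t / \<rho>\<close> times the oscillation \<open>2 * M\<close>.\<close>
      define e where "e = x + \<rho> *\<^sub>R \<beta>"
      have eO: "e \<in> \<Omega>" using xball \<rho>\<beta> \<rho> r by (auto simp: e_def dist_norm subset_iff)
      have s: "0 < \<rho> + t" using \<rho> t by simp
      have "x = (\<rho> / (\<rho> + t)) *\<^sub>R c + (t / (\<rho> + t)) *\<^sub>R e"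
      proof -
        have "(\<rho> + t) *\<^sub>R ((\<rho> / (\<rho> + t)) *\<^sub>R c + (t / (\<rho> + t)) *\<^sub>R e) = \<rho> *\<^sub>R c + t *\<^sub>R e"
          using s by (simp add: scaleR_add_right)
        also have "\<dots> = (\<rho> + t) *\<^sub>R x" by (simp add: c_def e_def algebra_simps)
        finally show ?thesis using s by (metis less_irrefl scaleR_cancel_left)
      qed
      moreover have "1 - t / (\<rho> + t) = \<rho> / (\<rho> + t)" "t / (\<rho> + t) \<le> 1" "0 \<le> t / (\<rho> + t)"
        using s t \<rho> by (simp_all add: field_simps)
      ultimately have "E x \<le> (\<rho> / (\<rho> + t)) * E c + (t / (\<rho> + t)) * E e"
        using convex_onD[OF conv, of "t / (\<rho> + t)" c e] cO eO by simp
      also have "\<dots> = (\<rho> * E c + t * E e) / (\<rho> + t)" by (simp add: add_divide_distrib)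
      finally have "(\<rho> + t) * E x \<le> \<rho> * E c + t * E e"
        using s by (simp add: pos_le_divide_eq mult.commute)
      moreover have "t * E e \<le> t * M" "- (t * M) \<le> t * E x"
        using bound[of e] bound[of x] eO xO sub t by (auto simp: abs_le_iff mult_left_mono minus_le_iff intro!: mult_left_mono)
           (smt (verit) mult_left_mono mult_minus_right subsetD)
      ultimately have "\<rho> * E x - 2 * M * t \<le> \<rho> * E c" by (simp add: algebra_simps)
      then show ?thesis using \<rho> by (simp add: field_simps)
    qed
    have ii: "E c - C2 * (norm h)^2 \<le> (zero_ext (c - h) + zero_ext (c + h)) / 2" for h
    proof (cases "norm h < r / 2")
      case True
      have O: "c + h \<in> \<Omega>" "c - h \<in> \<Omega>" using inO[of h] inO[of "- h"] True by auto
      have "c = (1 - 1/2) *\<^sub>R (c - h) + (1/2) *\<^sub>R (c + h)" by (simp add: algebra_simps flip: scaleR_add_left)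
      then have "E c \<le> (E (c - h) + E (c + h)) / 2"
        using convex_onD[OF conv, of "1/2" "c - h" "c + h"] O by simp
      moreover have "zero_ext (c - h) = E (c - h)" "zero_ext (c + h) = E (c + h)" using O sub by (auto simp: zero_ext_def)
      moreover have "E c - C2 * (norm h)^2 \<le> E c" using C2 by simp
      ultimately show ?thesis by simp
    next
      case False
      then have "(r / 2)^2 \<le> (norm h)^2" using r by (intro power_mono) auto
      then have "C2 * (r / 2)^2 \<le> C2 * (norm h)^2" using C2 by (rule mult_left_mono)
      moreover have "C2 * (r / 2)^2 = 2 * M" using r by (simp add: C2_def power2_eq_square)
      moreover have "E c \<le> M" using bound[of c] cO sub by auto
      moreover have "- M \<le> zero_ext (c - h)" "- M \<le> zero_ext (c + h)"
        using zero_ext_bound[of "c - h"] zero_ext_bound[of "c + h"] by (simp_all only: abs_le_iff) linarith+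
      ultimately show ?thesis by (simp add: field_simps)
    qed
    let ?I = "\<lambda>s. \<integral>w. zero_ext (c - s *\<^sub>R w) * gaussian H w \<partial>lborel"
    have int: "integrable lborel (\<lambda>w. zero_ext (c - s *\<^sub>R w) * gaussian H w)" for s
      by (rule integrable_bounded_gaussian[where K=M]) (auto simp: zero_ext_bound)
    have int': "integrable lborel (\<lambda>w. zero_ext (c + s *\<^sub>R w) * gaussian H w)" for s
      by (rule integrable_bounded_gaussian[where K=M]) (auto simp: zero_ext_bound)
    \<comment> \<open>Evenness of the Gaussian lets the values at \<open>c - h\<close> and
      \<open>c + h\<close> be paired.\<close>
    have refl: "?I (sqrt t) = (\<integral>w. zero_ext (c + sqrt t *\<^sub>R w) * gaussian H w \<partial>lborel)"
      using lborel_integral_affine[of "-1" "\<lambda>w. zero_ext (c - sqrt t *\<^sub>R w) * gaussian H w" 0]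
      by (simp add: gaussian_even)
    have "(\<integral>w. (E c - C2 * (norm (sqrt t *\<^sub>R w))^2) * gaussian H w \<partial>lborel)
       \<le> (\<integral>w. (zero_ext (c - sqrt t *\<^sub>R w) + zero_ext (c + sqrt t *\<^sub>R w)) / 2 * gaussian H w \<partial>lborel)"
    proof (rule integral_mono)
      have "integrable lborel (\<lambda>w. E c * gaussian H w - C2 * t * (norm w ^ 2 * gaussian H w))"
        by (intro Bochner_Integration.integrable_diff integrable_mult_right integrable_gaussian integrable_norm_power_mult_gaussian H)
      then show "integrable lborel (\<lambda>w. (E c - C2 * (norm (sqrt t *\<^sub>R w))^2) * gaussian H w)"
        using t by (simp add: power_mult_distrib algebra_simps)
      have "integrable lborel (\<lambda>w. 1/2 * (zero_ext (c - sqrt t *\<^sub>R w) * gaussian H w + zero_ext (c + sqrt t *\<^sub>R w) * gaussian H w))"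
        by (intro integrable_mult_right Bochner_Integration.integrable_add int int')
      then show "integrable lborel (\<lambda>w. (zero_ext (c - sqrt t *\<^sub>R w) + zero_ext (c + sqrt t *\<^sub>R w)) / 2 * gaussian H w)"
        by (rule back_subst[of "integrable lborel"]) (simp add: fun_eq_iff algebra_simps)
    qed (intro mult_right_mono ii gaussian_pos[THEN less_imp_le])
    also have "(\<integral>w. (zero_ext (c - sqrt t *\<^sub>R w) + zero_ext (c + sqrt t *\<^sub>R w)) / 2 * gaussian H w \<partial>lborel)
        = (\<integral>w. 1/2 * (zero_ext (c - sqrt t *\<^sub>R w) * gaussian H w + zero_ext (c + sqrt t *\<^sub>R w) * gaussian H w) \<partial>lborel)"
      by (intro Bochner_Integration.integral_cong) (auto simp: algebra_simps)
    also have "\<dots> = ?I (sqrt t)"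
      by (subst integral_mult_right_zero, subst Bochner_Integration.integral_add[OF int int']) (simp add: refl)
    also have "(\<integral>w. (E c - C2 * (norm (sqrt t *\<^sub>R w))^2) * gaussian H w \<partial>lborel)
        = (\<integral>w. E c * gaussian H w - C2 * t * (norm w ^ 2 * gaussian H w) \<partial>lborel)"
      using t by (intro Bochner_Integration.integral_cong) (auto simp: power_mult_distrib algebra_simps)
    also have "\<dots> = E c * ?Z - C2 * t * m2"
      unfolding gaussian_mass_def m2_def
      by (subst Bochner_Integration.integral_diff)
         (auto intro!: integrable_mult_right integrable_gaussian integrable_norm_power_mult_gaussian H)
    finally have "(E c * ?Z - C2 * t * m2) / ?Z \<le> heat_ext t x"
      unfolding heat_ext_gaussian[OF t(1)] c_def[symmetric] using Z by (intro divide_right_mono) auto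
    then have "E c - C2 * m2 / ?Z * t \<le> heat_ext t x" using Z by (simp add: diff_divide_distrib mult_ac)
    then show ?thesis using i by (simp add: C_def algebra_simps)
  qed
  then show ?thesis using C \<rho> by blast
qed

text \<open>A parabolic maximum principle for \<open>E - heat_ext t + (t - t0) (g0 - N |x - x1|\<^sup>2 - \<kappa>)\<close> on a cylinder around
  \<open>x1\<close>: at an interior maximum the viscosity condition bounds the generator from below and the time
  derivative bounds it from above. The constant \<open>N\<close> makes the function small on the lateral boundary, and
  convexity makes it small at the initial time \<open>t0\<close>, which tends to \<open>0\<close>.\<close>

lemma heat_mean_value:
  assumes O: "open \<Omega>" and sub: "\<Omega> \<subseteq> cbox a b" and conv: "convex_on \<Omega> E" and r: "0 < r"
    and D: "\<And>x. x \<in> D \<Longrightarrow> ball x (3 * r) \<subseteq> \<Omega>"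
    and visc: "\<And>x1 x \<phi>. x1 \<in> D \<Longrightarrow> x \<in> ball x1 r \<Longrightarrow> C2_on \<Omega> \<phi> \<Longrightarrow>
      local_max_in \<Omega> (\<lambda>y. E y - \<phi> y) x \<Longrightarrow> g0 \<le> generator (gradient \<phi> x) (hessian \<phi> x)"
  shows "\<exists>S T0. 0 < T0 \<and> (\<forall>T x. 0 < T \<and> T \<le> T0 \<and> x \<in> D \<longrightarrow> E x + T * g0 - S * T^2 \<le> heat_ext T x)"
proof -
  define D' where "D' = (\<Union>x\<in>D. cball x r)"
  have "ball x r \<subseteq> \<Omega>" if x: "x \<in> D'" for x
  proof -
    obtain x1 where x1: "x1 \<in> D" "dist x1 x \<le> r" using x by (auto simp: D'_def)
    have "y \<in> ball x1 (3 * r)" if "y \<in> ball x r" for y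
      using dist_triangle[of x1 y x] x1(2) that r by (simp add: dist_commute)
    then show ?thesis using D[OF x1(1)] by blast
  qed
  from heat_ext_lower_bound[OF sub conv r this] obtain C T0 where
    C: "0 \<le> C" and T0: "0 < T0" and low0: "\<forall>t x. 0 < t \<and> t \<le> T0 \<and> x \<in> D' \<longrightarrow> E x - C * t \<le> heat_ext t x"
    by metis
  have low: "E x - C * t \<le> heat_ext t x" if "0 < t" "t \<le> T0" "x \<in> D'" for t x using low0 that by simp
  define N where "N = (\<bar>g0\<bar> + C) / r^2"
  have N: "0 \<le> N" using C r by (simp add: N_def)
  have Nr: "g0 - N * r^2 \<le> - C" using r by (simp add: N_def)
  define S' where "S' = 2 * N * \<bar>trace (matrix_inv H)\<bar> + 2 * N * norm \<beta> * r"
  have S': "0 \<le> S'" using N r by (simp add: S'_def)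
  have "E x1 + T * g0 - (S' + 1) * T^2 \<le> heat_ext T x1" if T: "0 < T" "T \<le> T0" and x1: "x1 \<in> D" for T x1
  proof -
    \<comment> \<open>The penalty disturbs the generator by at most \<open>T * S'\<close>; the extra
      \<open>T\<close> makes the contradiction strict. Over a time span \<open>T\<close> this costs
      \<open>(S' + 1) * T^2\<close>, the quadratic error in the claim.\<close>
    define \<kappa> where "\<kappa> = T * (S' + 1)"
    have \<kappa>: "0 < \<kappa>" using T S' by (simp add: \<kappa>_def)
    define \<theta> where "\<theta> x = g0 - N * (norm (x - x1))^2" for x
    have key: "E x1 - heat_ext T x1 + (T - t0) * (g0 - \<kappa>) \<le> C * t0" if t0: "0 < t0" "t0 < T" for t0
    proof (rule ccontr)
      define \<Phi> where "\<Phi> t x = E x - heat_ext t x + (t - t0) * (\<theta> x - \<kappa>)" for t x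
      assume "\<not> E x1 - heat_ext T x1 + (T - t0) * (g0 - \<kappa>) \<le> C * t0"
      then have big: "C * t0 < \<Phi> T x1" by (simp add: \<Phi>_def \<theta>_def)
      let ?K = "{t0..T} \<times> cball x1 r"
      have cb: "cball x1 r \<subseteq> \<Omega>" using D[OF x1] r by (force simp: subset_iff)
      have cont: "continuous_on ?K (\<lambda>p. \<Phi> (fst p) (snd p))"
      proof -
        have "continuous_on ?K (\<lambda>p. E (snd p))"
          by (rule continuous_on_compose2[OF E]) (use cb sub in \<open>auto intro!: continuous_intros\<close>)
        moreover have "continuous_on ?K (\<lambda>p. case (fst p, snd p) of (t, x) \<Rightarrow> heat_ext t x)"
          by (rule continuous_on_compose2[OF continuous_on_heat_ext]) (use t0 in \<open>auto intro!: continuous_intros\<close>)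
        ultimately show ?thesis unfolding \<Phi>_def \<theta>_def case_prod_beta fst_conv snd_conv
          by (intro continuous_intros)
      qed
      have "compact ?K" by (intro compact_Times compact_Icc compact_cball)
      moreover have "?K \<noteq> {}" using t0 r by auto
      ultimately obtain p where p: "p \<in> ?K" "\<And>q. q \<in> ?K \<Longrightarrow> \<Phi> (fst q) (snd q) \<le> \<Phi> (fst p) (snd p)"
        using continuous_attains_sup[OF _ _ cont] by blast
      obtain t x where tx: "p = (t, x)" by (cases p)
      have t: "t0 \<le> t" "t \<le> T" and x: "dist x1 x \<le> r" using p(1) tx by auto
      have mx: "\<Phi> s y \<le> \<Phi> t x" if "t0 \<le> s" "s \<le> T" "dist x1 y \<le> r" for s y
        using p(2)[of "(s, y)"] that tx by auto
      have Phi: "C * t0 < \<Phi> t x" using mx[of T x1] big t0 r by simp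
      have xD': "x \<in> D'" using x x1 by (auto simp: D'_def)
      have EU: "E x - heat_ext t x \<le> C * t" using low[of t x] t t0 T xD' by simp
      have "t \<noteq> t0" using EU Phi by (auto simp: \<Phi>_def)
      then have tt: "t0 < t" using t by simp
      have xr: "dist x1 x < r"
      proof (rule ccontr)
        assume "\<not> dist x1 x < r"
        then have "norm (x - x1) = r" using x by (simp add: dist_norm norm_minus_commute)
        then have "\<theta> x \<le> - C" using Nr by (simp add: \<theta>_def)
        then have "(t - t0) * (\<theta> x - \<kappa>) \<le> (t - t0) * (- C)" using tt \<kappa> by (intro mult_left_mono) auto
        then have "\<Phi> t x \<le> C * t + (t - t0) * (- C)" using EU by (simp add: \<Phi>_def)
        then show False using Phi by (simp add: algebra_simps)
      qed
      have tpos: "0 < t" using tt t0 by simp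
      define c where "c = (t - t0) * N"
      \<comment> \<open>At the fixed time \<open>t\<close>, \<open>\<Phi> t y\<close> is
        \<open>E y - \<phi> y\<close> plus a constant, so the space maximum of \<open>\<Phi>\<close>
        makes \<open>\<phi>\<close> a smooth test function for \<open>E\<close>.\<close>
      define \<phi> where "\<phi> y = heat_ext t y + c * (norm (y - x1))^2" for y
      have C2: "C2_data UNIV \<phi> (\<lambda>y. heat_ext_grad t y + c *\<^sub>R (2 *\<^sub>R (y - x1))) (\<lambda>y. heat_ext_hess t y + c *\<^sub>R (2 *\<^sub>R mat 1))"
        unfolding \<phi>_def[abs_def] by (intro C2_data_add C2_data_scale C2_data_square heat_ext_C2_data tpos)
      have "C2_on \<Omega> \<phi>" by (rule C2_data_imp_C2_on[OF C2_data_subset[OF C2] O]) simp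
      moreover have "local_max_in \<Omega> (\<lambda>y. E y - \<phi> y) x"
      proof -
        have "\<forall>\<^sub>F y in at x within \<Omega>. y \<in> ball x1 r"
          using xr by (intro eventually_at_topological[THEN iffD2] exI[of _ "ball x1 r"]) auto
        then have "\<forall>\<^sub>F y in at x within \<Omega>. E y - \<phi> y \<le> E x - \<phi> x"
        proof (rule eventually_mono)
          fix y assume "y \<in> ball x1 r"
          then have "\<Phi> t y \<le> \<Phi> t x" using t by (intro mx) auto
          then show "E y - \<phi> y \<le> E x - \<phi> x"
            by (simp add: \<Phi>_def \<theta>_def \<phi>_def c_def algebra_simps)
        qed
        moreover have "x \<in> \<Omega>" using cb x by auto
        ultimately show ?thesis by (simp add: local_max_in_def)
      qed
      ultimately have "g0 \<le> generator (gradient \<phi> x) (hessian \<phi> x)" using visc[OF x1] xr by simp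
      also have "\<dots> = generator (heat_ext_grad t x) (heat_ext_hess t x) + c * (2 * trace (matrix_inv H) - 2 * (\<beta> \<bullet> (x - x1)))"
        unfolding C2_data_gradient_hessian(1,2)[OF C2 open_UNIV UNIV_I]
        by (simp add: generator_def matrix_add_ldistrib trace_add trace_scaleR_right inner_add_right
            algebra_simps)
      finally have 1: "g0 \<le> generator (heat_ext_grad t x) (heat_ext_hess t x) + c * (2 * trace (matrix_inv H) - 2 * (\<beta> \<bullet> (x - x1)))" .
      have 2: "c * (2 * trace (matrix_inv H) - 2 * (\<beta> \<bullet> (x - x1))) \<le> T * S'"
      proof -
        have "- (\<beta> \<bullet> (x - x1)) \<le> norm \<beta> * norm (x - x1)" 
          using Cauchy_Schwarz_ineq2[of \<beta> "x - x1"] by linarith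
        also have "\<dots> \<le> norm \<beta> * r" using x by (intro mult_left_mono) (auto simp: dist_norm norm_minus_commute)
        finally have "N * (2 * trace (matrix_inv H) - 2 * (\<beta> \<bullet> (x - x1))) \<le> N * (2 * \<bar>trace (matrix_inv H)\<bar> + 2 * (norm \<beta> * r))"
          using N by (intro mult_left_mono) auto
        also have "\<dots> = S'" by (simp add: S'_def algebra_simps)
        finally have *: "N * (2 * trace (matrix_inv H) - 2 * (\<beta> \<bullet> (x - x1))) \<le> S'" .
        have "c * (2 * trace (matrix_inv H) - 2 * (\<beta> \<bullet> (x - x1))) \<le> (t - t0) * S'"
          unfolding c_def mult.assoc using tt * by (intro mult_left_mono) auto
        also have "\<dots> \<le> T * S'" using S' t t0 by (intro mult_right_mono) auto
        finally show ?thesis .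
      qed
      \<comment> \<open>The maximum may sit at the final time \<open>T\<close>, so only earlier
        times are compared: a negative time derivative would make \<open>\<Phi>\<close> larger just
        before \<open>t\<close>.\<close>
      have 3: "0 \<le> - generator (heat_ext_grad t x) (heat_ext_hess t x) + (\<theta> x - \<kappa>)"
      proof (rule ccontr)
        assume neg: "\<not> ?thesis"
        have "((\<lambda>s. \<Phi> s x) has_real_derivative - generator (heat_ext_grad t x) (heat_ext_hess t x) + (\<theta> x - \<kappa>)) (at t)"
          unfolding \<Phi>_def by (auto intro!: derivative_eq_intros heat_ext_time_derivative tpos)
        from DERIV_neg_dec_left[OF this] neg obtain d where
          d: "0 < d" "\<And>h. 0 < h \<Longrightarrow> h < d \<Longrightarrow> \<Phi> t x < \<Phi> (t - h) x" by auto
        define h where "h = min (d / 2) (t - t0)"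
        have "0 < h" "h < d" "h \<le> t - t0" using d tt by (auto simp: h_def)
        then show False using d(2)[of h] mx[of "t - h" x] t x by auto
      qed
      have "\<theta> x \<le> g0" using N by (simp add: \<theta>_def)
      then show False using 1 2 3 T by (simp add: \<kappa>_def algebra_simps)
    qed
    define A where "A = E x1 - heat_ext T x1 + T * (g0 - \<kappa>)"
    have "A \<le> 0"
    proof (rule ccontr)
      assume "\<not> A \<le> 0"
      then have A: "0 < A" by simp
      define L where "L = \<bar>C + g0 - \<kappa>\<bar> + 1"
      \<comment> \<open>Small enough for the terms of order \<open>t0\<close> to use up at most half
        of the supposedly positive \<open>A\<close>.\<close>
      define t0 where "t0 = min (T / 2) (A / (2 * L))"
      have L: "0 < L" by (simp add: L_def)
      have t0: "0 < t0" "t0 < T" using A L T by (auto simp: t0_def)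
      have "A \<le> t0 * (C + g0 - \<kappa>)" using key[OF t0] by (simp add: A_def algebra_simps)
      also have "\<dots> \<le> t0 * L" using t0 by (intro mult_left_mono) (auto simp: L_def)
      also have "\<dots> \<le> A / (2 * L) * L" using L by (intro mult_right_mono) (auto simp: t0_def)
      also have "\<dots> = A / 2" using L by simp
      finally show False using A by simp
    qed
    then show ?thesis by (simp add: A_def \<kappa>_def power2_eq_square algebra_simps)
  qed
  then show ?thesis using T0 by blast
qed

end

section \<open>Mollification\<close>

text \<open>At 0 the difference quotient is bounded by a positive power of
  \<open>\<bar>h\<bar>\<close>, so cutting off at 0 preserves differentiability from the second
  power on.\<close>

lemma DERIV_max0_power:
  "((\<lambda>s::real. max 0 s ^ Suc (Suc k)) has_real_derivative (real (Suc (Suc k)) * max 0 s ^ Suc k)) (at s)"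
proof -
  consider "s < 0" | "s > 0" | "s = 0" by linarith
  then show ?thesis
  proof cases
    case 1
    have "((\<lambda>s::real. 0) has_real_derivative 0) (at s)" by simp
    then have "((\<lambda>s::real. max 0 s ^ Suc (Suc k)) has_real_derivative 0) (at s)"
      by (rule has_field_derivative_transform_within_open[of _ _ _ "{..<0}"]) (use 1 in auto)
    then show ?thesis using 1 by simp
  next
    case 2
    have "((\<lambda>s::real. s ^ Suc (Suc k)) has_real_derivative (real (Suc (Suc k)) * s ^ Suc k)) (at s)"
      using DERIV_pow[of "Suc (Suc k)" s] by simp
    then have "((\<lambda>s::real. max 0 s ^ Suc (Suc k)) has_real_derivative (real (Suc (Suc k)) * s ^ Suc k)) (at s)"
      by (rule has_field_derivative_transform_within_open[of _ _ _ "{0<..}"]) (use 2 in auto)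
    then show ?thesis using 2 by simp
  next
    case 3
    have "((\<lambda>h::real. max 0 h ^ Suc (Suc k) / h) \<longlongrightarrow> 0) (at 0)"
    proof (rule Lim_null_comparison)
      show "\<forall>\<^sub>F h in at (0::real). norm (max 0 h ^ Suc (Suc k) / h) \<le> \<bar>h\<bar> ^ Suc k"
      proof (intro always_eventually allI)
        fix h :: real
        have "max 0 h ^ Suc (Suc k) / h = max 0 h ^ Suc k" by (cases "0 < h") (auto simp: max_def)
        moreover have "max 0 h ^ Suc k \<le> \<bar>h\<bar> ^ Suc k" by (intro power_mono) auto
        ultimately show "norm (max 0 h ^ Suc (Suc k) / h) \<le> \<bar>h\<bar> ^ Suc k" by (simp del: power_Suc)
      qed
      show "((\<lambda>h::real. \<bar>h\<bar> ^ Suc k) \<longlongrightarrow> 0) (at 0)"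
        by (auto intro!: tendsto_eq_intros)
    qed
    then show ?thesis using 3 by (simp add: has_field_derivative_iff)
  qed
qed

text \<open>The cube makes the cut-off polynomial twice continuously differentiable across the
  sphere of radius \<open>\<epsilon>\<close>.\<close>

definition bump :: "real \<Rightarrow> real^'n \<Rightarrow> real" where
  "bump \<epsilon> z = max 0 (\<epsilon>^2 - (norm z)^2) ^ 3"

lemma bump_nonneg: "0 \<le> bump \<epsilon> z" by (simp add: bump_def)

lemma bump_zero: "0 < \<epsilon> \<Longrightarrow> \<epsilon> \<le> norm z \<Longrightarrow> bump \<epsilon> z = 0"
  by (simp add: bump_def power_mono max_absorb1)

lemma bump_pos: "norm z < \<epsilon> \<Longrightarrow> 0 < bump \<epsilon> z"
  unfolding bump_def by (intro zero_less_power) (simp add: power_strict_mono less_max_iff_disj)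

lemma bump_C2_data:
  "C2_data UNIV (bump \<epsilon> :: real^'n \<Rightarrow> real)
     (\<lambda>z. (- 6 * max 0 (\<epsilon>^2 - (norm z)^2) ^ 2) *\<^sub>R z)
     (\<lambda>z. (24 * max 0 (\<epsilon>^2 - (norm z)^2)) *\<^sub>R outer_product z z - (6 * max 0 (\<epsilon>^2 - (norm z)^2) ^ 2) *\<^sub>R mat 1)"
proof -
  have q: "((\<lambda>z. \<epsilon>^2 - (norm z)^2) has_derivative (\<lambda>v. - 2 * (z \<bullet> v))) (at z)" for z :: "real^'n"
    unfolding power2_norm_eq_inner by (auto intro!: derivative_eq_intros simp: inner_commute)
  have d3: "((\<lambda>s::real. max 0 s ^ 3) has_derivative (\<lambda>h. (3 * max 0 s ^ 2) * h)) (at s)" for s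
    using DERIV_max0_power[of 1 s] by (simp add: has_field_derivative_def eval_nat_numeral)
  have d2: "((\<lambda>s::real. max 0 s ^ 2) has_derivative (\<lambda>h. (2 * max 0 s) * h)) (at s)" for s
    using DERIV_max0_power[of 0 s] by (simp add: has_field_derivative_def eval_nat_numeral)
  have 1: "(bump \<epsilon> has_derivative (\<lambda>v. ((- 6 * max 0 (\<epsilon>^2 - (norm z)^2) ^ 2) *\<^sub>R z) \<bullet> v)) (at z)" for z :: "real^'n"
    unfolding bump_def[abs_def]
    by (rule has_derivative_eq_rhs[OF has_derivative_compose[OF q d3]]) (simp add: fun_eq_iff)
  have dm: "((\<lambda>z::real^'n. - 6 * max 0 (\<epsilon>^2 - (norm z)^2) ^ 2) has_derivative
      (\<lambda>v. 24 * max 0 (\<epsilon>^2 - (norm z)^2) * (z \<bullet> v))) (at z)" for z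
    by (rule has_derivative_eq_rhs[OF has_derivative_mult_right[OF has_derivative_compose[OF q d2]]]) (simp add: fun_eq_iff)
  have 2: "((\<lambda>z::real^'n. (- 6 * max 0 (\<epsilon>^2 - (norm z)^2) ^ 2) *\<^sub>R z) has_derivative
     (\<lambda>v. ((24 * max 0 (\<epsilon>^2 - (norm z)^2)) *\<^sub>R outer_product z z - (6 * max 0 (\<epsilon>^2 - (norm z)^2) ^ 2) *\<^sub>R mat 1) *v v)) (at z)" for z
    by (rule has_derivative_eq_rhs[OF has_derivative_scaleR[OF dm has_derivative_ident]])
       (simp add: fun_eq_iff matrix_vector_mult_diff_rdistrib scaleR_matrix_vector_assoc[symmetric] outer_product_mult_vec)
  have "continuous_on UNIV (\<lambda>z::real^'n. (24 * max 0 (\<epsilon>^2 - (norm z)^2)) *\<^sub>R outer_product z z - (6 * max 0 (\<epsilon>^2 - (norm z)^2) ^ 2) *\<^sub>R mat 1)"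
    unfolding outer_product_def by (intro continuous_intros)
  then show ?thesis using 1 2 by (auto simp: C2_data_def)
qed

lemma continuous_on_bump: "continuous_on S (bump \<epsilon> :: real^'n \<Rightarrow> real)"
  unfolding bump_def[abs_def] by (intro continuous_intros)

lemma measurable_bump [measurable]: "bump \<epsilon> \<in> borel_measurable borel"
  by (intro borel_measurable_continuous_onI continuous_on_bump)

lemma integrable_bump:
  assumes "0 < \<epsilon>" shows "integrable lborel (bump \<epsilon> :: real^'n \<Rightarrow> real)"
proof -
  have "integrable lborel (\<lambda>z. indicator (cball 0 \<epsilon>) z *\<^sub>R bump \<epsilon> (z :: real^'n))"
    by (intro borel_integrable_compact compact_cball continuous_on_bump)
  then show ?thesis
    by (rule back_subst[of "integrable lborel"])
       (use bump_zero[OF assms, OF less_imp_le] in \<open>auto simp: fun_eq_iff indicator_def not_le\<close>)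
qed

text \<open>The type argument fixes the dimension, which \<open>\<epsilon>\<close> alone does not
  determine.\<close>

definition bump_mass :: "real \<Rightarrow> 'n::finite itself \<Rightarrow> real" where
  "bump_mass \<epsilon> T = (\<integral>z. bump \<epsilon> (z :: real^'n) \<partial>lborel)"

lemma bump_mass_pos:
  assumes "0 < \<epsilon>" shows "0 < bump_mass \<epsilon> TYPE('n::finite)"
proof -
  have "bump_mass \<epsilon> TYPE('n) \<noteq> 0"
  proof
    assume "bump_mass \<epsilon> TYPE('n) = 0"
    then have "AE z in lborel. bump \<epsilon> (z::real^'n) = 0"
      using integral_nonneg_eq_0_iff_AE[OF integrable_bump[OF assms]] by (auto simp: bump_mass_def bump_nonneg)
    then have "AE z in lborel. z \<notin> ball (0::real^'n) \<epsilon>"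
      by (rule eventually_mono) (use bump_pos in force)
    then have "emeasure lborel (ball (0::real^'n) \<epsilon>) = 0"
      by (subst (asm) AE_iff_measurable[OF _ refl]) (auto simp: ball_def)
    then show False using assms unit_ball_vol_pos[of "real CARD('n)"] by (simp add: emeasure_ball)
  qed
  moreover have "0 \<le> bump_mass \<epsilon> TYPE('n)"
    unfolding bump_mass_def by (intro Bochner_Integration.integral_nonneg) (simp add: bump_nonneg)
  ultimately show ?thesis by simp
qed

text \<open>Only the upper bound is needed. Compare the scaling \<open>\<integral> exp (- s\<^sup>2 Q / 4) = s\<close> to the power \<open>- n\<close> times
  \<open>\<integral> exp (- Q / 4)\<close> with the tangent inequality of \<open>exp\<close> and let \<open>s\<close> tend to \<open>1\<close>.\<close>

lemma gaussian_second_moment: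
  fixes H :: "real^'n^'n"
  assumes H: "posdef_matrix H"
  shows "(\<integral>w. (w \<bullet> (H *v w)) * gaussian H w \<partial>lborel) \<le> 2 * real CARD('n) * gaussian_mass H"
    "integrable lborel (\<lambda>w. (w \<bullet> (H *v w)) * gaussian H w)"
proof -
  let ?Q = "\<lambda>w. w \<bullet> (H *v w)"
  let ?n = "CARD('n)"
  let ?Z = "gaussian_mass H"
  have Z: "0 < ?Z" by (rule gaussian_mass_pos[OF H])
  have [measurable]: "?Q \<in> borel_measurable borel"
    by (intro borel_measurable_continuous_onI continuous_intros)
  have Q0: "0 \<le> ?Q w" for w using posdef_imp_nonneg[OF H] by (simp add: nonneg_matrix_def)
  obtain K where K: "\<And>v. norm (H *v v) \<le> norm v * K"
    using bounded_linear.bounded[OF matrix_vector_mul_bounded_linear, of H] by blast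
  show int: "integrable lborel (\<lambda>w. ?Q w * gaussian H w)"
  proof (rule Bochner_Integration.integrable_bound)
    show "integrable lborel (\<lambda>w. \<bar>K\<bar> * (norm w ^ 2 * gaussian H w))"
      by (intro integrable_mult_right integrable_norm_power_mult_gaussian H)
    have "norm (?Q w) \<le> \<bar>K\<bar> * norm w ^ 2" for w
    proof -
      have "norm (?Q w) \<le> norm w * norm (H *v w)" using Cauchy_Schwarz_ineq2[of w "H *v w"] by simp
      also have "\<dots> \<le> norm w * (norm w * \<bar>K\<bar>)"
        by (intro mult_left_mono order_trans[OF K[of w]]) (auto intro: mult_left_mono)
      finally show ?thesis by (simp add: power2_eq_square algebra_simps)
    qed
    then show "AE w in lborel. norm (?Q w * gaussian H w) \<le> norm (\<bar>K\<bar> * (norm w ^ 2 * gaussian H w))"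
      using gaussian_pos[of H] by (intro always_eventually) (auto simp: abs_mult simp flip: mult.assoc intro!: mult_right_mono)
  qed measurable
  have bd: "(\<integral>w. ?Q w * gaussian H w \<partial>lborel) * (h * (2 + h)) \<le> 4 * (((1 + h) ^ ?n - 1) * (1 + h)^2) * ?Z"
    if h: "0 < h" for h :: real
  proof -
    \<comment> \<open>In terms of \<open>h\<close> the scaled integral is
      \<open>(1 + h) ^ CARD('n)\<close> times the mass, and the difference quotient of this power at
      0 tends to the dimension.\<close>
    define s where "s = 1 / (1 + h)"
    have s: "0 < s" "s < 1" using h by (auto simp: s_def)
    have "?Z = s ^ ?n * (\<integral>w. gaussian H (s *\<^sub>R w) \<partial>lborel)"
      using lborel_integral_affine[of s "gaussian H" 0] s by (simp add: gaussian_mass_def)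
    then have J: "(\<integral>w. gaussian H (s *\<^sub>R w) \<partial>lborel) = (1 + h) ^ ?n * ?Z"
      using h by (simp add: s_def field_simps power_divide)
    have gs: "gaussian H (s *\<^sub>R w) = exp (- (s^2 / 4 * ?Q w))" for w
      by (simp add: gaussian_def matrix_vector_mult_scaleR power2_eq_square)
    have "(\<integral>w. gaussian H w + (1 - s^2) / 4 * (?Q w * gaussian H w) \<partial>lborel) \<le> (\<integral>w. gaussian H (s *\<^sub>R w) \<partial>lborel)"
    proof (rule integral_mono)
      show "integrable lborel (\<lambda>w. gaussian H w + (1 - s^2) / 4 * (?Q w * gaussian H w))"
        by (intro Bochner_Integration.integrable_add integrable_mult_right int integrable_gaussian H)
      show "integrable lborel (\<lambda>w. gaussian H (s *\<^sub>R w))"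
        using integrable_norm_power_gaussian[OF H, of "s^2 / 4" 0] s by (simp add: gs)
      fix w
      have "1 + (1 - s^2) / 4 * ?Q w \<le> exp ((1 - s^2) / 4 * ?Q w)" by (rule exp_ge_add_one_self)
      then have "(1 + (1 - s^2) / 4 * ?Q w) * gaussian H w \<le> exp ((1 - s^2) / 4 * ?Q w) * gaussian H w"
        using gaussian_pos[of H w] by (intro mult_right_mono) auto
      also have "\<dots> = gaussian H (s *\<^sub>R w)"
        unfolding gs by (simp add: gaussian_def field_simps flip: exp_add)
      finally show "gaussian H w + (1 - s^2) / 4 * (?Q w * gaussian H w) \<le> gaussian H (s *\<^sub>R w)"
        by (simp add: algebra_simps)
    qed
    also have "(\<integral>w. gaussian H w + (1 - s^2) / 4 * (?Q w * gaussian H w) \<partial>lborel)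
        = ?Z + (1 - s^2) / 4 * (\<integral>w. ?Q w * gaussian H w \<partial>lborel)"
      by (subst Bochner_Integration.integral_add) (auto simp: gaussian_mass_def intro!: integrable_gaussian H integrable_mult_right int)
    finally have "(1 - s^2) * (\<integral>w. ?Q w * gaussian H w \<partial>lborel) \<le> 4 * ((1 + h) ^ ?n - 1) * ?Z"
      unfolding J by (simp add: field_simps)
    then have "(1 + h)^2 * ((1 - s^2) * (\<integral>w. ?Q w * gaussian H w \<partial>lborel)) \<le> (1 + h)^2 * (4 * ((1 + h) ^ ?n - 1) * ?Z)"
      by (rule mult_left_mono) simp
    \<comment> \<open>The factor \<open>h\<close> is divided out below; in the limit
      \<open>2 + h\<close> becomes the 2 that reduces the constant 4 to 2.\<close>
    moreover have "(1 + h)^2 * (1 - s^2) = h * (2 + h)"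
      using h by (simp add: s_def power_divide right_diff_distrib) (simp add: power2_eq_square algebra_simps)
    ultimately have "h * (2 + h) * (\<integral>w. ?Q w * gaussian H w \<partial>lborel) \<le> (1 + h)^2 * (4 * ((1 + h) ^ ?n - 1) * ?Z)"
      by (simp only: mult.assoc[symmetric])
    then show ?thesis by (simp only: mult_ac)
  qed
  have "((\<lambda>h::real. ((1 + h) ^ ?n - 1) / h) \<longlongrightarrow> real ?n) (at 0)"
  proof -
    have "((\<lambda>x::real. x ^ ?n) has_real_derivative real ?n * 1 ^ (?n - 1)) (at 1)"
      by (auto intro!: derivative_eq_intros)
    then show ?thesis by (simp add: DERIV_def)
  qed
  then have lim: "((\<lambda>h::real. ((1 + h) ^ ?n - 1) / h) \<longlongrightarrow> real ?n) (at_right 0)"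
    by (rule tendsto_mono[rotated]) (simp add: at_le)
  have "((\<lambda>h::real. 4 * ((((1 + h) ^ ?n - 1) / h) * (1 + h)^2) * ?Z) \<longlongrightarrow> 4 * (real ?n * (1 + 0)^2) * ?Z) (at_right 0)"
    by (intro tendsto_intros lim)
  moreover have "((\<lambda>h::real. (\<integral>w. ?Q w * gaussian H w \<partial>lborel) * (2 + h)) \<longlongrightarrow> (\<integral>w. ?Q w * gaussian H w \<partial>lborel) * (2 + 0)) (at_right 0)"
    by (intro tendsto_intros)
  moreover have "\<forall>\<^sub>F h in at_right (0::real). (\<integral>w. ?Q w * gaussian H w \<partial>lborel) * (2 + h) \<le> 4 * ((((1 + h) ^ ?n - 1) / h) * (1 + h)^2) * ?Z"
    unfolding eventually_at_filter
  proof (intro always_eventually allI impI)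
    fix h :: real assume "h \<noteq> 0" "h \<in> {0<..}"
    then have h: "0 < h" by simp
    show "(\<integral>w. ?Q w * gaussian H w \<partial>lborel) * (2 + h) \<le> 4 * ((((1 + h) ^ ?n - 1) / h) * (1 + h)^2) * ?Z"
      using bd[OF h] h by (simp add: field_simps)
  qed
  ultimately have "(\<integral>w. ?Q w * gaussian H w \<partial>lborel) * (2 + 0) \<le> 4 * (real ?n * (1 + 0)^2) * ?Z"
    by (intro tendsto_le[OF trivial_limit_at_right_real])
  then show "(\<integral>w. ?Q w * gaussian H w \<partial>lborel) \<le> 2 * real ?n * ?Z" by (simp add: mult_ac)
qed


lemma power4_sum_le: "(x + y) ^ 4 \<le> 8 * (x ^ 4 + (y::real) ^ 4)"
proof -
  have "(x + y)^2 \<le> 2 * (x^2 + y^2)"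
    using sum_squares_bound[of x y] by (simp add: power2_eq_square algebra_simps)
  then have "((x + y)^2)^2 \<le> (2 * (x^2 + y^2))^2" by (intro power_mono) auto
  also have "\<dots> = 4 * (x^2 + y^2)^2" by (simp only: power_mult_distrib) simp
  also have "(x^2 + y^2)^2 \<le> 2 * ((x^2)^2 + (y^2)^2)"
    using sum_squares_bound[of "x^2" "y^2"] by (simp add: power2_eq_square algebra_simps)
  finally show ?thesis by (simp flip: power_mult)
qed

section \<open>Mollification of bounded functions and preservation of convexity\<close>

context bounded_extension
begin

definition mollify :: "real \<Rightarrow> real^'n \<Rightarrow> real" where
  "mollify \<epsilon> x = (1 / bump_mass \<epsilon> TYPE('n)) * integral (cbox a b) (\<lambda>y. E y * bump \<epsilon> (x - y))"

lemma mollify_C2_data: "C2_data UNIV (mollify \<epsilon>) (gradient (mollify \<epsilon>)) (hessian (mollify \<epsilon>))"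
proof -
  have "C2_on UNIV (mollify \<epsilon>)"
    unfolding mollify_def[abs_def]
    by (rule C2_data_imp_C2_on[OF C2_data_scale[OF convolution_C2_data[OF E bump_C2_data]] open_UNIV])
  then show ?thesis by (rule C2_on_imp_C2_data)
qed

lemma mollify_eq:
  "mollify \<epsilon> x = (1 / bump_mass \<epsilon> TYPE('n)) * (\<integral>z. bump \<epsilon> z * zero_ext (x - z) \<partial>lborel)"
proof -
  have cb: "continuous_on S (\<lambda>y. bump \<epsilon> (x - y))" for S
    by (rule continuous_on_compose2[OF continuous_on_bump[of UNIV]]) (auto intro!: continuous_intros)
  have [measurable]: "(\<lambda>y. bump \<epsilon> (x - y)) \<in> borel_measurable borel"
    by (intro borel_measurable_continuous_onI cb)
  have si: "set_integrable lborel (cbox a b) (\<lambda>y. E y * bump \<epsilon> (x - y))"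
    unfolding set_integrable_def by (intro borel_integrable_compact compact_cbox continuous_intros E cb)
  have "integral (cbox a b) (\<lambda>y. E y * bump \<epsilon> (x - y)) = (\<integral>y. zero_ext y * bump \<epsilon> (x - y) \<partial>lborel)"
    using set_borel_integral_eq_integral(2)[OF si] by (simp add: set_lebesgue_integral_def zero_ext_def mult.assoc)
  also have "\<dots> = (\<integral>z. bump \<epsilon> z * zero_ext (x - z) \<partial>lborel)"
    using lborel_integral_affine[of "-1" "\<lambda>y. zero_ext y * bump \<epsilon> (x - y)" x] by (simp add: mult.commute)
  finally show ?thesis by (simp add: mollify_def)
qed

lemma integrable_bump_mult:
  assumes "0 < \<epsilon>" and [measurable]: "f \<in> borel_measurable borel" and f: "\<And>z. \<bar>f z\<bar> \<le> K"
  shows "integrable lborel (\<lambda>z::real^'n. bump \<epsilon> z * f z)"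
proof (rule Bochner_Integration.integrable_bound)
  show "integrable lborel (\<lambda>z::real^'n. K * bump \<epsilon> z)" by (intro integrable_mult_right integrable_bump assms)
  show "AE z in lborel. norm (bump \<epsilon> z * f z) \<le> norm (K * bump \<epsilon> (z::real^'n))"
    using f by (intro always_eventually)
      (auto simp: abs_mult mult.commute[of "\<bar>K\<bar>"] intro!: mult_left_mono order_trans[OF f abs_ge_self])
qed measurable

lemma mollify_bound: assumes "0 < \<epsilon>" shows "\<bar>mollify \<epsilon> x\<bar> \<le> M"
proof -
  let ?\<mu> = "bump_mass \<epsilon> TYPE('n)"
  have \<mu>: "0 < ?\<mu>" by (rule bump_mass_pos[OF assms])
  have "\<bar>\<integral>z. bump \<epsilon> z * zero_ext (x - z) \<partial>lborel\<bar> \<le> (\<integral>z. bump \<epsilon> (z::real^'n) * M \<partial>lborel)"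
  proof (rule order_trans[OF integral_abs_bound integral_mono])
    show "integrable lborel (\<lambda>z. \<bar>bump \<epsilon> z * zero_ext (x - z)\<bar>)"
      by (intro integrable_abs integrable_bump_mult[where K=M] assms) (auto simp: zero_ext_bound)
    show "\<bar>bump \<epsilon> z * zero_ext (x - z)\<bar> \<le> bump \<epsilon> z * M" for z
      by (simp add: abs_mult bump_nonneg mult_left_mono zero_ext_bound)
  qed (intro integrable_mult_left integrable_bump assms)
  then have "\<bar>\<integral>z. bump \<epsilon> z * zero_ext (x - z) \<partial>lborel\<bar> \<le> ?\<mu> * M" by (simp add: bump_mass_def)
  then show ?thesis unfolding mollify_eq using \<mu> by (simp add: abs_mult field_simps)
qed

text \<open>The bump vanishes off the ball, so the integrands are compared only there; the global
  bound \<open>K\<close> secures integrability.\<close>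

lemma mollify_mono:
  assumes e: "0 < \<epsilon>" and [measurable]: "f \<in> borel_measurable borel" "g \<in> borel_measurable borel"
    and f: "\<And>z. \<bar>f z\<bar> \<le> K" and g: "\<And>z. \<bar>g z\<bar> \<le> K"
    and le: "\<And>z::real^'n. norm z < \<epsilon> \<Longrightarrow> f z \<le> g z"
  shows "(\<integral>z. bump \<epsilon> z * f z \<partial>lborel) \<le> (\<integral>z. bump \<epsilon> z * g z \<partial>lborel)"
proof (rule integral_mono)
  show "bump \<epsilon> z * f z \<le> bump \<epsilon> z * g z" for z
    using le[of z] bump_zero[OF e, of z] by (cases "norm z < \<epsilon>") (auto simp: bump_nonneg mult_left_mono)
qed (intro integrable_bump_mult[where K=K] assms)+

text \<open>Averaging over translates preserves the midpoint inequality; the margin \<open>r\<close>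
  keeps the translated endpoints inside the domain of convexity.\<close>

lemma mollify_hessian_psd:
  assumes e: "0 < \<epsilon>" and sub: "\<Omega> \<subseteq> cbox a b" and conv: "convex_on \<Omega> E" and r: "0 < r"
    and ball: "ball x (\<epsilon> + r) \<subseteq> \<Omega>"
  shows "nonneg_matrix (hessian (mollify \<epsilon>) x)"
proof -
  note C = mollify_C2_data[of \<epsilon>]
  let ?\<mu> = "bump_mass \<epsilon> TYPE('n)"
  have "2 * mollify \<epsilon> x \<le> mollify \<epsilon> (x + v) + mollify \<epsilon> (x - v)" if v: "norm v < r" for v
  proof -
    have i: "integrable lborel (\<lambda>z. bump \<epsilon> z * zero_ext (y - z))" for y
      by (intro integrable_bump_mult[where K=M] e) (auto simp: zero_ext_bound)
    have "(\<integral>z. bump \<epsilon> z * (2 * zero_ext (x - z)) \<partial>lborel) \<le> (\<integral>z. bump \<epsilon> z * (zero_ext (x + v - z) + zero_ext (x - v - z)) \<partial>lborel)"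
    proof (rule mollify_mono[OF e, where K="2 * M"])
      fix z :: "real^'n" assume z: "norm z < \<epsilon>"
      have n1: "norm (v - z) < \<epsilon> + r" "norm (v + z) < \<epsilon> + r"
        using norm_triangle_ineq4[of v z] norm_triangle_ineq[of v z] v z by auto
      have O: "x - z \<in> \<Omega>" "x + v - z \<in> \<Omega>" "x - v - z \<in> \<Omega>"
        using ball z r n1 by (auto simp: subset_iff dist_norm algebra_simps norm_minus_commute)
      have "x - z = (1 - 1/2) *\<^sub>R (x + v - z) + (1/2) *\<^sub>R (x - v - z)"
        by (simp add: algebra_simps flip: scaleR_add_left)
      then have "E (x - z) \<le> (E (x + v - z) + E (x - v - z)) / 2"
        using convex_onD[OF conv, of "1/2" "x + v - z" "x - v - z"] O by simp
      moreover have "x - z \<in> cbox a b" "x + v - z \<in> cbox a b" "x - v - z \<in> cbox a b" using O sub by blast+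
      ultimately show "2 * zero_ext (x - z) \<le> zero_ext (x + v - z) + zero_ext (x - v - z)"
        by (simp add: zero_ext_def)
    next
      show "\<bar>2 * zero_ext (x - z)\<bar> \<le> 2 * M" for z using zero_ext_bound[of "x - z"] by simp
      show "\<bar>zero_ext (x + v - z) + zero_ext (x - v - z)\<bar> \<le> 2 * M" for z
        using zero_ext_bound[of "x + v - z"] zero_ext_bound[of "x - v - z"] by linarith
    qed measurable
    then have "2 * (\<integral>z. bump \<epsilon> z * zero_ext (x - z) \<partial>lborel) \<le>
        (\<integral>z. bump \<epsilon> z * zero_ext (x + v - z) \<partial>lborel) + (\<integral>z. bump \<epsilon> z * zero_ext (x - v - z) \<partial>lborel)"
      using Bochner_Integration.integral_add[OF i i, of "x + v" "x - v"]
      by (simp add: distrib_left mult.left_commute)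
    then show ?thesis
      unfolding mollify_eq using bump_mass_pos[OF e, where 'n='n] by (simp add: field_simps)
  qed
  then show ?thesis
    using second_difference_nonneg[OF C open_UNIV UNIV_I r] hessian_symmetric[OF C open_UNIV UNIV_I]
    by (simp add: nonneg_matrix_def)
qed

end

section \<open>Averaging the heat mean value inequality\<close>

context heat_extension
begin

lemma heat_ext_bound: assumes "0 < t" shows "\<bar>heat_ext t x\<bar> \<le> M"
proof -
  have Z: "0 < gaussian_mass H" by (rule gaussian_mass_pos[OF H])
  have "\<bar>\<integral>w. zero_ext (x - t *\<^sub>R \<beta> - sqrt t *\<^sub>R w) * gaussian H w \<partial>lborel\<bar> \<le> (\<integral>w. M * gaussian H w \<partial>lborel)"
  proof (rule order_trans[OF integral_abs_bound integral_mono])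
    show "integrable lborel (\<lambda>w. \<bar>zero_ext (x - t *\<^sub>R \<beta> - sqrt t *\<^sub>R w) * gaussian H w\<bar>)"
      by (intro integrable_abs integrable_bounded_gaussian[where K=M]) (auto simp: zero_ext_bound)
    show "\<bar>zero_ext (x - t *\<^sub>R \<beta> - sqrt t *\<^sub>R w) * gaussian H w\<bar> \<le> M * gaussian H w" for w
      using gaussian_pos[of H w] by (simp add: abs_mult mult_right_mono zero_ext_bound)
  qed (intro integrable_mult_right integrable_gaussian H)
  then show ?thesis unfolding heat_ext_gaussian[OF assms] using Z
    by (simp add: gaussian_mass_def field_simps)
qed

lemma measurable_heat_ext: assumes "0 < t" shows "heat_ext t \<in> borel_measurable borel"
  by (intro borel_measurable_continuous_onI C2_data_continuous(1)[OF heat_ext_C2_data[OF assms]])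

text \<open>Convolutions commute, by Fubini's theorem. This turns the mean value inequality for
  \<open>E\<close> into one for a smooth function.\<close>

lemma average_heat_ext:
  assumes t: "0 < t" and e: "0 < \<epsilon>"
  shows "(1 / bump_mass \<epsilon> TYPE('n)) * (\<integral>z. bump \<epsilon> z * heat_ext t (x - z) \<partial>lborel)
    = (1 / gaussian_mass H) * (\<integral>w. gaussian H w * mollify \<epsilon> (x - t *\<^sub>R \<beta> - sqrt t *\<^sub>R w) \<partial>lborel)"
proof -
  let ?f = "\<lambda>z w. bump \<epsilon> z * (gaussian H w * zero_ext (x - z - t *\<^sub>R \<beta> - sqrt t *\<^sub>R w))"
  let ?Z = "gaussian_mass H" and ?\<mu> = "bump_mass \<epsilon> TYPE('n)"
  have bg: "integrable (lborel \<Otimes>\<^sub>M lborel) (\<lambda>(z, w). bump \<epsilon> (z::real^'n) * gaussian H w)"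
  proof (rule lborel_pair.Fubini_integrable)
    show "(\<lambda>(z, w). bump \<epsilon> (z::real^'n) * gaussian H w) \<in> borel_measurable (lborel \<Otimes>\<^sub>M lborel)"
      by measurable
    have "integrable lborel (\<lambda>z::real^'n. bump \<epsilon> z * ?Z)" by (intro integrable_mult_left integrable_bump e)
    then show "integrable lborel (\<lambda>z. \<integral>w. norm (case (z, w) of (z, w) \<Rightarrow> bump \<epsilon> (z::real^'n) * gaussian H w) \<partial>lborel)"
      using gaussian_pos[of H] by (simp add: abs_mult bump_nonneg less_imp_le gaussian_mass_def)
    show "AE z in lborel. integrable lborel (\<lambda>w. case (z, w) of (z, w) \<Rightarrow> bump \<epsilon> (z::real^'n) * gaussian H w)"
      using integrable_gaussian[OF H] by simp
  qed
  have int: "integrable (lborel \<Otimes>\<^sub>M lborel) (\<lambda>(z, w). ?f z w)"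
  proof (rule Bochner_Integration.integrable_bound)
    show "integrable (lborel \<Otimes>\<^sub>M lborel) (\<lambda>p. M * (case p of (z, w) \<Rightarrow> bump \<epsilon> (z::real^'n) * gaussian H w))"
      by (intro integrable_mult_right bg)
    show "(\<lambda>(z, w). ?f z w) \<in> borel_measurable (lborel \<Otimes>\<^sub>M lborel)" by measurable
    show "AE p in lborel \<Otimes>\<^sub>M lborel. norm (case p of (z, w) \<Rightarrow> ?f z w) \<le>
        norm (M * (case p of (z, w) \<Rightarrow> bump \<epsilon> (z::real^'n) * gaussian H w))"
    proof (intro always_eventually allI)
      fix p :: "(real^'n) \<times> (real^'n)"
      obtain z w where p: "p = (z, w)" by (cases p)
      have "\<bar>bump \<epsilon> z * gaussian H w\<bar> * \<bar>zero_ext (x - z - t *\<^sub>R \<beta> - sqrt t *\<^sub>R w)\<bar> \<le> \<bar>bump \<epsilon> z * gaussian H w\<bar> * M"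
        by (intro mult_left_mono zero_ext_bound) simp
      then show "norm (case p of (z, w) \<Rightarrow> ?f z w) \<le> norm (M * (case p of (z, w) \<Rightarrow> bump \<epsilon> (z::real^'n) * gaussian H w))"
        using M by (simp add: p abs_mult mult_ac)
    qed
  qed
  have "(\<integral>z. bump \<epsilon> z * heat_ext t (x - z) \<partial>lborel) = (1 / ?Z) * (\<integral>z. (\<integral>w. ?f z w \<partial>lborel) \<partial>lborel)"
    by (simp add: heat_ext_gaussian[OF t] mult.commute)
  also have "(\<integral>z. (\<integral>w. ?f z w \<partial>lborel) \<partial>lborel) = (\<integral>w. (\<integral>z. ?f z w \<partial>lborel) \<partial>lborel)"
    using lborel_pair.Fubini_integral[OF int] by simp
  also have "\<dots> = (\<integral>w. ?\<mu> * (gaussian H w * mollify \<epsilon> (x - t *\<^sub>R \<beta> - sqrt t *\<^sub>R w)) \<partial>lborel)"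
  proof (rule Bochner_Integration.integral_cong[OF refl])
    fix w
    have "(\<integral>z. ?f z w \<partial>lborel) = (\<integral>z. gaussian H w * (bump \<epsilon> z * zero_ext (x - t *\<^sub>R \<beta> - sqrt t *\<^sub>R w - z)) \<partial>lborel)"
      by (intro Bochner_Integration.integral_cong) (auto simp: algebra_simps)
    then show "(\<integral>z. ?f z w \<partial>lborel) = ?\<mu> * (gaussian H w * mollify \<epsilon> (x - t *\<^sub>R \<beta> - sqrt t *\<^sub>R w))"
      using bump_mass_pos[OF e, where 'n='n] by (simp add: mollify_eq)
  qed
  finally show ?thesis using bump_mass_pos[OF e, where 'n='n] by simp
qed

text \<open>The Taylor bound is inserted into the Gaussian average at
  \<open>v = - T *\<^sub>R \<beta> - sqrt T *\<^sub>R w\<close>, and first-order terms in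
  \<open>T\<close> are compared. The drift contributes \<open>- (\<beta> \<bullet> q)\<close>, the
  quadratic form at most \<open>CARD('n)\<close> by the second moment, the part odd in
  \<open>w\<close> nothing, and the quartic remainder only order \<open>T^2\<close>.\<close>

lemma mollified_linear_inequality:
  assumes e: "0 < \<epsilon>" and T0: "0 < T0"
    and mean: "\<And>T x. 0 < T \<Longrightarrow> T \<le> T0 \<Longrightarrow> dist xh x < \<epsilon> \<Longrightarrow> E x + T * g0 - S * T^2 \<le> heat_ext T x"
    and sub: "ball xh \<epsilon> \<subseteq> cbox a b" and C: "0 \<le> C"
    and upper: "\<And>v. mollify \<epsilon> (xh + v) \<le> mollify \<epsilon> xh + q \<bullet> v + (v \<bullet> (H *v v)) / 2 + C * norm v ^ 4"
  shows "g0 \<le> CARD('n) - \<beta> \<bullet> q"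
proof -
  let ?Z = "gaussian_mass H" and ?\<mu> = "bump_mass \<epsilon> TYPE('n)" and ?m = "mollify \<epsilon>"
  have Z: "0 < ?Z" by (rule gaussian_mass_pos[OF H])
  have \<mu>: "0 < ?\<mu>" by (rule bump_mass_pos[OF e])
  let ?Q = "\<lambda>w. w \<bullet> (H *v w)"
  define m4 where "m4 = (\<integral>w. norm w ^ 4 * gaussian H w \<partial>lborel) / ?Z"
  have m4: "0 \<le> m4" unfolding m4_def
    using Z by (intro divide_nonneg_pos Bochner_Integration.integral_nonneg) (auto simp: gaussian_def)
  \<comment> \<open>Bounds the collected coefficients of \<open>T^2\<close>; the factor 8 stems from
    \<open>power4_sum_le\<close>.\<close>
  define K where "K = \<bar>S\<bar> + ?Q \<beta> / 2 + C * (8 * (norm \<beta> ^ 4 + m4))"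
  have Qb: "0 \<le> ?Q \<beta>" using posdef_imp_nonneg[OF H] by (simp add: nonneg_matrix_def)
  have sym: "transpose H = H" using H by (simp add: posdef_matrix_def)
  have K: "0 \<le> K" using Qb C m4 by (simp add: K_def)
  have lin: "g0 \<le> CARD('n) - \<beta> \<bullet> q + T * K" if T: "0 < T" "T \<le> T0" "T \<le> 1" for T
  proof -
    define c where "c = ?m xh + T * g0 - S * T^2"
    have "c \<le> (1 / ?\<mu>) * (\<integral>z. bump \<epsilon> z * heat_ext T (xh - z) \<partial>lborel)"
    proof -
      let ?K = "M + (M + T * \<bar>g0\<bar> + \<bar>S\<bar> * T^2)"
      have "(\<integral>z. bump \<epsilon> z * (zero_ext (xh - z) + (T * g0 - S * T^2)) \<partial>lborel) \<le> (\<integral>z. bump \<epsilon> z * heat_ext T (xh - z) \<partial>lborel)"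
      proof (rule mollify_mono[OF e, where K="?K"])
        show "(\<lambda>z. heat_ext T (xh - z)) \<in> borel_measurable borel"
          using measurable_compose[OF _ measurable_heat_ext[OF T(1)], of "\<lambda>z. xh - z" borel] by simp
        fix z :: "real^'n"
        have "\<bar>T * g0 - S * T^2\<bar> \<le> T * \<bar>g0\<bar> + \<bar>S\<bar> * T^2"
          using abs_triangle_ineq4[of "T * g0" "S * T^2"] T by (simp add: abs_mult)
        then show "\<bar>zero_ext (xh - z) + (T * g0 - S * T^2)\<bar> \<le> ?K" using zero_ext_bound[of "xh - z"] M by linarith
        have "0 \<le> T * \<bar>g0\<bar>" "0 \<le> \<bar>S\<bar> * T^2" using T by auto
        then show "\<bar>heat_ext T (xh - z)\<bar> \<le> ?K" using heat_ext_bound[OF T(1), of "xh - z"] M by linarith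
        assume z: "norm z < \<epsilon>"
        then have "xh - z \<in> cbox a b" using sub by (auto simp: subset_iff dist_norm)
        then show "zero_ext (xh - z) + (T * g0 - S * T^2) \<le> heat_ext T (xh - z)"
          using mean[OF T(1,2), of "xh - z"] z by (simp add: zero_ext_def dist_norm)
      qed measurable
      also have "(\<integral>z. bump \<epsilon> z * (zero_ext (xh - z) + (T * g0 - S * T^2)) \<partial>lborel)
          = (\<integral>z. bump \<epsilon> z * zero_ext (xh - z) + bump \<epsilon> z * (T * g0 - S * T^2) \<partial>lborel)"
        by (simp add: distrib_left)
      also have "\<dots> = (\<integral>z. bump \<epsilon> z * zero_ext (xh - z) \<partial>lborel) + ?\<mu> * (T * g0 - S * T^2)"
        unfolding bump_mass_def
        by (subst Bochner_Integration.integral_add)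
           (auto intro!: integrable_bump_mult[OF e, where K=M] integrable_mult_left integrable_bump e simp: zero_ext_bound)
      finally have "((\<integral>z. bump \<epsilon> z * zero_ext (xh - z) \<partial>lborel) + ?\<mu> * (T * g0 - S * T^2)) / ?\<mu>
          \<le> (\<integral>z. bump \<epsilon> z * heat_ext T (xh - z) \<partial>lborel) / ?\<mu>"
        using \<mu> by (intro divide_right_mono) auto
      then show ?thesis unfolding c_def mollify_eq using \<mu> by (simp add: add_divide_distrib)
    qed
    also have "\<dots> = (1 / ?Z) * (\<integral>w. gaussian H w * ?m (xh - T *\<^sub>R \<beta> - sqrt T *\<^sub>R w) \<partial>lborel)"
      by (rule average_heat_ext[OF T(1) e])
    finally have 1: "c * ?Z \<le> (\<integral>w. gaussian H w * ?m (xh - T *\<^sub>R \<beta> - sqrt T *\<^sub>R w) \<partial>lborel)"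
      using Z by (simp add: field_simps)
    \<comment> \<open>\<open>A\<close> gathers the terms independent of \<open>w\<close>;
      \<open>pv\<close> is the coefficient of the part linear in \<open>w\<close>, which integrates
      to 0.\<close>
    define A where "A = ?m xh - T * (\<beta> \<bullet> q) + T^2 / 2 * ?Q \<beta> + C * (8 * (T^2 * norm \<beta> ^ 4))"
    define pv where "pv = - sqrt T *\<^sub>R q + (T * sqrt T) *\<^sub>R (H *v \<beta>)"
    let ?B = "\<lambda>w. A * gaussian H w + (pv \<bullet> w) * gaussian H w + T / 2 * (?Q w * gaussian H w) + C * 8 * T^2 * (norm w ^ 4 * gaussian H w)"
    have pw: "gaussian H w * ?m (xh - T *\<^sub>R \<beta> - sqrt T *\<^sub>R w) \<le> ?B w" for w
    proof -
      define v where "v = - (T *\<^sub>R \<beta>) - sqrt T *\<^sub>R w"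
      have Qv: "?Q v = T^2 * ?Q \<beta> + 2 * (T * sqrt T) * ((H *v \<beta>) \<bullet> w) + T * ?Q w"
      proof -
        have "?Q v = (T *\<^sub>R \<beta> + sqrt T *\<^sub>R w) \<bullet> (H *v (T *\<^sub>R \<beta> + sqrt T *\<^sub>R w))"
        proof -
          have "v = - (T *\<^sub>R \<beta> + sqrt T *\<^sub>R w)" by (simp add: v_def)
          then show ?thesis
            by (simp only: linear_neg[OF matrix_vector_mul_linear] inner_minus_left inner_minus_right minus_minus)
        qed
        also have "\<dots> = T * T * ?Q \<beta> + T * sqrt T * (\<beta> \<bullet> (H *v w)) + T * sqrt T * (w \<bullet> (H *v \<beta>)) + sqrt T * sqrt T * ?Q w"
          by (simp add: matrix_vector_right_distrib matrix_vector_mult_scaleR inner_add_left inner_add_right algebra_simps)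
        also have "\<beta> \<bullet> (H *v w) = (H *v \<beta>) \<bullet> w" by (simp add: symmetric_inner[OF sym, of \<beta> w] inner_commute)
        finally show ?thesis using T by (simp add: power2_eq_square inner_commute)
      qed
      have "norm v \<le> T * norm \<beta> + sqrt T * norm w"
        using norm_triangle_ineq4[of "- (T *\<^sub>R \<beta>)" "sqrt T *\<^sub>R w"] T by (simp add: v_def)
      then have "norm v ^ 4 \<le> (T * norm \<beta> + sqrt T * norm w) ^ 4" by (intro power_mono) auto
      also have "\<dots> \<le> 8 * ((T * norm \<beta>) ^ 4 + (sqrt T * norm w) ^ 4)" by (rule power4_sum_le)
      also have "\<dots> = 8 * (T ^ 4 * norm \<beta> ^ 4 + T^2 * norm w ^ 4)"
      proof -
        have "sqrt T ^ 4 = (sqrt T ^ 2) ^ 2" by (simp flip: power_mult)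
        then show ?thesis using T by (simp add: power_mult_distrib)
      qed
      also have "\<dots> \<le> 8 * (T^2 * norm \<beta> ^ 4 + T^2 * norm w ^ 4)"
        using T by (intro mult_left_mono add_right_mono mult_right_mono power_decreasing) auto
      finally have v4: "norm v ^ 4 \<le> 8 * (T^2 * norm \<beta> ^ 4 + T^2 * norm w ^ 4)" .
      have "?m (xh + v) \<le> ?m xh + q \<bullet> v + ?Q v / 2 + C * (8 * (T^2 * norm \<beta> ^ 4 + T^2 * norm w ^ 4))"
        using upper[of v] mult_left_mono[OF v4 C] by linarith
      also have "q \<bullet> v = - T * (\<beta> \<bullet> q) - sqrt T * (q \<bullet> w)"
        by (simp add: v_def inner_diff_right inner_commute)
      finally have "?m (xh + v) \<le> A + pv \<bullet> w + T / 2 * ?Q w + C * 8 * T^2 * norm w ^ 4"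
        unfolding Qv A_def pv_def by (simp add: inner_add_left algebra_simps add_divide_distrib)
      then have "gaussian H w * ?m (xh + v) \<le> gaussian H w * (A + pv \<bullet> w + T / 2 * ?Q w + C * 8 * T^2 * norm w ^ 4)"
        using gaussian_pos[of H w] by (intro mult_left_mono) auto
      then show ?thesis by (simp add: v_def algebra_simps)
    qed
    have ipw: "integrable lborel (\<lambda>w. (pv \<bullet> w) * gaussian H w)"
    proof (rule Bochner_Integration.integrable_bound)
      show "integrable lborel (\<lambda>w. norm pv * (norm w ^ 1 * gaussian H w))"
        by (intro integrable_mult_right integrable_norm_power_mult_gaussian H)
      show "AE w in lborel. norm (pv \<bullet> w * gaussian H w) \<le> norm (norm pv * (norm w ^ 1 * gaussian H w))"
        using Cauchy_Schwarz_ineq2[of pv] gaussian_pos[of H]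
        by (intro always_eventually) (auto simp: abs_mult simp flip: mult.assoc intro!: mult_right_mono)
    qed measurable
    have zero: "(\<integral>w. (pv \<bullet> w) * gaussian H w \<partial>lborel) = 0"
      using lborel_integral_affine[of "-1" "\<lambda>w. (pv \<bullet> w) * gaussian H w" 0]
      by (simp add: gaussian_even)
    have iB: "integrable lborel ?B"
      by (intro Bochner_Integration.integrable_add integrable_mult_right integrable_gaussian ipw
          gaussian_second_moment(2) integrable_norm_power_mult_gaussian H)
    have "(\<integral>w. gaussian H w * ?m (xh - T *\<^sub>R \<beta> - sqrt T *\<^sub>R w) \<partial>lborel) \<le> (\<integral>w. ?B w \<partial>lborel)"
    proof (rule integral_mono[OF _ iB pw])
      have mm: "?m \<in> borel_measurable borel"
        by (intro borel_measurable_continuous_onI C2_data_continuous(1)[OF mollify_C2_data])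
      have "integrable lborel (\<lambda>w. ?m (xh - T *\<^sub>R \<beta> - sqrt T *\<^sub>R w) * gaussian H w)"
        by (rule integrable_bounded_gaussian[where K=M])
           (use measurable_compose[OF _ mm, of "\<lambda>w. xh - T *\<^sub>R \<beta> - sqrt T *\<^sub>R w" borel] mollify_bound[OF e] in auto)
      then show "integrable lborel (\<lambda>w. gaussian H w * ?m (xh - T *\<^sub>R \<beta> - sqrt T *\<^sub>R w))"
        by (simp add: mult.commute)
    qed
    also have "\<dots> = A * ?Z + T / 2 * (\<integral>w. ?Q w * gaussian H w \<partial>lborel) + C * 8 * T^2 * (m4 * ?Z)"
      using Z unfolding m4_def gaussian_mass_def[symmetric]
      by (subst Bochner_Integration.integral_add
            Bochner_Integration.integral_add[of _ "\<lambda>w. A * gaussian H w + (pv \<bullet> w) * gaussian H w"]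
            Bochner_Integration.integral_add[of _ "\<lambda>w. A * gaussian H w"],
          (intro Bochner_Integration.integrable_add integrable_mult_right integrable_gaussian ipw
            gaussian_second_moment(2) integrable_norm_power_mult_gaussian H)+)+
         (simp add: zero gaussian_mass_def)
    also have "\<dots> \<le> A * ?Z + T / 2 * (2 * CARD('n) * ?Z) + C * 8 * T^2 * (m4 * ?Z)"
    proof -
      have "T / 2 * (\<integral>w. ?Q w * gaussian H w \<partial>lborel) \<le> T / 2 * (2 * CARD('n) * ?Z)"
        using gaussian_second_moment(1)[OF H] T by (intro mult_left_mono) auto
      then show ?thesis by linarith
    qed
    also have "\<dots> = (A + T * CARD('n) + C * 8 * T^2 * m4) * ?Z" by (simp add: algebra_simps)
    finally have "c * ?Z \<le> (A + T * CARD('n) + C * 8 * T^2 * m4) * ?Z" using 1 by (rule order_trans[rotated])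
    then have "c \<le> A + T * CARD('n) + C * 8 * T^2 * m4" using Z by (rule mult_right_le_imp_le)
    then have "T * g0 \<le> T * (CARD('n) - \<beta> \<bullet> q) + T^2 * (S + ?Q \<beta> / 2 + C * (8 * (norm \<beta> ^ 4 + m4)))"
      by (simp add: c_def A_def algebra_simps)
    also have "\<dots> \<le> T * (CARD('n) - \<beta> \<bullet> q) + T^2 * K"
      by (intro add_left_mono mult_left_mono) (auto simp: K_def)
    also have "\<dots> = T * (CARD('n) - \<beta> \<bullet> q + T * K)" by (simp add: power2_eq_square algebra_simps)
    finally show ?thesis using T by simp
  qed
  show ?thesis
  proof (rule field_le_epsilon)
    fix d :: real assume d: "0 < d"
    define T where "T = min (min T0 1) (d / (K + 1))"
    have "0 < T" "T \<le> T0" "T \<le> 1" using T0 d K by (auto simp: T_def)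
    from lin[OF this] have "g0 \<le> CARD('n) - \<beta> \<bullet> q + T * K" .
    moreover have "T * K \<le> d"
    proof -
      have "T * K \<le> d / (K + 1) * (K + 1)" using K d by (intro mult_mono) (auto simp: T_def)
      also have "\<dots> = d" using K by simp
      finally show ?thesis .
    qed
    ultimately show "g0 \<le> CARD('n) - \<beta> \<bullet> q + d" by linarith
  qed
qed

end

section \<open>Mollified subsolutions\<close>

lemma eventually_within_open_ball:
  fixes x :: "'a::metric_space"
  assumes "open S" "x \<in> S" "\<forall>\<^sub>F y in at x within S. P y" "P x"
  shows "\<exists>r>0. ball x r \<subseteq> S \<and> (\<forall>y\<in>ball x r. P y)"
proof -
  obtain d where d: "0 < d" "\<And>y. y \<in> S \<Longrightarrow> y \<noteq> x \<Longrightarrow> dist y x < d \<Longrightarrow> P y"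
    using assms(3) unfolding eventually_at by blast
  obtain r where r: "0 < r" "ball x r \<subseteq> S" using assms(1,2) by (meson open_contains_ball)
  have "P y" if "y \<in> ball x (min d r)" for y
    using that d(2)[of y] r assms(4) by (cases "y = x") (auto simp: dist_commute)
  then show ?thesis using d r by (intro exI[of _ "min d r"]) auto
qed

lemma local_max_in_ball:
  fixes u :: "'a::metric_space \<Rightarrow> real"
  assumes "open S" "local_max_in S u x"
  shows "\<exists>r>0. ball x r \<subseteq> S \<and> (\<forall>y\<in>ball x r. u y \<le> u x)"
  using assms eventually_within_open_ball[of S x "\<lambda>y. u y \<le> u x"] by (auto simp: local_max_in_def)

lemma local_min_in_ball:
  fixes u :: "'a::metric_space \<Rightarrow> real"
  assumes "open S" "local_min_in S u x"
  shows "\<exists>r>0. ball x r \<subseteq> S \<and> (\<forall>y\<in>ball x r. u x \<le> u y)"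
  using assms eventually_within_open_ball[of S x "\<lambda>y. u x \<le> u y"] by (auto simp: local_min_in_def)

lemma local_max_inI:
  fixes u :: "'a::metric_space \<Rightarrow> real"
  assumes "x \<in> S" "0 < r" "\<And>y. y \<in> S \<Longrightarrow> dist x y < r \<Longrightarrow> u y \<le> u x"
  shows "local_max_in S u x"
  using assms unfolding local_max_in_def eventually_at by (metis dist_commute)

lemma local_min_inI:
  fixes u :: "'a::metric_space \<Rightarrow> real"
  assumes "x \<in> S" "0 < r" "\<And>y. y \<in> S \<Longrightarrow> dist x y < r \<Longrightarrow> u x \<le> u y"
  shows "local_min_in S u x"
  using assms unfolding local_min_in_def eventually_at by (metis dist_commute)

lemma convex_on_midpoint:
  fixes u :: "'a::real_vector \<Rightarrow> real"
  assumes "convex_on S u" "x + v \<in> S" "x - v \<in> S"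
  shows "2 * u x \<le> u (x + v) + u (x - v)"
proof -
  have "x = (1 - 1/2) *\<^sub>R (x + v) + (1/2) *\<^sub>R (x - v)"
    by (simp add: algebra_simps flip: scaleR_add_left)
  then show ?thesis using convex_onD[OF assms(1), of "1/2" "x + v" "x - v"] assms by simp
qed

text \<open>The midpoint inequality at the touching point passes from \<open>u\<close> to
  \<open>\<phi>\<close>. It makes \<open>trace_inverse_ge\<close> applicable to every test function
  of a convex subsolution.\<close>

lemma convex_touching_above_nonneg_hessian:
  assumes S: "open S" and conv: "convex_on S u" and C: "C2_on S \<phi>"
    and mx: "local_max_in S (\<lambda>y. u y - \<phi> y) x"
  shows "nonneg_matrix (hessian \<phi> x)"
proof -
  note D = C2_on_imp_C2_data[OF C]
  obtain r where r: "0 < r" "ball x r \<subseteq> S" "\<And>y. y \<in> ball x r \<Longrightarrow> u y - \<phi> y \<le> u x - \<phi> x"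
    using local_max_in_ball[OF S mx] by metis
  have x: "x \<in> S" using r by auto
  have "2 * \<phi> x \<le> \<phi> (x + v) + \<phi> (x - v)" if "norm v < r" for v
  proof -
    have v: "x + v \<in> ball x r" "x - v \<in> ball x r" using that by (auto simp: dist_norm)
    then have "2 * u x \<le> u (x + v) + u (x - v)" using convex_on_midpoint[OF conv] r(2) by blast
    then show ?thesis using r(3)[OF v(1)] r(3)[OF v(2)] by linarith
  qed
  then show ?thesis
    using second_difference_nonneg[OF D S x r(1)] hessian_symmetric[OF D S x]
    by (simp add: nonneg_matrix_def)
qed

lemma powr_above_tangent:
  fixes r s p :: real
  assumes r: "0 < r" and s: "0 \<le> s" and p: "1 < p"
  shows "r powr p + p * r powr (p - 1) * (s - r) \<le> s powr p"
\<comment> \<open>The derivative criterion for convexity is used on the open half line, so the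
  endpoint 0 is treated by hand.\<close>
proof (cases "s = 0")
  case True
  have "r powr (p - 1) * r = r powr p" using r powr_add[of r "p - 1" 1] by simp
  then have "r powr p + p * r powr (p - 1) * (s - r) = (1 - p) * r powr p"
    using True by (simp add: algebra_simps)
  also have "\<dots> \<le> 0" using p by (intro mult_nonpos_nonneg) auto
  finally show ?thesis using True by simp
next
  case False
  have "((\<lambda>x. x powr p) has_real_derivative p * r powr (p - 1)) (at r within {0<..})"
    by (rule has_field_derivative_at_within[OF has_real_derivative_powr[OF r]])
  then have "p * r powr (p - 1) * (s - r) \<le> s powr p - r powr p"
    using r s p False by (intro convex_on_imp_above_tangent[OF powr_convex[of p]]) (auto simp: interior_open)
  then show ?thesis by simp
qed

text \<open>The scalar tangent inequality for the power, combined with the Cauchy-Schwarz inequality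
  for the radial slope. At \<open>q0 = 0\<close> the slope vanishes and nonnegativity
  remains.\<close>

lemma norm_powr_above_tangent:
  fixes q q0 :: "'a::real_inner"
  assumes p: "1 < p"
  shows "norm q0 powr p + ((p * norm q0 powr (p - 1) / norm q0) *\<^sub>R q0) \<bullet> (q - q0) \<le> norm q powr p"
proof (cases "q0 = 0")
  case False
  let ?r = "norm q0"
  have r: "0 < ?r" using False by simp
  have "q0 \<bullet> (q - q0) \<le> ?r * norm q - ?r * ?r"
    using norm_cauchy_schwarz[of q0 q] by (simp add: inner_diff_right dot_square_norm power2_eq_square)
  then have "(p * ?r powr (p - 1) / ?r) * (q0 \<bullet> (q - q0)) \<le> (p * ?r powr (p - 1) / ?r) * (?r * (norm q - ?r))"
    using p by (intro mult_left_mono) (auto simp: algebra_simps)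
  also have "\<dots> = p * ?r powr (p - 1) * (norm q - ?r)" using r by simp
  finally show ?thesis using powr_above_tangent[OF r norm_ge_zero[of q] p] by simp
qed (use p in simp)

context bounded_extension
begin

text \<open>The bound must hold for all \<open>v\<close> because the Gaussian average sees the whole
  space. Near \<open>x\<close> the surplus \<open>\<delta>\<close> in \<open>H\<close> absorbs the
  Taylor error; far away the quartic term dominates a bounded function and its linear part.\<close>

lemma mollify_upper_taylor:
  assumes e: "0 < \<epsilon>" and \<delta>: "0 < \<delta>" and psd: "nonneg_matrix (hessian (mollify \<epsilon>) x)"
  defines "H \<equiv> hessian (mollify \<epsilon>) x + \<delta> *\<^sub>R mat 1"
  shows "\<exists>C\<ge>0. \<forall>v. mollify \<epsilon> (x + v) \<le> mollify \<epsilon> x + gradient (mollify \<epsilon>) x \<bullet> v + (v \<bullet> (H *v v)) / 2 + C * norm v ^ 4"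
proof -
  let ?m = "mollify \<epsilon>" and ?g = "gradient (mollify \<epsilon>) x"
  have Hq: "v \<bullet> (H *v v) = v \<bullet> (hessian ?m x *v v) + \<delta> * (norm v)^2" for v
    by (simp add: H_def quadratic_form_add quadratic_form_scaleR power2_norm_eq_inner)
  have H0: "0 \<le> v \<bullet> (H *v v)" for v
    using psd \<delta> by (simp add: Hq nonneg_matrix_def)
  have "0 < \<delta> / 2" using \<delta> by simp
  from taylor_second_order[OF mollify_C2_data open_UNIV UNIV_I this, of x \<epsilon>] obtain d where d: "0 < d"
    "\<And>v. norm v < d \<Longrightarrow> \<bar>?m (x + v) - ?m x - ?g \<bullet> v - (v \<bullet> (hessian ?m x *v v)) / 2\<bar> \<le> \<delta> / 2 * (norm v)^2" by blast
  \<comment> \<open>For \<open>norm v \<ge> d\<close> one has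
    \<open>norm v ^ 4 / d ^ 4 \<ge> 1\<close> and \<open>norm v ^ 4 / d ^ 3 \<ge> norm v\<close>,
    which cover the oscillation \<open>2 * M\<close> and the linear term.\<close>
  define C where "C = 2 * M / d ^ 4 + norm ?g / d ^ 3"
  have C: "0 \<le> C" using M d by (simp add: C_def)
  have "?m (x + v) \<le> ?m x + ?g \<bullet> v + (v \<bullet> (H *v v)) / 2 + C * norm v ^ 4" for v
  proof (cases "norm v < d")
    case True
    have "0 \<le> C * norm v ^ 4" using C by simp
    moreover have "?m (x + v) - ?m x - ?g \<bullet> v - (v \<bullet> (hessian ?m x *v v)) / 2 \<le> \<delta> / 2 * (norm v)^2"
      using d(2)[OF True] by linarith
    ultimately show ?thesis unfolding Hq by (simp add: add_divide_distrib)
  next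
    case False
    then have dv: "d \<le> norm v" by simp
    have "2 * M = 2 * M / d ^ 4 * d ^ 4" using d by simp
    also have "\<dots> \<le> 2 * M / d ^ 4 * norm v ^ 4" using dv d M by (intro mult_left_mono power_mono) auto
    finally have 1: "2 * M \<le> 2 * M / d ^ 4 * norm v ^ 4" .
    have "norm ?g * norm v = norm ?g / d ^ 3 * (d ^ 3 * norm v)" using d by simp
    also have "\<dots> \<le> norm ?g / d ^ 3 * (norm v ^ 3 * norm v)"
      using dv d by (intro mult_left_mono mult_right_mono power_mono) auto
    also have "\<dots> = norm ?g / d ^ 3 * norm v ^ 4" by (simp add: eval_nat_numeral)
    finally have 2: "norm ?g * norm v \<le> norm ?g / d ^ 3 * norm v ^ 4" .
    have "C * norm v ^ 4 = 2 * M / d ^ 4 * norm v ^ 4 + norm ?g / d ^ 3 * norm v ^ 4"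
      by (simp add: C_def distrib_right)
    moreover have "- (norm ?g * norm v) \<le> ?g \<bullet> v" using Cauchy_Schwarz_ineq2[of ?g v] by linarith
    moreover have "?m (x + v) \<le> M" "- M \<le> ?m x"
      using mollify_bound[OF e, of "x + v"] mollify_bound[OF e, of x] by linarith+
    ultimately show ?thesis using 1 2 H0[of v] by linarith
  qed
  then show ?thesis using C by blast
qed

text \<open>The matrix \<open>H\<close> of the heat flow is the (slightly enlarged) Hessian of the mollified function itself, so
  that only the trace moment \<open>gaussian_second_moment\<close> enters.\<close>

lemma mollify_subsolution:
  assumes O: "open \<Omega>" and sub: "\<Omega> \<subseteq> cbox a b" and visc: "viscosity_subsolution c p f \<Omega> E"
    and p: "1 < p" and c: "0 \<le> c" and e: "0 < \<epsilon>" and r: "0 < r"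
    and ball: "ball xh (\<epsilon> + 3 * r) \<subseteq> \<Omega>"
    and fmin: "\<And>x. x \<in> ball xh (\<epsilon> + r) \<Longrightarrow> fmin \<le> f x"
  shows "fmin + c * norm (gradient (mollify \<epsilon>) xh) powr p \<le> monge_ampere (hessian (mollify \<epsilon>) xh)"
proof -
  let ?m = "mollify \<epsilon>" and ?n = "real CARD('n)"
  define q0 where "q0 = gradient ?m xh"
  have conv: "convex_on \<Omega> E" using visc by (simp add: viscosity_subsolution_def)
  have psd: "nonneg_matrix (hessian ?m xh)"
    by (rule mollify_hessian_psd[OF e sub conv, of "3 * r"]) (use r ball in auto)
  have main: "fmin + c * norm q0 powr p \<le> monge_ampere (hessian ?m xh + \<delta> *\<^sub>R mat 1)" if \<delta>: "0 < \<delta>" for \<delta>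
  proof -
    define H where "H = hessian ?m xh + \<delta> *\<^sub>R mat 1"
    have H: "posdef_matrix H" unfolding H_def by (rule posdef_add_id[OF psd \<delta>])
    define d where "d = monge_ampere H"
    have d: "0 < d" unfolding d_def by (rule monge_ampere_pos[OF H])
    \<comment> \<open>\<open>\<beta>0\<close> is the gradient of \<open>|q|^p\<close> at
      \<open>q0\<close>, and \<open>?n / d\<close> is the factor in \<open>trace_inverse_ge\<close>;
      \<open>\<beta>\<close> and \<open>g0\<close> thus belong to the equation linearised at
      \<open>H\<close> and \<open>q0\<close>.\<close>
    define \<beta>0 where "\<beta>0 = (p * norm q0 powr (p - 1) / norm q0) *\<^sub>R q0"
    define \<beta> where "\<beta> = (?n * c / d) *\<^sub>R \<beta>0"
    define g0 where "g0 = ?n / d * (fmin + c * norm q0 powr p - c * (\<beta>0 \<bullet> q0))"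
    interpret heat: heat_extension a b E M H \<beta> by unfold_locales (rule H)
    have visc': "g0 \<le> heat.generator (gradient \<phi> x) (hessian \<phi> x)"
      if "x1 \<in> ball xh \<epsilon>" "x \<in> ball x1 r" "C2_on \<Omega> \<phi>" "local_max_in \<Omega> (\<lambda>y. E y - \<phi> y) x" for x1 x \<phi>
    proof -
      let ?X = "hessian \<phi> x" and ?q = "gradient \<phi> x"
      have x: "x \<in> \<Omega>" using that(4) by (simp add: local_max_in_def)
      have X: "nonneg_matrix ?X" by (rule convex_touching_above_nonneg_hessian[OF O conv that(3,4)])
      have "x \<in> ball xh (\<epsilon> + r)" using that(1,2) dist_triangle[of xh x x1] by auto
      then have "fmin \<le> f x" by (rule fmin)
      moreover have "f x + c * norm ?q powr p \<le> monge_ampere ?X"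
        using visc x that(3,4) by (auto simp: viscosity_subsolution_def)
      moreover have "c * (norm q0 powr p + \<beta>0 \<bullet> (?q - q0)) \<le> c * norm ?q powr p"
        using norm_powr_above_tangent[OF p, of q0 ?q] c by (intro mult_left_mono) (auto simp: \<beta>0_def)
      ultimately have "fmin + c * (norm q0 powr p + \<beta>0 \<bullet> (?q - q0)) \<le> monge_ampere ?X" by linarith
      then have "?n / d * (fmin + c * (norm q0 powr p + \<beta>0 \<bullet> (?q - q0))) \<le> ?n / d * monge_ampere ?X"
        using d by (intro mult_left_mono) auto
      also have "\<dots> \<le> trace (matrix_inv H ** ?X)"
        using trace_inverse_ge[OF H X] by (simp add: d_def)
      finally have "?n / d * (fmin + c * (norm q0 powr p + \<beta>0 \<bullet> (?q - q0))) \<le> trace (matrix_inv H ** ?X)" .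
      moreover have "g0 + \<beta> \<bullet> ?q = ?n / d * (fmin + c * (norm q0 powr p + \<beta>0 \<bullet> (?q - q0)))"
        by (simp add: g0_def \<beta>_def inner_diff_right algebra_simps)
      ultimately show ?thesis by (simp add: heat.generator_def)
    qed
    have D: "ball x (3 * r) \<subseteq> \<Omega>" if "x \<in> ball xh \<epsilon>" for x
    proof
      fix y assume "y \<in> ball x (3 * r)"
      then have "y \<in> ball xh (\<epsilon> + 3 * r)" using that dist_triangle[of xh y x] by auto
      then show "y \<in> \<Omega>" using ball by blast
    qed
    have "\<exists>S T0. 0 < T0 \<and> (\<forall>T x. 0 < T \<and> T \<le> T0 \<and> x \<in> ball xh \<epsilon> \<longrightarrow> E x + T * g0 - S * T^2 \<le> heat.heat_ext T x)"
    proof (rule heat.heat_mean_value[OF O sub conv r])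
      show "ball x (3 * r) \<subseteq> \<Omega>" if "x \<in> ball xh \<epsilon>" for x by (rule D[OF that])
      show "g0 \<le> heat.generator (gradient \<phi> x) (hessian \<phi> x)"
        if "x1 \<in> ball xh \<epsilon>" "x \<in> ball x1 r" "C2_on \<Omega> \<phi>" "local_max_in \<Omega> (\<lambda>y. E y - \<phi> y) x" for x1 x \<phi>
        by (rule visc'[OF that])
    qed
    then obtain S T0 where
      T0: "0 < T0" and mean: "\<forall>T x. 0 < T \<and> T \<le> T0 \<and> x \<in> ball xh \<epsilon> \<longrightarrow> E x + T * g0 - S * T^2 \<le> heat.heat_ext T x"
      by metis
    obtain C where C: "0 \<le> C" "\<And>v. ?m (xh + v) \<le> ?m xh + q0 \<bullet> v + (v \<bullet> (H *v v)) / 2 + C * norm v ^ 4"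
      using mollify_upper_taylor[OF e \<delta> psd] unfolding H_def q0_def by metis
    have "g0 \<le> ?n - \<beta> \<bullet> q0"
    proof (rule heat.mollified_linear_inequality[OF e T0 _ _ C(1)])
      show "E x + T * g0 - S * T^2 \<le> heat.heat_ext T x" if "0 < T" "T \<le> T0" "dist xh x < \<epsilon>" for T x
        using mean that by simp
      show "ball xh \<epsilon> \<subseteq> cbox a b" using subset_ball[of \<epsilon> "\<epsilon> + 3 * r" xh] ball sub r by auto
    qed (rule C(2))
    \<comment> \<open>The linearisation is exact at \<open>q0\<close>: the drift terms in
      \<open>g0\<close> and \<open>\<beta> \<bullet> q0\<close> cancel, leaving the nonlinear
      inequality at \<open>H\<close>.\<close>
    then have "?n / d * (fmin + c * norm q0 powr p) \<le> ?n"
      by (simp add: g0_def \<beta>_def algebra_simps)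
    then have "?n * ((fmin + c * norm q0 powr p) / d) \<le> ?n * 1" by simp
    then have "(fmin + c * norm q0 powr p) / d \<le> 1" by (rule mult_left_le_imp_le) simp
    then show ?thesis using d by (simp add: pos_divide_le_eq d_def H_def)
  qed
  then have "fmin + c * norm q0 powr p \<le> monge_ampere (hessian ?m xh)" by (rule monge_ampere_perturbation_ge)
  then show ?thesis by (simp add: q0_def)
qed

end

section \<open>Comparison\<close>

context bounded_extension
begin

lemma mollify_close:
  assumes e: "0 < \<epsilon>" and sub: "ball x \<epsilon> \<subseteq> cbox a b"
    and close: "\<And>y. dist x y < \<epsilon> \<Longrightarrow> \<bar>E y - E x\<bar> \<le> \<eta>"
  shows "\<bar>mollify \<epsilon> x - E x\<bar> \<le> \<eta>"
proof -
  let ?\<mu> = "bump_mass \<epsilon> TYPE('n)" and ?I = "\<integral>z. bump \<epsilon> z * zero_ext (x - z) \<partial>lborel"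
  let ?K = "M + (M + \<bar>E x\<bar> + \<bar>\<eta>\<bar>)"
  have \<mu>: "0 < ?\<mu>" by (rule bump_mass_pos[OF e])
  have zero_ext: "\<bar>zero_ext (x - z) - E x\<bar> \<le> \<eta>" if "norm z < \<epsilon>" for z
  proof -
    have "dist x (x - z) < \<epsilon>" using that by (simp add: dist_norm)
    moreover from this have "x - z \<in> cbox a b" using sub by auto
    ultimately show ?thesis using close[of "x - z"] by (simp add: zero_ext_def)
  qed
  have K: "\<bar>zero_ext (x - z)\<bar> \<le> ?K" "\<bar>E x + \<eta>\<bar> \<le> ?K" "\<bar>E x - \<eta>\<bar> \<le> ?K" for z
    using zero_ext_bound[of "x - z"] M by linarith+
  have "?I \<le> (\<integral>z. bump \<epsilon> (z::real^'n) * (E x + \<eta>) \<partial>lborel)"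
    by (rule mollify_mono[OF e, where K="?K"]) (use K zero_ext in \<open>auto simp: abs_le_iff algebra_simps\<close>)
  then have 1: "?I \<le> ?\<mu> * (E x + \<eta>)" by (simp add: bump_mass_def)
  have "(\<integral>z. bump \<epsilon> (z::real^'n) * (E x - \<eta>) \<partial>lborel) \<le> ?I"
  proof (rule mollify_mono[OF e, where K="?K"])
    show "E x - \<eta> \<le> zero_ext (x - z)" if "norm z < \<epsilon>" for z using zero_ext[OF that] by linarith
  qed (use K in auto)
  then have 2: "?\<mu> * (E x - \<eta>) \<le> ?I" by (simp add: bump_mass_def)
  have "mollify \<epsilon> x = ?I / ?\<mu>" by (simp add: mollify_eq)
  moreover have "?I / ?\<mu> \<le> E x + \<eta>" using 1 \<mu> by (simp add: pos_divide_le_eq mult.commute)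
  moreover have "E x - \<eta> \<le> ?I / ?\<mu>" using 2 \<mu> by (simp add: pos_le_divide_eq mult.commute)
  ultimately show ?thesis by linarith
qed

end

text \<open>If \<open>E - v\<close> had a positive maximum \<open>m0\<close>, the mollification
  minus \<open>v\<close> would have a maximum strictly inside the compact set \<open>K\<close> where
  \<open>E - v \<ge> m0 / 2\<close>. There the mollification is itself a test function for
  \<open>v\<close>, and its nearly preserved subsolution inequality contradicts the gap between
  \<open>f\<close> and \<open>f'\<close>.\<close>

lemma strict_comparison:
  fixes \<Omega> :: "(real^'n) set"
  assumes O: "open \<Omega>" and bd: "bounded \<Omega>" and p: "1 < p" and c: "0 \<le> c"
    and E: "continuous_on UNIV E" and sub: "viscosity_subsolution c p f' \<Omega> E"
    and v: "continuous_on (closure \<Omega>) v" and super: "viscosity_supersolution c p f \<Omega> v"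
    and f: "continuous_on \<Omega> f" and f': "continuous_on \<Omega> f'" and ff': "\<And>x. x \<in> \<Omega> \<Longrightarrow> f x < f' x"
    and bdry: "\<And>x. x \<in> frontier \<Omega> \<Longrightarrow> E x \<le> v x"
    and x0: "x0 \<in> \<Omega>"
  shows "E x0 \<le> v x0"
proof (rule ccontr)
  assume "\<not> E x0 \<le> v x0"
  define W where "W x = E x - v x" for x
  have W0: "0 < W x0" using \<open>\<not> E x0 \<le> v x0\<close> by (simp add: W_def)
  have clO: "\<Omega> \<subseteq> closure \<Omega>" by (rule closure_subset)
  have Wc: "continuous_on (closure \<Omega>) W"
    unfolding W_def[abs_def] by (intro continuous_intros v continuous_on_subset[OF E]) auto
  have comp: "compact (closure \<Omega>)" using bd by simp
  have "closure \<Omega> \<noteq> {}" using x0 clO by auto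
  from continuous_attains_sup[OF comp this Wc] obtain xm where
    xm: "xm \<in> closure \<Omega>" "\<And>y. y \<in> closure \<Omega> \<Longrightarrow> W y \<le> W xm" by blast
  define m0 where "m0 = W xm"
  have m0: "0 < m0" using xm(2)[of x0] x0 clO W0 by (auto simp: m0_def)
  define K where "K = closure \<Omega> \<inter> W -` {m0 / 2..}"
  have "closed K" unfolding K_def by (intro continuous_closed_preimage Wc closed_atLeast closed_closure)
  then have K: "compact K" using comp by (metis K_def compact_Int_closed inf.left_idem inf_commute)
  have xmK: "xm \<in> K" using xm m0 by (simp add: K_def m0_def)
  have KO: "K \<subseteq> \<Omega>"
  proof
    fix x assume x: "x \<in> K"
    show "x \<in> \<Omega>"
    proof (rule ccontr)
      assume "x \<notin> \<Omega>"
      then have "x \<in> frontier \<Omega>" using x O by (simp add: K_def frontier_def interior_open)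
      then have "W x \<le> 0" using bdry by (simp add: W_def)
      then show False using x m0 by (simp add: K_def)
    qed
  qed
  obtain \<rho> where \<rho>: "0 < \<rho>" "(\<Union>x\<in>K. cball x \<rho>) \<subseteq> \<Omega>"
    using compact_subset_open_imp_cball_epsilon_subset[OF K O KO] by blast
  define K2 where "K2 = (\<Union>x\<in>K. cball x \<rho>)"
  have K2: "compact K2" unfolding K2_def by (rule compact_minkowski_sum_cball[OF K])
  have K2O: "K2 \<subseteq> \<Omega>" using \<rho> by (simp add: K2_def)
  have xmK2: "xm \<in> K2" using xmK \<rho> by (force simp: K2_def)
  have "continuous_on K2 (\<lambda>x. f' x - f x)"
    by (intro continuous_intros continuous_on_subset[OF f] continuous_on_subset[OF f'] K2O)
  from continuous_attains_inf[OF K2 _ this] xmK2 obtain xs where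
    xs: "xs \<in> K2" "\<And>x. x \<in> K2 \<Longrightarrow> f' xs - f xs \<le> f' x - f x" by blast
  \<comment> \<open>The gap may close at the boundary of the domain; on the compact neighbourhood
    \<open>K2\<close> of \<open>K\<close> it has a positive minimum.\<close>
  define \<sigma> where "\<sigma> = f' xs - f xs"
  have \<sigma>: "0 < \<sigma>" using ff' xs(1) K2O by (auto simp: \<sigma>_def)
  have "uniformly_continuous_on K2 f'" "uniformly_continuous_on K2 E"
    by (auto intro!: compact_uniformly_continuous K2 continuous_on_subset[OF f'] K2O continuous_on_subset[OF E])
  then obtain \<delta>1 \<delta>2 where \<delta>: "0 < \<delta>1" "0 < \<delta>2"
    "\<And>x y. x \<in> K2 \<Longrightarrow> y \<in> K2 \<Longrightarrow> dist y x < \<delta>1 \<Longrightarrow> dist (f' y) (f' x) < \<sigma> / 2"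
    "\<And>x y. x \<in> K2 \<Longrightarrow> y \<in> K2 \<Longrightarrow> dist y x < \<delta>2 \<Longrightarrow> dist (E y) (E x) < m0 / 8"
    using \<sigma> m0 unfolding uniformly_continuous_on_def by (metis half_gt_zero zero_less_divide_iff zero_less_numeral)
  define s where "s = min \<rho> (min \<delta>1 \<delta>2)"
  have s: "0 < s" "s \<le> \<rho>" "s \<le> \<delta>1" "s \<le> \<delta>2" using \<rho> \<delta> by (auto simp: s_def)
  \<comment> \<open>\<open>mollify_subsolution\<close> is used with \<open>r = \<epsilon>\<close>:
    the ball of radius \<open>4 * \<epsilon> = s / 2\<close> must lie in the domain, and
    \<open>f'\<close> may drop by at most \<open>\<sigma> / 2\<close> within radius
    \<open>2 * \<epsilon>\<close>.\<close>
  define \<epsilon> where "\<epsilon> = s / 8"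
  have e: "0 < \<epsilon>" using s by (simp add: \<epsilon>_def)
  obtain a b where ab: "\<Omega> \<subseteq> cbox a b"
    using bounded_subset_cbox_symmetric[OF bd] by metis
  have "compact (E ` cbox a b)"
    by (intro compact_continuous_image continuous_on_subset[OF E] compact_cbox) auto
  then have "bounded (E ` cbox a b)" by (rule compact_imp_bounded)
  then obtain M where M: "0 < M" "\<And>y. y \<in> cbox a b \<Longrightarrow> \<bar>E y\<bar> \<le> M"
    unfolding bounded_pos by (auto simp: real_norm_def)
  interpret bounded_extension a b E M
    by unfold_locales (use M in \<open>auto intro: continuous_on_subset[OF E]\<close>)
  let ?m = "mollify \<epsilon>"
  have inK2: "y \<in> K2" if "x \<in> K" "dist x y \<le> \<rho>" for x y using that by (auto simp: K2_def)
  have ballO: "ball x t \<subseteq> \<Omega>" if "x \<in> K" "t \<le> s" for x t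
    using inK2[OF that(1)] that(2) s K2O by (auto simp: subset_iff)
  have close: "\<bar>?m x - E x\<bar> \<le> m0 / 8" if x: "x \<in> K" for x
  proof (rule mollify_close[OF e])
    show "ball x \<epsilon> \<subseteq> cbox a b" using ballO[OF x, of \<epsilon>] ab s by (auto simp: \<epsilon>_def)
    fix y assume y: "dist x y < \<epsilon>"
    then have "dist (E y) (E x) < m0 / 8"
      using inK2[OF x, of y] inK2[OF x, of x] s e by (intro \<delta>(4)) (auto simp: \<epsilon>_def dist_commute)
    then show "\<bar>E y - E x\<bar> \<le> m0 / 8" by (simp add: dist_real_def)
  qed
  have "continuous_on K (\<lambda>x. ?m x - v x)"
  proof (intro continuous_intros)
    show "continuous_on K ?m"
      by (rule continuous_on_subset[OF C2_data_continuous(1)[OF mollify_C2_data]]) simp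
    show "continuous_on K v" using KO clO by (intro continuous_on_subset[OF v]) auto
  qed
  from continuous_attains_sup[OF K _ this] xmK obtain xh where
    xh: "xh \<in> K" "\<And>x. x \<in> K \<Longrightarrow> ?m x - v x \<le> ?m xh - v xh" by blast
  have xhO: "xh \<in> \<Omega>" using xh KO by auto
  \<comment> \<open>Two errors of \<open>m0 / 8\<close> leave \<open>W xh \<ge> 3 / 4 * m0\<close>.
    Strictness makes \<open>K\<close> a neighbourhood of \<open>xh\<close>, so the maximum over
    \<open>K\<close> is a local one.\<close>
  have "m0 / 2 < W xh"
  proof -
    have "E xm - m0 / 8 \<le> ?m xm" "?m xh \<le> E xh + m0 / 8"
      using close[OF xmK, unfolded abs_diff_le_iff] close[OF xh(1), unfolded abs_diff_le_iff] by blast+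
    moreover have "E xm = m0 + v xm" "E xh = W xh + v xh" by (simp_all add: m0_def W_def)
    ultimately show ?thesis using xh(2)[OF xmK] m0 by linarith
  qed
  moreover have "continuous_on \<Omega> W" by (rule continuous_on_subset[OF Wc clO])
  ultimately have "\<forall>\<^sub>F y in at xh within \<Omega>. m0 / 2 < W y"
    using xhO by (metis continuous_on_def order_tendstoD(1))
  then obtain r' where r': "0 < r'" "\<And>y. y \<in> \<Omega> \<Longrightarrow> y \<noteq> xh \<Longrightarrow> dist y xh < r' \<Longrightarrow> m0 / 2 < W y"
    unfolding eventually_at by blast
  have lmin: "local_min_in \<Omega> (\<lambda>y. v y - ?m y) xh"
  proof (rule local_min_inI[OF xhO r'(1)])
    fix y assume y: "y \<in> \<Omega>" "dist xh y < r'"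
    have "y \<in> K"
    proof (cases "y = xh")
      case False
      then have "m0 / 2 < W y" using r'(2) y by (simp add: dist_commute)
      then show ?thesis using y clO by (auto simp: K_def)
    qed (use xh in simp)
    then show "v xh - ?m xh \<le> v y - ?m y" using xh(2)[of y] by linarith
  qed
  have conv: "convex_on \<Omega> E" using sub by (simp add: viscosity_subsolution_def)
  have psd: "nonneg_matrix (hessian ?m xh)"
    by (rule mollify_hessian_psd[OF e ab conv e]) (intro ballO xh, use s in \<open>simp add: \<epsilon>_def\<close>)
  have "C2_on \<Omega> ?m"
    by (rule C2_data_imp_C2_on[OF C2_data_subset[OF mollify_C2_data] O]) simp
  then have 1: "monge_ampere (hessian ?m xh) \<le> f xh + c * norm (gradient ?m xh) powr p"
    using super xhO lmin psd by (auto simp: viscosity_supersolution_def)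
  have 2: "(f' xh - \<sigma> / 2) + c * norm (gradient ?m xh) powr p \<le> monge_ampere (hessian ?m xh)"
  proof (rule mollify_subsolution[OF O ab sub p c e e])
    show "ball xh (\<epsilon> + 3 * \<epsilon>) \<subseteq> \<Omega>" by (intro ballO xh) (use s in \<open>simp add: \<epsilon>_def\<close>)
    fix x assume "x \<in> ball xh (\<epsilon> + \<epsilon>)"
    then have d: "dist xh x < s / 4" by (simp add: \<epsilon>_def)
    then have "dist (f' x) (f' xh) < \<sigma> / 2"
      using inK2[OF xh(1), of x] inK2[OF xh(1), of xh] s by (intro \<delta>(3)) (auto simp: dist_commute)
    then show "f' xh - \<sigma> / 2 \<le> f' x" unfolding dist_real_def abs_diff_less_iff by linarith
  qed
  have "\<sigma> \<le> f' xh - f xh" unfolding \<sigma>_def using xh(1) \<rho> by (intro xs(2)) (auto intro!: inK2)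
  then show False using 1 2 \<sigma> by linarith
qed

section \<open>Convex combinations with paraboloids and the comparison principle\<close>

lemma norm_powr_convex_combination:
  fixes q r :: "'a::real_inner"
  assumes p: "1 < p" and l: "0 \<le> l" "l \<le> 1"
  shows "norm ((1 - l) *\<^sub>R q + l *\<^sub>R r) powr p \<le> (1 - l) * norm q powr p + l * norm r powr p"
proof -
  define z where "z = (1 - l) *\<^sub>R q + l *\<^sub>R r"
  define B where "B = (p * norm z powr (p - 1) / norm z) *\<^sub>R z"
  have "norm z powr p = (1 - l) * (norm z powr p + B \<bullet> (q - z)) + l * (norm z powr p + B \<bullet> (r - z))"
  proof -
    have "(1 - l) * (B \<bullet> (q - z)) + l * (B \<bullet> (r - z)) = B \<bullet> ((1 - l) *\<^sub>R q + l *\<^sub>R r - z)"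
      by (simp add: inner_diff_right inner_add_right algebra_simps)
    also have "\<dots> = 0" by (simp only: z_def[symmetric] diff_self inner_zero_right)
    finally show ?thesis by (simp add: algebra_simps)
  qed
  also have "\<dots> \<le> (1 - l) * norm q powr p + l * norm r powr p"
    using norm_powr_above_tangent[OF p, of z] l by (intro add_mono mult_left_mono) (auto simp: B_def)
  finally show ?thesis by (simp add: z_def)
qed

text \<open>With Hessian \<open>s *\<^sub>R mat 1\<close> and gradient of length at most
  \<open>s * R\<close> in the ball, the subsolution property follows from
  \<open>M + c * (s * R) powr p \<le> s\<close>, where \<open>M\<close> bounds
  \<open>f\<close>.\<close>

definition paraboloid :: "real \<Rightarrow> real \<Rightarrow> real^'n \<Rightarrow> real^'n \<Rightarrow> real" where
  "paraboloid s R y x = s / 2 * ((norm (x - y))^2 - R^2)"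

lemma paraboloid_C2_data:
  "C2_data S (paraboloid s R y) (\<lambda>x. s *\<^sub>R (x - y)) (\<lambda>x. s *\<^sub>R mat 1)"
proof -
  have "C2_data S (\<lambda>x. s / 2 * ((norm (x - y))^2) + (- (s / 2 * R^2)))
      (\<lambda>x. (s / 2) *\<^sub>R (2 *\<^sub>R (x - y)) + 0) (\<lambda>x. (s / 2) *\<^sub>R (2 *\<^sub>R mat 1) + 0)"
    by (intro C2_data_add C2_data_scale C2_data_square C2_data_const)
  then show ?thesis by (simp add: paraboloid_def[abs_def] right_diff_distrib)
qed

lemma convex_on_norm_square:
  assumes "convex S" shows "convex_on S (\<lambda>x::'a::real_inner. (norm (x - y))^2)"
proof (rule convex_onI[OF _ assms])
  fix t :: real and x z :: 'a
  assume t: "0 < t" "t < 1"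
  have eq: "(1 - t) *\<^sub>R x + t *\<^sub>R z - y = (1 - t) *\<^sub>R (x - y) + t *\<^sub>R (z - y)" by (simp add: algebra_simps)
  define X where "X = x - y"
  define Z where "Z = z - y"
  have "(1 - t) * (norm X)^2 + t * (norm Z)^2 - (norm ((1 - t) *\<^sub>R X + t *\<^sub>R Z))^2 = (1 - t) * t * (norm (X - Z))^2"
    unfolding power2_norm_eq_inner
    by (simp add: inner_add_left inner_add_right inner_diff_left inner_diff_right inner_commute algebra_simps)
  moreover have "0 \<le> (1 - t) * t * (norm (X - Z))^2" using t by simp
  ultimately show "(norm ((1 - t) *\<^sub>R x + t *\<^sub>R z - y))^2 \<le> (1 - t) * (norm (x - y))^2 + t * (norm (z - y))^2"
    unfolding eq X_def[symmetric] Z_def[symmetric] by linarith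
qed

lemma convex_on_paraboloid: assumes "convex S" "0 \<le> s" shows "convex_on S (paraboloid s R y)"
proof -
  have "convex_on S (\<lambda>x. s / 2 * (norm (x - y))^2 + - (s / 2 * R^2))"
    using assms by (intro convex_on_add convex_on_cmul convex_on_norm_square) (auto simp: convex_on_const)
  then show ?thesis by (simp add: paraboloid_def[abs_def] right_diff_distrib)
qed

text \<open>Superadditivity of \<open>monge_ampere\<close> and convexity of the power work in the
  same direction. A test function for the combination becomes one for \<open>u\<close> after
  subtracting the smooth paraboloid and dividing by \<open>1 - l\<close>. The new right-hand side
  keeps the distance to \<open>y\<close> rather than \<open>R\<close>, which is the source of
  strictness inside the ball.\<close>

lemma convex_combination_subsolution:
  fixes \<Omega> :: "(real^'n) set"
  assumes O: "open \<Omega>" and cO: "convex \<Omega>" and p: "1 < p" and c: "0 \<le> c" and s: "0 \<le> s"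
    and u: "viscosity_subsolution c p f \<Omega> u" and l: "0 < l" "l < 1"
  shows "viscosity_subsolution c p (\<lambda>x. (1 - l) * f x + l * (s - c * (s * norm (x - y)) powr p)) \<Omega>
    (\<lambda>x. (1 - l) * u x + l * paraboloid s R y x)" (is "viscosity_subsolution c p ?f \<Omega> ?E")
  unfolding viscosity_subsolution_def
proof (intro conjI ballI allI impI)
  have conv: "convex_on \<Omega> u" using u by (simp add: viscosity_subsolution_def)
  show "convex_on \<Omega> ?E"
    using l by (intro convex_on_add convex_on_cmul conv convex_on_paraboloid cO s) auto
  fix x \<phi> assume x: "x \<in> \<Omega>" and "C2_on \<Omega> \<phi> \<and> local_max_in \<Omega> (\<lambda>y. ?E y - \<phi> y) x"
  then have C: "C2_on \<Omega> \<phi>" and mx: "local_max_in \<Omega> (\<lambda>y. ?E y - \<phi> y) x" by auto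
  define \<psi> where "\<psi> x = (1 / (1 - l)) * (\<phi> x - l * paraboloid s R y x)" for x
  have D: "C2_data \<Omega> \<psi> (\<lambda>x. (1 / (1 - l)) *\<^sub>R (gradient \<phi> x - l *\<^sub>R (s *\<^sub>R (x - y))))
     (\<lambda>x. (1 / (1 - l)) *\<^sub>R (hessian \<phi> x - l *\<^sub>R (s *\<^sub>R mat 1)))"
    unfolding \<psi>_def[abs_def]
    by (intro C2_data_scale C2_data_diff paraboloid_C2_data C2_on_imp_C2_data[OF C])
  note gh = C2_data_gradient_hessian(1,2)[OF D O x]
  have C\<psi>: "C2_on \<Omega> \<psi>" by (rule C2_data_imp_C2_on[OF D O])
  have mx\<psi>: "local_max_in \<Omega> (\<lambda>y. u y - \<psi> y) x"
  proof -
    have "u z - \<psi> z = (1 / (1 - l)) * (?E z - \<phi> z)" for z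
      using l by (simp add: \<psi>_def field_simps)
    then show ?thesis using mx l by (simp add: local_max_in_def divide_le_cancel)
  qed
  have psd: "nonneg_matrix (hessian \<psi> x)" by (rule convex_touching_above_nonneg_hessian[OF O conv C\<psi> mx\<psi>])
  have Fu: "f x + c * norm (gradient \<psi> x) powr p \<le> monge_ampere (hessian \<psi> x)"
    using u x C\<psi> mx\<psi> by (auto simp: viscosity_subsolution_def)
  have h: "hessian \<phi> x = (1 - l) *\<^sub>R hessian \<psi> x + (l * s) *\<^sub>R mat 1" using l by (simp add: gh)
  have g: "gradient \<phi> x = (1 - l) *\<^sub>R gradient \<psi> x + l *\<^sub>R (s *\<^sub>R (x - y))" using l by (simp add: gh)
  have "(1 - l) * monge_ampere (hessian \<psi> x) + l * s \<le> monge_ampere (hessian \<phi> x)"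
    using monge_ampere_superadditive[OF nonneg_matrix_scaleR[OF psd, of "1 - l"] nonneg_matrix_scaleR[OF nonneg_matrix_id, of "l * s"]] l s
    by (simp add: h monge_ampere_scaleR monge_ampere_id)
  moreover have "(1 - l) * (f x + c * norm (gradient \<psi> x) powr p) \<le> (1 - l) * monge_ampere (hessian \<psi> x)"
    using Fu l by (intro mult_left_mono) auto
  moreover have "c * norm (gradient \<phi> x) powr p \<le> c * ((1 - l) * norm (gradient \<psi> x) powr p + l * (s * norm (x - y)) powr p)"
    using norm_powr_convex_combination[OF p, of l "gradient \<psi> x" "s *\<^sub>R (x - y)"] l c s
    unfolding g by (intro mult_left_mono) auto
  ultimately show "?f x + c * norm (gradient \<phi> x) powr p \<le> monge_ampere (hessian \<phi> x)"
    by (simp add: algebra_simps)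
qed

lemma comparison_principle:
  fixes \<Omega> :: "(real^'n) set"
  assumes O: "open \<Omega>" and cO: "convex \<Omega>" and bd: "bounded \<Omega>" and p: "1 < p" and c: "0 < c" and s: "0 < s"
    and y: "\<And>x. x \<in> \<Omega> \<Longrightarrow> norm (x - y) < R" and R: "0 < R"
    and M: "\<And>x. x \<in> \<Omega> \<Longrightarrow> f x \<le> M" and sM: "M + c * (s * R) powr p \<le> s"
    and f: "continuous_on \<Omega> f"
    and u: "continuous_on (closure \<Omega>) u" "viscosity_subsolution c p f \<Omega> u" "\<And>x. x \<in> frontier \<Omega> \<Longrightarrow> u x = 0"
    and v: "continuous_on (closure \<Omega>) v" "viscosity_supersolution c p f \<Omega> v" "\<And>x. x \<in> frontier \<Omega> \<Longrightarrow> v x = 0"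
    and x0: "x0 \<in> \<Omega>"
  shows "u x0 \<le> v x0"
proof -
  \<comment> \<open>Zero boundary values make this extension continuous on the whole space, as
    \<open>strict_comparison\<close> demands of the function to be mollified.\<close>
  define U where "U x = (if x \<in> \<Omega> then u x else 0)" for x
  have Uc: "continuous_on UNIV U"
  proof -
    have "continuous_on (closure \<Omega> \<union> - \<Omega>) U"
      unfolding U_def[abs_def]
      by (rule continuous_on_cases) (use O u in \<open>auto simp: frontier_def interior_open\<close>)
    moreover have "closure \<Omega> \<union> - \<Omega> = UNIV" using closure_subset by auto
    ultimately show ?thesis by simp
  qed
  have ple: "paraboloid s R y x \<le> 0" if "x \<in> closure \<Omega>" for x
  proof -
    have "\<Omega> \<subseteq> cball y R" using y by (auto simp: dist_norm norm_minus_commute less_imp_le)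
    then have "x \<in> cball y R" using closure_minimal[of \<Omega> "cball y R"] that by auto
    then have "(norm (x - y))^2 \<le> R^2" by (intro power_mono) (auto simp: dist_norm norm_minus_commute)
    then show ?thesis using s by (simp add: paraboloid_def mult_nonneg_nonpos)
  qed
  have main: "(1 - l) * u x0 + l * paraboloid s R y x0 \<le> v x0" if l: "0 < l" "l < 1" for l
  proof -
    let ?f = "\<lambda>x. (1 - l) * f x + l * (s - c * (s * norm (x - y)) powr p)"
    let ?E = "\<lambda>x. (1 - l) * U x + l * paraboloid s R y x"
    have Uu: "U x = u x" if "x \<in> \<Omega>" for x using that by (simp add: U_def)
    have vu: "viscosity_subsolution c p f \<Omega> U"
    proof -
      have "convex_on \<Omega> U" 
        using u(2) cO unfolding viscosity_subsolution_def convex_on_def by (auto simp: Uu convexD)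
      moreover have "local_max_in \<Omega> (\<lambda>y. U y - \<psi> y) x \<longleftrightarrow> local_max_in \<Omega> (\<lambda>y. u y - \<psi> y) x" for \<psi> x
        unfolding local_max_in_def eventually_at using Uu by auto
      ultimately show ?thesis using u(2) by (auto simp: viscosity_subsolution_def)
    qed
    have "?E x0 \<le> v x0"
    proof (rule strict_comparison[OF O bd p less_imp_le[OF c] _ convex_combination_subsolution[OF O cO p less_imp_le[OF c] less_imp_le[OF s] vu l] v(1,2) f _ _ _ x0])
      show "continuous_on UNIV ?E" unfolding paraboloid_def by (intro continuous_intros Uc)
      have cp: "continuous_on \<Omega> (\<lambda>x. (s * norm (x - y)) powr p)"
        by (rule continuous_on_powr') (use p s in \<open>auto intro!: continuous_intros\<close>)
      show "continuous_on \<Omega> ?f"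
        by (intro continuous_on_add continuous_on_mult continuous_on_diff continuous_on_const f cp)
      show "f x < ?f x" if x: "x \<in> \<Omega>" for x
      proof -
        have "(s * norm (x - y)) powr p < (s * R) powr p"
          using y[OF x] s p by (intro powr_less_mono2) auto
        then have "c * (s * norm (x - y)) powr p < c * (s * R) powr p" using c by simp
        then have "f x < s - c * (s * norm (x - y)) powr p" using M[OF x] sM by linarith
        then have "l * f x < l * (s - c * (s * norm (x - y)) powr p)" using l by simp
        then show ?thesis by (simp add: algebra_simps)
      qed
      show "?E x \<le> v x" if x: "x \<in> frontier \<Omega>" for x
      proof -
        have "x \<notin> \<Omega>" "x \<in> closure \<Omega>" using x O by (auto simp: frontier_def interior_open)
        then show ?thesis using v(3)[OF x] ple[of x] l by (simp add: U_def mult_nonneg_nonpos)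
      qed
    qed
    then show ?thesis using x0 by (simp add: U_def)
  qed
  show ?thesis
  proof (rule field_le_epsilon)
    fix e :: real assume e: "0 < e"
    define A where "A = \<bar>u x0 - paraboloid s R y x0\<bar> + 1"
    define l where "l = min (1 / 2) (e / A)"
    have A: "0 < A" by (simp add: A_def)
    have l: "0 < l" "l < 1" using e A by (auto simp: l_def)
    have "u x0 \<le> v x0 + l * (u x0 - paraboloid s R y x0)" using main[OF l] by (simp add: algebra_simps)
    also have "l * (u x0 - paraboloid s R y x0) \<le> l * A" using l by (intro mult_left_mono) (auto simp: A_def)
    also have "\<dots> \<le> e / A * A" using A by (intro mult_right_mono) (auto simp: l_def)
    finally show "u x0 \<le> v x0 + e" using A by simp
  qed
qed

section \<open>Perron's method\<close>

text \<open>A test function touching \<open>w\<close> from above at \<open>x\<close> also touches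
  \<open>\<zeta>\<close> there, hence has the same gradient and the larger Hessian; monotonicity of
  the operator does the rest. It serves the paraboloids, with \<open>w\<close> equal to
  \<open>\<zeta>\<close>, and the glued function in Perron's method.\<close>

lemma touching_from_below_inequality:
  fixes w \<zeta> :: "real^'n \<Rightarrow> real"
  assumes O: "open \<Omega>" and S: "open S" "x \<in> S" "S \<subseteq> \<Omega>" and \<zeta>: "C2_data S \<zeta> g h"
    and le: "\<And>y. y \<in> S \<Longrightarrow> \<zeta> y \<le> w y" and eq: "\<zeta> x = w x"
    and psd: "nonneg_matrix (h x)" and ineq: "F + c * norm (g x) powr p \<le> monge_ampere (h x)"
    and C: "C2_on \<Omega> \<phi>" and mx: "local_max_in \<Omega> (\<lambda>y. w y - \<phi> y) x"
  shows "F + c * norm (gradient \<phi> x) powr p \<le> monge_ampere (hessian \<phi> x)"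
proof -
  obtain r where r: "0 < r" "ball x r \<subseteq> \<Omega>" "\<And>y. y \<in> ball x r \<Longrightarrow> w y - \<phi> y \<le> w x - \<phi> x"
    using local_max_in_ball[OF O mx] by metis
  obtain r' where r': "0 < r'" "ball x r' \<subseteq> S" using S by (meson open_contains_ball)
  note D = C2_data_subset[OF C2_on_imp_C2_data[OF C] S(3)]
  have "0 < min r r'" using r r' by simp
  moreover have "\<phi> x - \<zeta> x \<le> \<phi> y - \<zeta> y" if "dist y x < min r r'" for y
    using r(3)[of y] le[of y] eq r'(2) that by (auto simp: dist_commute subset_iff)
  ultimately have "gradient \<phi> x = g x" "nonneg_matrix (hessian \<phi> x - h x)"
    using touching_C2[OF D \<zeta> S(1,2)] by blast+
  then show ?thesis using ineq monge_ampere_mono[OF psd, of "hessian \<phi> x"] by simp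
qed

text \<open>Two uses of the mean value theorem along the segment: for \<open>\<zeta>\<close>, and
  for its directional derivative, which grows by the Hessian form.\<close>

lemma convex_above_tangent:
  fixes \<zeta> :: "real^'n \<Rightarrow> real"
  assumes C: "C2_data S \<zeta> g h" and S: "convex S" and psd: "\<And>x. x \<in> S \<Longrightarrow> nonneg_matrix (h x)"
    and z: "z \<in> S" and x: "x \<in> S"
  shows "\<zeta> z + g z \<bullet> (x - z) \<le> \<zeta> x"
proof -
  define d where "d = x - z"
  have inS: "z + s *\<^sub>R d \<in> S" if "0 \<le> s" "s \<le> 1" for s
  proof -
    have "z + s *\<^sub>R d = (1 - s) *\<^sub>R z + s *\<^sub>R x" by (simp add: d_def algebra_simps)
    then show ?thesis using convexD[OF S z x, of "1 - s" s] that by simp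
  qed
  have d1: "((\<lambda>s. \<zeta> (z + s *\<^sub>R d)) has_real_derivative g (z + s *\<^sub>R d) \<bullet> d) (at s)" if "0 \<le> s" "s \<le> 1" for s
  proof -
    have "(\<zeta> has_derivative (\<lambda>v. g (z + s *\<^sub>R d) \<bullet> v)) (at (z + s *\<^sub>R d))"
      using C inS[OF that] by (auto simp: C2_data_def)
    moreover have "((\<lambda>s. z + s *\<^sub>R d) has_derivative (\<lambda>k. k *\<^sub>R d)) (at s)"
      by (auto intro!: derivative_eq_intros)
    ultimately have "((\<lambda>s. \<zeta> (z + s *\<^sub>R d)) has_derivative (\<lambda>k. g (z + s *\<^sub>R d) \<bullet> (k *\<^sub>R d))) (at s)"
      by (rule has_derivative_compose[rotated])
    then show ?thesis by (rule has_derivative_imp_has_field_derivative) simp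
  qed
  have d2: "((\<lambda>s. g (z + s *\<^sub>R d) \<bullet> d) has_real_derivative (h (z + s *\<^sub>R d) *v d) \<bullet> d) (at s)" if "0 \<le> s" "s \<le> 1" for s
  proof -
    have "(g has_derivative (\<lambda>v. h (z + s *\<^sub>R d) *v v)) (at (z + s *\<^sub>R d))"
      using C inS[OF that] by (auto simp: C2_data_def)
    moreover have "((\<lambda>s. z + s *\<^sub>R d) has_derivative (\<lambda>k. k *\<^sub>R d)) (at s)"
      by (auto intro!: derivative_eq_intros)
    ultimately have "((\<lambda>s. g (z + s *\<^sub>R d)) has_derivative (\<lambda>k. h (z + s *\<^sub>R d) *v (k *\<^sub>R d))) (at s)"
      by (rule has_derivative_compose[rotated])
    from has_derivative_inner_left[OF this, of d]
    show ?thesis by (rule has_derivative_imp_has_field_derivative) (simp add: matrix_vector_mult_scaleR)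
  qed
  obtain s where s: "0 < s" "s < 1" "\<zeta> (z + 1 *\<^sub>R d) - \<zeta> (z + 0 *\<^sub>R d) = (1 - 0) * (g (z + s *\<^sub>R d) \<bullet> d)"
    using MVT2[of 0 1 "\<lambda>s. \<zeta> (z + s *\<^sub>R d)" "\<lambda>s. g (z + s *\<^sub>R d) \<bullet> d"] d1 by auto
  obtain t where t: "0 < t" "t < s" "g (z + s *\<^sub>R d) \<bullet> d - g (z + 0 *\<^sub>R d) \<bullet> d = (s - 0) * ((h (z + t *\<^sub>R d) *v d) \<bullet> d)"
    using MVT2[of 0 s "\<lambda>s. g (z + s *\<^sub>R d) \<bullet> d" "\<lambda>t. (h (z + t *\<^sub>R d) *v d) \<bullet> d"] d2 s by auto
  have "0 \<le> (h (z + t *\<^sub>R d) *v d) \<bullet> d"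
    using psd[OF inS[of t]] t s by (simp add: nonneg_matrix_def inner_commute)
  then have "0 \<le> s * ((h (z + t *\<^sub>R d) *v d) \<bullet> d)" using s by simp
  then have "g z \<bullet> d \<le> g (z + s *\<^sub>R d) \<bullet> d" using t by simp
  then show ?thesis using s by (simp add: d_def)
qed

section \<open>The supremum of nonpositive subsolutions\<close>

definition perron_family :: "real \<Rightarrow> real \<Rightarrow> (real^'n \<Rightarrow> real) \<Rightarrow> (real^'n) set \<Rightarrow> (real^'n \<Rightarrow> real) set" where
  "perron_family c p f \<Omega> = {v. viscosity_subsolution c p f \<Omega> v \<and> (\<forall>x\<in>\<Omega>. v x \<le> 0)}"

text \<open>The value 0 off the domain builds in the boundary data; that they are attained
  continuously is the task of the barriers.\<close>

definition perron :: "real \<Rightarrow> real \<Rightarrow> (real^'n \<Rightarrow> real) \<Rightarrow> (real^'n) set \<Rightarrow> real^'n \<Rightarrow> real" where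
  "perron c p f \<Omega> x = (if x \<in> \<Omega> then SUP v\<in>perron_family c p f \<Omega>. v x else 0)"

locale perron_setting =
  fixes c p :: real and f :: "real^'n \<Rightarrow> real" and \<Omega> :: "(real^'n) set"
  assumes O: "open \<Omega>" and cO: "convex \<Omega>" and p: "1 < p" and c: "0 \<le> c"
    and f: "continuous_on \<Omega> f" and f0: "\<And>x. x \<in> \<Omega> \<Longrightarrow> 0 \<le> f x"
    and ne: "perron_family c p f \<Omega> \<noteq> {}"
begin

abbreviation "\<F> \<equiv> perron_family c p f \<Omega>"
abbreviation "u \<equiv> perron c p f \<Omega>"

lemma bdd: "x \<in> \<Omega> \<Longrightarrow> bdd_above ((\<lambda>v. v x) ` \<F>)"
  by (intro bdd_aboveI[of _ 0]) (auto simp: perron_family_def)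

lemma perron_upper: "v \<in> \<F> \<Longrightarrow> x \<in> \<Omega> \<Longrightarrow> v x \<le> u x"
  using cSUP_upper[OF _ bdd, of v x] by (simp add: perron_def)

lemma perron_nonpos: "u x \<le> 0"
  using ne by (auto simp: perron_def perron_family_def intro!: cSUP_least)

lemma perron_approx: "x \<in> \<Omega> \<Longrightarrow> 0 < e \<Longrightarrow> \<exists>v\<in>\<F>. u x - e < v x"
  using less_cSUP_iff[OF ne bdd, of x "u x - e"] by (simp add: perron_def)

lemma perron_convex: "convex_on \<Omega> u"
proof (rule convex_onI[OF _ cO])
  fix t x y assume t: "(0::real) < t" "t < 1" and xy: "x \<in> \<Omega>" "y \<in> \<Omega>"
  have z: "(1 - t) *\<^sub>R x + t *\<^sub>R y \<in> \<Omega>" using convexD[OF cO xy, of "1 - t" t] t by simp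
  have "v ((1 - t) *\<^sub>R x + t *\<^sub>R y) \<le> (1 - t) * u x + t * u y" if v: "v \<in> \<F>" for v
  proof -
    have "convex_on \<Omega> v" using v by (simp add: perron_family_def viscosity_subsolution_def)
    then have "v ((1 - t) *\<^sub>R x + t *\<^sub>R y) \<le> (1 - t) * v x + t * v y"
      using convex_onD[of \<Omega> v t x y] t xy by simp
    also have "\<dots> \<le> (1 - t) * u x + t * u y"
      using perron_upper[OF v] xy t by (intro add_mono mult_left_mono) auto
    finally show ?thesis .
  qed
  then show "u ((1 - t) *\<^sub>R x + t *\<^sub>R y) \<le> (1 - t) * u x + t * u y"
    using z ne by (simp add: perron_def cSUP_least)
qed

text \<open>A member of the family that is nearly optimal at \<open>x0\<close> has a maximum near
  \<open>x0\<close> against the test function steepened by a small multiple of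
  \<open>(norm (x - x0))^2\<close>; continuity carries the inequality there back to
  \<open>x0\<close>.\<close>

lemma perron_subsolution: "viscosity_subsolution c p f \<Omega> u"
  unfolding viscosity_subsolution_def
proof (intro conjI ballI allI impI perron_convex)
  fix x0 \<phi> assume x0: "x0 \<in> \<Omega>" and "C2_on \<Omega> \<phi> \<and> local_max_in \<Omega> (\<lambda>y. u y - \<phi> y) x0"
  then have C: "C2_on \<Omega> \<phi>" and mx: "local_max_in \<Omega> (\<lambda>y. u y - \<phi> y) x0" by auto
  obtain r where r: "0 < r" "ball x0 r \<subseteq> \<Omega>" "\<And>y. y \<in> ball x0 r \<Longrightarrow> u y - \<phi> y \<le> u x0 - \<phi> x0"
    using local_max_in_ball[OF O mx] by metis
  note D = C2_on_imp_C2_data[OF C]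
  have main: "f x0 + c * norm (gradient \<phi> x0) powr p \<le> monge_ampere (hessian \<phi> x0 + \<eta> *\<^sub>R mat 1)" if \<eta>2: "0 < \<eta>" for \<eta>
  proof (rule ccontr)
    define \<eta>' where "\<eta>' = \<eta> / 2"
    have \<eta>: "0 < \<eta>'" using \<eta>2 by (simp add: \<eta>'_def)
    \<comment> \<open>The defect of the steepened test function: its Hessian gains
      \<open>2 * \<eta>' = \<eta>\<close> times the identity, and at \<open>x0\<close> its gradient
      is unchanged.\<close>
    define G where "G x = monge_ampere (hessian \<phi> x + \<eta>' *\<^sub>R (2 *\<^sub>R mat 1)) - f x - c * norm (gradient \<phi> x + \<eta>' *\<^sub>R (2 *\<^sub>R (x - x0))) powr p" for x
    assume "\<not> ?thesis"
    then have G0: "G x0 < 0" by (simp add: G_def \<eta>'_def)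
    have "continuous_on \<Omega> (gradient \<phi>)"
      by (rule C2_data_continuous[OF D])
    then have cn: "continuous_on \<Omega> (\<lambda>x. norm (gradient \<phi> x + \<eta>' *\<^sub>R (2 *\<^sub>R (x - x0))) powr p)"
      using p by (intro continuous_on_powr' continuous_intros) auto
    have ch: "continuous_on \<Omega> (hessian \<phi>)" using D by (simp add: C2_data_def)
    have "continuous_on \<Omega> G" unfolding G_def[abs_def]
      by (intro continuous_on_diff continuous_on_mult continuous_on_const cn f continuous_on_monge_ampere continuous_on_add ch)
    then have "\<forall>\<^sub>F y in at x0 within \<Omega>. G y < 0"
      using x0 G0 by (metis continuous_on_def order_tendstoD(2))
    then obtain d where d: "0 < d" "\<And>y. y \<in> \<Omega> \<Longrightarrow> y \<noteq> x0 \<Longrightarrow> dist y x0 < d \<Longrightarrow> G y < 0"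
      unfolding eventually_at by blast
    define \<rho> where "\<rho> = min d r / 2"
    have \<rho>: "0 < \<rho>" "\<rho> < r" "\<rho> < d" using d r by (auto simp: \<rho>_def)
    \<comment> \<open>The steepening gains exactly this much on the sphere of radius
      \<open>\<rho>\<close>; a better approximation at \<open>x0\<close> forces the maximum into the
      open ball.\<close>
    have "0 < \<eta>' * \<rho>^2" using \<eta> \<rho> by simp
    from perron_approx[OF x0 this] obtain v where v: "v \<in> \<F>" "u x0 - \<eta>' * \<rho>^2 < v x0" by blast
    have vs: "viscosity_subsolution c p f \<Omega> v" using v by (simp add: perron_family_def)
    have vc: "continuous_on \<Omega> v" using vs by (intro convex_on_continuous O) (simp add: viscosity_subsolution_def)
    have \<phi>c: "continuous_on \<Omega> \<phi>"
      by (rule C2_data_continuous[OF D])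
    have cb: "cball x0 \<rho> \<subseteq> ball x0 r" using \<rho> by auto
    define \<phi>' where "\<phi>' x = \<phi> x + \<eta>' * (norm (x - x0))^2" for x
    have "continuous_on (cball x0 \<rho>) (\<lambda>x. v x - \<phi>' x)"
      unfolding \<phi>'_def using cb r(2)
      by (intro continuous_intros continuous_on_subset[OF vc] continuous_on_subset[OF \<phi>c]) auto
    then obtain x1 where x1: "x1 \<in> cball x0 \<rho>" "\<And>x. x \<in> cball x0 \<rho> \<Longrightarrow> v x - \<phi>' x \<le> v x1 - \<phi>' x1"
      using continuous_attains_sup[of "cball x0 \<rho>" "\<lambda>x. v x - \<phi>' x"] \<rho> by auto
    have x1r: "x1 \<in> ball x0 r" using x1 cb by auto
    then have x1O: "x1 \<in> \<Omega>" using r by auto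
    have "v x0 - \<phi> x0 \<le> v x1 - \<phi> x1 - \<eta>' * (norm (x1 - x0))^2" using x1(2)[of x0] \<rho> by (simp add: \<phi>'_def)
    moreover have "v x1 \<le> u x1" by (rule perron_upper[OF v(1) x1O])
    moreover have "u x1 - \<phi> x1 \<le> u x0 - \<phi> x0" by (rule r(3)[OF x1r])
    ultimately have "\<eta>' * (norm (x1 - x0))^2 < \<eta>' * \<rho>^2" using v(2) by linarith
    then have "norm (x1 - x0) < \<rho>" using \<eta> \<rho> by (simp add: power2_less_imp_less)
    then have x1\<rho>: "dist x0 x1 < \<rho>" by (simp add: dist_norm norm_minus_commute)
    have D': "C2_data \<Omega> \<phi>' (\<lambda>x. gradient \<phi> x + \<eta>' *\<^sub>R (2 *\<^sub>R (x - x0))) (\<lambda>x. hessian \<phi> x + \<eta>' *\<^sub>R (2 *\<^sub>R mat 1))"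
      unfolding \<phi>'_def[abs_def] by (intro C2_data_add C2_data_scale C2_data_square D)
    have "local_max_in \<Omega> (\<lambda>y. v y - \<phi>' y) x1"
    proof (rule local_max_inI[OF x1O, of "\<rho> - dist x0 x1"])
      fix y assume "dist x1 y < \<rho> - dist x0 x1"
      then have "y \<in> cball x0 \<rho>" using dist_triangle[of x0 y x1] by auto
      then show "v y - \<phi>' y \<le> v x1 - \<phi>' x1" by (rule x1(2))
    qed (use x1\<rho> in simp)
    then have "f x1 + c * norm (gradient \<phi>' x1) powr p \<le> monge_ampere (hessian \<phi>' x1)"
      using vs x1O C2_data_imp_C2_on[OF D' O] by (auto simp: viscosity_subsolution_def)
    then have "0 \<le> G x1"
      using C2_data_gradient_hessian(1,2)[OF D' O x1O] by (simp add: G_def)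
    moreover have "G x1 < 0" using d(2)[OF x1O] G0 x1\<rho> \<rho> by (cases "x1 = x0") (auto simp: dist_commute)
    ultimately show False by simp
  qed
  then show "f x0 + c * norm (gradient \<phi> x0) powr p \<le> monge_ampere (hessian \<phi> x0)"
    by (rule monge_ampere_perturbation_ge)
qed

text \<open>The glued function is convex because the tangent planes of \<open>\<zeta>\<close> at points where \<open>u < \<zeta>\<close> stay below
  \<open>u\<close> outside the ball: a segment leaving the ball crosses the shell where \<open>\<zeta> < u\<close>.\<close>

lemma perron_bump_subsolution:
  assumes r: "0 < r" and ball: "ball x0 r \<subseteq> \<Omega>" and \<zeta>: "C2_data (ball x0 r) \<zeta> g h"
    and psd: "\<And>x. x \<in> ball x0 r \<Longrightarrow> nonneg_matrix (h x)"
    and ineq: "\<And>x. x \<in> ball x0 r \<Longrightarrow> f x + c * norm (g x) powr p \<le> monge_ampere (h x)"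
    and np: "\<And>x. x \<in> ball x0 r \<Longrightarrow> \<zeta> x \<le> 0"
    and q: "0 < q" "q < r" and outer: "\<And>x. x \<in> ball x0 r \<Longrightarrow> q \<le> dist x0 x \<Longrightarrow> \<zeta> x < u x"
    and x: "x \<in> ball x0 r"
  shows "\<zeta> x \<le> u x"
proof -
  define V where "V x = (if x \<in> ball x0 r then max (u x) (\<zeta> x) else u x)" for x
  have uV: "u x \<le> V x" for x by (simp add: V_def)
  have \<zeta>V: "\<zeta> x \<le> V x" if "x \<in> ball x0 r" for x using that by (simp add: V_def)
  \<comment> \<open>Since \<open>\<zeta> < u\<close> on the shell, \<open>V\<close> differs from
    \<open>u\<close> only at distance less than \<open>q\<close>, so the gluing leaves no trace at
    the sphere of radius \<open>r\<close>.\<close>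
  have Vcases: "V x = u x \<or> (dist x0 x < q \<and> V x = \<zeta> x \<and> u x < \<zeta> x)" for x
    using outer[of x] by (cases "q \<le> dist x0 x") (auto simp: V_def max_def)
  have tangent: "\<zeta> z + g z \<bullet> (x - z) \<le> V x" if z: "dist x0 z < q" "u z < \<zeta> z" and x: "x \<in> \<Omega>" for x z
  proof -
    have zr: "z \<in> ball x0 r" using z q by auto
    define ell where "ell y = \<zeta> z + g z \<bullet> (y - z)" for y
    have conv: "ell y \<le> \<zeta> y" if "y \<in> ball x0 r" for y
      unfolding ell_def by (rule convex_above_tangent[OF \<zeta> _ psd zr that]) auto
    show ?thesis
    proof (cases "x \<in> ball x0 r")
      case True
      then show ?thesis using conv[OF True] \<zeta>V[OF True] by (simp add: ell_def)
    next
      case False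
      \<comment> \<open>For \<open>x\<close> outside the ball, the segment from \<open>z\<close>
        meets the sphere of radius \<open>q\<close>. There the tangent plane is below
        \<open>u\<close>, while at \<open>z\<close> it is above; convexity of \<open>u\<close> keeps
        it below \<open>u\<close> at \<open>x\<close>.\<close>
      define k where "k t = dist x0 (z + t *\<^sub>R (x - z))" for t
      have "\<exists>t\<ge>0. t \<le> 1 \<and> k t = q"
      proof (rule IVT')
        show "k 0 \<le> q" using z by (simp add: k_def)
        show "q \<le> k 1" using False q by (simp add: k_def)
        show "continuous_on {0..1} k" unfolding k_def by (intro continuous_intros)
      qed simp
      then obtain t where t: "0 \<le> t" "t \<le> 1" "k t = q" by blast
      define \<xi> where "\<xi> = z + t *\<^sub>R (x - z)"
      have "t \<noteq> 0" using t z by (auto simp: k_def)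
      then have t0: "0 < t" using t by simp
      have \<xi>q: "dist x0 \<xi> = q" using t by (simp add: k_def \<xi>_def)
      then have \<xi>r: "\<xi> \<in> ball x0 r" using q by simp
      have "\<zeta> \<xi> < u \<xi>" using outer[OF \<xi>r] \<xi>q by simp
      then have 1: "ell \<xi> < u \<xi>" using conv[OF \<xi>r] by linarith
      have \<xi>eq: "\<xi> = (1 - t) *\<^sub>R z + t *\<^sub>R x" by (simp add: \<xi>_def algebra_simps)
      have "u \<xi> \<le> (1 - t) * u z + t * u x"
        unfolding \<xi>eq using zr ball x t by (intro convex_onD[OF perron_convex]) auto
      moreover have "ell \<xi> = (1 - t) * \<zeta> z + t * ell x"
        by (simp add: ell_def \<xi>_def algebra_simps)
      moreover have "(1 - t) * u z \<le> (1 - t) * \<zeta> z" using z t by (intro mult_left_mono) auto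
      ultimately have "t * ell x < t * u x" using 1 by linarith
      then have "ell x < u x" using t0 by simp
      then show ?thesis using uV[of x] by (simp add: ell_def)
    qed
  qed
  have "convex_on \<Omega> V"
  proof (rule convex_onI[OF _ cO])
    fix t x y assume t: "(0::real) < t" "t < 1" and xy: "x \<in> \<Omega>" "y \<in> \<Omega>"
    define z where "z = (1 - t) *\<^sub>R x + t *\<^sub>R y"
    from Vcases[of z] have "V z \<le> (1 - t) * V x + t * V y"
    proof
      assume "V z = u z"
      also have "u z \<le> (1 - t) * u x + t * u y"
        unfolding z_def using t xy by (intro convex_onD[OF perron_convex]) auto
      also have "\<dots> \<le> (1 - t) * V x + t * V y" using t uV by (intro add_mono mult_left_mono) auto
      finally show ?thesis .
    next
      assume z: "dist x0 z < q \<and> V z = \<zeta> z \<and> u z < \<zeta> z"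
      have "(1 - t) * (g z \<bullet> (x - z)) + t * (g z \<bullet> (y - z)) = g z \<bullet> ((1 - t) *\<^sub>R x + t *\<^sub>R y - z)"
        by (simp add: inner_diff_right inner_add_right algebra_simps)
      also have "\<dots> = 0" by (simp only: z_def[symmetric] diff_self inner_zero_right)
      finally have "V z = (1 - t) * (\<zeta> z + g z \<bullet> (x - z)) + t * (\<zeta> z + g z \<bullet> (y - z))"
        using z by (simp add: algebra_simps)
      also have "\<dots> \<le> (1 - t) * V x + t * V y"
        using tangent z xy t by (intro add_mono mult_left_mono) auto
      finally show ?thesis .
    qed
    then show "V ((1 - t) *\<^sub>R x + t *\<^sub>R y) \<le> (1 - t) * V x + t * V y" by (simp add: z_def)
  qed
  moreover have "f x + c * norm (gradient \<phi> x) powr p \<le> monge_ampere (hessian \<phi> x)"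
    if x: "x \<in> \<Omega>" and C: "C2_on \<Omega> \<phi>" and mx: "local_max_in \<Omega> (\<lambda>y. V y - \<phi> y) x" for x \<phi>
    using Vcases[of x]
  proof
    \<comment> \<open>A test function touching \<open>V\<close> from above at such a point also
      touches the smaller function \<open>u\<close>.\<close>
    assume eq: "V x = u x"
    have "u y - \<phi> y \<le> u x - \<phi> x" if "V y - \<phi> y \<le> V x - \<phi> x" for y
      using that uV[of y] eq by linarith
    then have "local_max_in \<Omega> (\<lambda>y. u y - \<phi> y) x"
      using mx unfolding local_max_in_def by (auto elim: eventually_mono)
    then show ?thesis using perron_subsolution x C by (auto simp: viscosity_subsolution_def)
  next
    assume z: "dist x0 x < q \<and> V x = \<zeta> x \<and> u x < \<zeta> x"
    then have xr: "x \<in> ball x0 r" using q by auto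
    show ?thesis
      by (rule touching_from_below_inequality[OF O open_ball xr ball \<zeta> \<zeta>V _ psd[OF xr] ineq[OF xr] C mx])
         (use z in auto)
  qed
  ultimately have "viscosity_subsolution c p f \<Omega> V" by (simp add: viscosity_subsolution_def)
  moreover have "V x \<le> 0" for x using perron_nonpos[of x] np[of x] by (simp add: V_def)
  ultimately have "V \<in> \<F>" by (simp add: perron_family_def)
  then have "V x \<le> u x" using x ball by (intro perron_upper) auto
  then show ?thesis using \<zeta>V[OF x] by simp
qed

lemma matrix_quadratic_bound: "\<exists>K>0. \<forall>A v. \<bar>v \<bullet> ((A::real^'n^'n) *v v)\<bar> \<le> K * norm A * (norm v)^2"
proof -
  have "bilinear ((*v) :: real^'n^'n \<Rightarrow> real^'n \<Rightarrow> real^'n)"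
    unfolding bilinear_def
    by (auto intro!: linearI simp: matrix_vector_mult_add_rdistrib matrix_vector_right_distrib
        matrix_vector_mult_scaleR scaleR_matrix_vector_assoc)
  then have "bounded_bilinear ((*v) :: real^'n^'n \<Rightarrow> real^'n \<Rightarrow> real^'n)"
    by (simp add: bilinear_conv_bounded_bilinear)
  then obtain K where K: "K > 0" "\<And>A v. norm ((A::real^'n^'n) *v v) \<le> norm A * norm v * K"
    using bounded_bilinear.pos_bounded by blast
  have "\<bar>v \<bullet> (A *v v)\<bar> \<le> K * norm A * (norm v)^2" for A :: "real^'n^'n" and v
  proof -
    have "\<bar>v \<bullet> (A *v v)\<bar> \<le> norm v * norm (A *v v)" by (rule Cauchy_Schwarz_ineq2)
    also have "\<dots> \<le> norm v * (norm A * norm v * K)" by (intro mult_left_mono K) auto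
    finally show ?thesis by (simp add: power2_eq_square mult_ac)
  qed
  then show ?thesis using K by blast
qed

text \<open>If the inequality failed at \<open>x0\<close>, then \<open>\<phi>\<close>, lowered by a
  small paraboloid and raised by a constant, would be a convex subsolution near \<open>x0\<close>
  that exceeds \<open>u\<close> at \<open>x0\<close> but not on a shell, against
  \<open>perron_bump_subsolution\<close>. As \<open>f\<close> is nonnegative, failure forces a
  positive determinant, hence a positive definite Hessian that tolerates the lowering.\<close>

lemma perron_supersolution: "viscosity_supersolution c p f \<Omega> u"
  unfolding viscosity_supersolution_def
proof (intro conjI ballI allI impI perron_convex)
  fix x0 \<phi> assume x0: "x0 \<in> \<Omega>"
    and "C2_on \<Omega> \<phi> \<and> local_min_in \<Omega> (\<lambda>y. u y - \<phi> y) x0 \<and> nonneg_matrix (hessian \<phi> x0)"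
  then have C: "C2_on \<Omega> \<phi>" and mn: "local_min_in \<Omega> (\<lambda>y. u y - \<phi> y) x0"
    and psd: "nonneg_matrix (hessian \<phi> x0)" by auto
  obtain r1 where r1: "0 < r1" "ball x0 r1 \<subseteq> \<Omega>" "\<And>y. y \<in> ball x0 r1 \<Longrightarrow> u x0 - \<phi> x0 \<le> u y - \<phi> y"
    using local_min_in_ball[OF O mn] by metis
  note D = C2_on_imp_C2_data[OF C]
  show "monge_ampere (hessian \<phi> x0) \<le> f x0 + c * norm (gradient \<phi> x0) powr p"
  proof (rule ccontr)
    let ?H = "hessian \<phi> x0"
    assume "\<not> ?thesis"
    then have big: "f x0 + c * norm (gradient \<phi> x0) powr p < monge_ampere ?H" by simp
    moreover have "0 \<le> f x0 + c * norm (gradient \<phi> x0) powr p" using f0[OF x0] c by simp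
    ultimately have "0 < monge_ampere ?H" by linarith
    then have "0 < det ?H" by (simp add: monge_ampere_def)
    then have pd: "posdef_matrix ?H" by (rule posdef_if_det_pos[OF psd])
    obtain c0 where c0: "0 < c0" "\<And>v. c0 * (norm v)^2 \<le> v \<bullet> (?H *v v)" using posdef_coercive[OF pd] by blast
    \<comment> \<open>Members of the family must stay nonpositive, so raising needs room below 0. If
      \<open>u x0 = 0\<close>, then \<open>\<phi>\<close> has a local maximum at \<open>x0\<close>,
      against its positive definite Hessian.\<close>
    have ux0: "u x0 < 0"
    proof (rule ccontr)
      assume "\<not> u x0 < 0"
      then have u0: "u x0 = 0" using perron_nonpos[of x0] by simp
      have le: "\<phi> y \<le> \<phi> x0" if "y \<in> ball x0 r1" for y
        using r1(3)[OF that] perron_nonpos[of y] u0 by linarith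
      have "2 * (-1 * \<phi> x0) \<le> -1 * \<phi> (x0 + v) + -1 * \<phi> (x0 - v)" if "norm v < r1" for v
        using le[of "x0 + v"] le[of "x0 - v"] that by (simp add: dist_norm)
      then have "0 \<le> v \<bullet> ((-1 *\<^sub>R ?H) *v v)" for v
        by (rule second_difference_nonneg[OF C2_data_scale[OF D, of "-1"] O x0 r1(1)])
      then have "v \<bullet> (?H *v v) \<le> 0" for v unfolding quadratic_form_scaleR by (simp add: minus_le_iff)
      then show False using c0(2)[of "axis undefined 1"] c0(1)
        by (metis norm_axis_1 mult.right_neutral one_power2 not_le order_trans less_le_trans)
    qed
    obtain K where K: "0 < K" "\<And>A v. \<bar>v \<bullet> ((A::real^'n^'n) *v v)\<bar> \<le> K * norm A * (norm v)^2"
      using matrix_quadratic_bound by blast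
    have gc: "continuous_on \<Omega> (gradient \<phi>)"
      by (rule C2_data_continuous[OF D])
    have hc: "continuous_on \<Omega> (hessian \<phi>)" using D by (simp add: C2_data_def)
    have \<phi>c: "continuous_on \<Omega> \<phi>"
      by (rule C2_data_continuous[OF D])
    let ?T = "UNIV \<times> \<Omega> :: (real \<times> (real^'n)) set"
    define hh where "hh \<gamma> x = hessian \<phi> x - \<gamma> *\<^sub>R (2 *\<^sub>R mat 1)" for \<gamma> x
    define gg where "gg \<gamma> x = gradient \<phi> x - \<gamma> *\<^sub>R (2 *\<^sub>R (x - x0))" for \<gamma> x
    \<comment> \<open>Treating \<open>\<gamma>\<close> and \<open>x\<close> as one variable lets a
      single continuity argument make both small enough.\<close>
    define G where "G q = monge_ampere (hh (fst q) (snd q)) - f (snd q) - c * norm (gg (fst q) (snd q)) powr p" for q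
    have c1: "continuous_on ?T (\<lambda>q. hh (fst q) (snd q))"
      unfolding hh_def by (intro continuous_intros continuous_on_compose2[OF hc continuous_on_snd]) auto
    have c2: "continuous_on ?T (\<lambda>q. gg (fst q) (snd q))"
      unfolding gg_def by (intro continuous_intros continuous_on_compose2[OF gc continuous_on_snd]) auto
    have c3: "continuous_on ?T (\<lambda>q. norm (gg (fst q) (snd q)) powr p)"
      using p by (intro continuous_on_powr' continuous_on_norm c2 continuous_on_const) auto
    have c4: "continuous_on ?T (\<lambda>q. f (snd q))"
      by (intro continuous_on_compose2[OF f continuous_on_snd] continuous_intros) auto
    have "continuous_on ?T G" unfolding G_def[abs_def]
      by (intro continuous_on_diff continuous_on_mult continuous_on_const c3 c4 continuous_on_monge_ampere c1)
    moreover have "(0, x0) \<in> ?T" using x0 by simp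
    moreover have "0 < G (0, x0)" using big by (simp add: G_def hh_def gg_def)
    ultimately have "\<forall>\<^sub>F q in at (0, x0) within ?T. 0 < G q"
      by (metis continuous_on_def order_tendstoD(1))
    then obtain d1 where d1: "0 < d1" "\<And>q. q \<in> ?T \<Longrightarrow> q \<noteq> (0, x0) \<Longrightarrow> dist q (0, x0) < d1 \<Longrightarrow> 0 < G q"
      unfolding eventually_at by blast
    have "0 < c0 / (2 * K)" using c0 K by simp
    then have "\<forall>\<^sub>F x in at x0 within \<Omega>. dist (hessian \<phi> x) ?H < c0 / (2 * K)"
      using hc x0 unfolding continuous_on_def by (blast intro: tendstoD)
    then obtain d2 where d2: "0 < d2" "\<And>x. x \<in> \<Omega> \<Longrightarrow> x \<noteq> x0 \<Longrightarrow> dist x x0 < d2 \<Longrightarrow> dist (hessian \<phi> x) ?H < c0 / (2 * K)"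
      unfolding eventually_at by blast
    have "0 < - u x0 / 2" using ux0 by simp
    then have "\<forall>\<^sub>F x in at x0 within \<Omega>. dist (\<phi> x) (\<phi> x0) < - u x0 / 2"
      using \<phi>c x0 unfolding continuous_on_def by (blast intro: tendstoD)
    then obtain d3 where d3: "0 < d3" "\<And>x. x \<in> \<Omega> \<Longrightarrow> x \<noteq> x0 \<Longrightarrow> dist x x0 < d3 \<Longrightarrow> dist (\<phi> x) (\<phi> x0) < - u x0 / 2"
      unfolding eventually_at by blast
    \<comment> \<open>One half of the coercivity \<open>c0\<close> pays for the Hessian
      \<open>2 * \<gamma>\<close> of the subtracted paraboloid, the other half for the variation of
      \<open>hessian \<phi>\<close> near \<open>x0\<close>.\<close>
    define \<gamma> where "\<gamma> = min (c0 / 4) (d1 / 2)"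
    have \<gamma>: "0 < \<gamma>" "\<gamma> \<le> c0 / 4" "\<gamma> \<le> d1 / 2" using c0 d1 by (auto simp: \<gamma>_def)
    define l where "l = - u x0 / \<gamma>"
    have l: "0 < l" unfolding l_def using ux0 \<gamma> by (intro divide_pos_pos) auto
    define r where "r = min (min r1 (d1 / 2)) (min (min d2 d3) (min 1 l))"
    have r: "0 < r" "r \<le> r1" "r \<le> d1 / 2" "r \<le> d2" "r \<le> d3" "r \<le> 1" "r \<le> l"
      using r1(1) d1(1) d2(1) d3(1) l by (auto simp: r_def)
    have ballO: "ball x0 r \<subseteq> \<Omega>" using r1(2) r(2) by auto
    \<comment> \<open>The raise is positive at the centre, yet on the shell it is less than the
      lowering, at least \<open>\<gamma> * (3 / 4 * r)^2 = 9 / 16 * \<gamma> * r^2\<close>. The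
      bounds \<open>r \<le> 1\<close> and \<open>r \<le> l\<close> keep it at most half of
      \<open>- u x0\<close>.\<close>
    define \<kappa> where "\<kappa> = \<gamma> * r^2 / 2"
    have \<kappa>: "0 < \<kappa>" "\<kappa> \<le> - u x0 / 2"
    proof -
      show "0 < \<kappa>" using \<gamma> r by (simp add: \<kappa>_def)
      have "\<gamma> * r^2 \<le> \<gamma> * r" using r \<gamma> by (intro mult_left_mono) (auto simp: power2_eq_square mult_left_le)
      also have "\<dots> \<le> \<gamma> * l" using r(7) \<gamma> by (intro mult_left_mono) auto
      also have "\<dots> = - u x0" using \<gamma> by (simp add: l_def)
      finally show "\<kappa> \<le> - u x0 / 2" by (simp add: \<kappa>_def)
    qed
    define \<zeta> where "\<zeta> x = \<phi> x - \<gamma> * (norm (x - x0))^2 + (u x0 - \<phi> x0 + \<kappa>)" for x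
    have Z: "C2_data \<Omega> \<zeta> (\<lambda>x. gg \<gamma> x + 0) (\<lambda>x. hh \<gamma> x + 0)"
      unfolding \<zeta>_def[abs_def] gg_def hh_def
      by (intro C2_data_add C2_data_diff C2_data_scale C2_data_square C2_data_const D)
    have "\<zeta> x0 \<le> u x0"
    proof (rule perron_bump_subsolution[OF r(1) ballO C2_data_subset[OF Z ballO], where q="3 / 4 * r"])
      fix x assume x: "x \<in> ball x0 r"
      then have xO: "x \<in> \<Omega>" and dx: "dist x x0 < r" using ballO by (auto simp: dist_commute)
      have low: "\<zeta> x \<le> u x - \<gamma> * (norm (x - x0))^2 + \<kappa>"
        using r1(3)[of x] x r(2) by (simp add: \<zeta>_def)
      show "nonneg_matrix (hh \<gamma> x + 0)"
      proof -
        have "norm (hessian \<phi> x - ?H) \<le> c0 / (2 * K)"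
          using d2(2)[OF xO] dx r(4) c0 K by (cases "x = x0") (auto simp: dist_norm less_imp_le)
        then have kk: "K * norm (hessian \<phi> x - ?H) \<le> c0 / 2" using K by (simp add: field_simps)
        have "0 \<le> v \<bullet> (hh \<gamma> x *v v)" for v
        proof -
          have "v \<bullet> (hh \<gamma> x *v v) = v \<bullet> (?H *v v) + v \<bullet> ((hessian \<phi> x - ?H) *v v) - 2 * \<gamma> * (norm v)^2"
            by (simp add: hh_def matrix_vector_mult_diff_rdistrib scaleR_matrix_vector_assoc[symmetric]
                inner_diff_right power2_norm_eq_inner)
          moreover have "- (c0 / 2 * (norm v)^2) \<le> v \<bullet> ((hessian \<phi> x - ?H) *v v)"
          proof -
            have "\<bar>v \<bullet> ((hessian \<phi> x - ?H) *v v)\<bar> \<le> c0 / 2 * (norm v)^2"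
              by (rule order_trans[OF K(2)]) (intro mult_right_mono kk, simp)
            then show ?thesis by linarith
          qed
          moreover have "2 * \<gamma> * (norm v)^2 \<le> c0 / 2 * (norm v)^2" using \<gamma> by (intro mult_right_mono) auto
          ultimately show ?thesis using c0(2)[of v] by linarith
        qed
        then show ?thesis using hessian_symmetric[OF Z O xO] by (simp add: nonneg_matrix_def)
      qed
      show "f x + c * norm (gg \<gamma> x + 0) powr p \<le> monge_ampere (hh \<gamma> x + 0)"
      proof -
        have "dist (\<gamma>, x) (0, x0) \<le> \<gamma> + dist x x0"
          using \<gamma> sqrt_sum_squares_le_sum[of \<gamma> "dist x x0"] by (simp add: dist_Pair_Pair)
        also have "\<dots> < d1" using \<gamma> dx r by linarith
        finally have "0 < G (\<gamma>, x)" using d1(2)[of "(\<gamma>, x)"] xO \<gamma> by auto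
        then show ?thesis by (simp add: G_def)
      qed
      show "\<zeta> x \<le> 0"
      proof -
        have "\<phi> x - \<phi> x0 \<le> - u x0 / 2"
        proof (cases "x = x0")
          case False
          then have "dist (\<phi> x) (\<phi> x0) < - u x0 / 2" using d3(2)[OF xO] dx r by auto
          then show ?thesis unfolding dist_real_def by linarith
        qed (use ux0 in simp)
        moreover have "0 \<le> \<gamma> * (norm (x - x0))^2" using \<gamma> by simp
        ultimately show ?thesis using \<kappa> unfolding \<zeta>_def by linarith
      qed
      assume "3 / 4 * r \<le> dist x0 x"
      then have "(3 / 4 * r)^2 \<le> (norm (x - x0))^2" using r by (intro power_mono) (auto simp: dist_norm norm_minus_commute)
      then have "\<gamma> * (3 / 4 * r)^2 \<le> \<gamma> * (norm (x - x0))^2" using \<gamma> by (intro mult_left_mono) auto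
      moreover have "\<kappa> < \<gamma> * (3 / 4 * r)^2" using \<gamma> r by (simp add: \<kappa>_def power_mult_distrib power_divide)
      ultimately show "\<zeta> x < u x" using low by linarith
    qed (use r in auto)
    then show False using \<kappa> by (simp add: \<zeta>_def)
  qed
qed

end

section \<open>Barriers and the critical radius\<close>

lemma paraboloid_subsolution:
  assumes O: "open \<Omega>" and cO: "convex \<Omega>" and p: "1 < p" and c: "0 \<le> c" and s: "0 < s"
    and y: "\<And>x. x \<in> \<Omega> \<Longrightarrow> norm (x - y) < R"
    and M: "\<And>x. x \<in> \<Omega> \<Longrightarrow> f x \<le> M" and sM: "M + c * (s * R) powr p \<le> s"
  shows "paraboloid s R y \<in> perron_family c p f \<Omega>"
proof -
  have "f x + c * norm (gradient \<phi> x) powr p \<le> monge_ampere (hessian \<phi> x)"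
    if x: "x \<in> \<Omega>" and C: "C2_on \<Omega> \<phi>" and mx: "local_max_in \<Omega> (\<lambda>z. paraboloid s R y z - \<phi> z) x" for x \<phi>
  proof (rule touching_from_below_inequality[OF O O x order_refl paraboloid_C2_data order_refl refl _ _ C mx])
    show "nonneg_matrix (s *\<^sub>R mat 1 :: real^'a^'a)" using s by (intro nonneg_matrix_scaleR nonneg_matrix_id) simp
    have "norm (s *\<^sub>R (x - y)) powr p \<le> (s * R) powr p"
      using y[OF x] s p by (intro powr_mono2) auto
    then have "c * norm (s *\<^sub>R (x - y)) powr p \<le> c * (s * R) powr p" using c by (rule mult_left_mono)
    then show "f x + c * norm (s *\<^sub>R (x - y)) powr p \<le> monge_ampere (s *\<^sub>R mat 1 :: real^'a^'a)"
      using M[OF x] sM s by (simp add: monge_ampere_scaleR monge_ampere_id)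
  qed
  moreover have "paraboloid s R y x \<le> 0" if "x \<in> \<Omega>" for x
  proof -
    have "(norm (x - y))^2 \<le> R^2" using y[OF that] by (intro power_mono) auto
    then show ?thesis using s by (simp add: paraboloid_def mult_nonneg_nonpos)
  qed
  moreover have "convex_on \<Omega> (paraboloid s R y)" using cO s by (intro convex_on_paraboloid) auto
  ultimately show ?thesis by (simp add: perron_family_def viscosity_subsolution_def)
qed

text \<open>For \<open>M > 0\<close> the slope \<open>s = M p / (p - 1)\<close> satisfies \<open>s - b (s R)\<close> to the power \<open>p\<close> \<open>= M\<close> exactly at the
  critical radius.\<close>

lemma subcritical_slope_exists:
  fixes p b M R :: real
  assumes p: "1 < p" and b: "0 < b" and M: "0 \<le> M" and R: "0 < R"
    and le: "ereal R \<le> critical_radius p b M"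
  shows "\<exists>s>0. M + b * (s * R) powr p \<le> s"
proof (cases "M = 0")
  case True
  \<comment> \<open>With \<open>M = 0\<close> the equation \<open>b * (s * R) powr p = s\<close> is
    solved exactly, for every radius.\<close>
  define s where "s = (1 / (b * R powr p)) powr (1 / (p - 1))"
  have s: "0 < s" using b R by (simp add: s_def)
  have "s powr (p - 1) = 1 / (b * R powr p)" using b R p by (simp add: s_def powr_powr)
  then have "b * R powr p * s powr (p - 1) = 1" using b R by simp
  moreover have "s powr p = s powr (p - 1) * s" using s powr_add[of s "p - 1" 1] by simp
  ultimately have "b * (s * R) powr p = s"
    using s R by (simp add: powr_mult mult_ac)
  then show ?thesis using s True by auto
next
  case False
  then have M: "0 < M" using M by simp
  define Rc where "Rc = (p - 1) powr ((p - 1) / p) / (p * b powr (1 / p) * M powr ((p - 1) / p))"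
  have R': "R \<le> Rc" using le False by (simp add: critical_radius_def Rc_def)
  \<comment> \<open>The maximiser of \<open>s - b * (s * Rc) powr p\<close> over positive slopes.
    This is the origin of the constant in \<open>critical_radius\<close>: for a larger radius the
    maximum falls below \<open>M\<close>.\<close>
  define s where "s = M * p / (p - 1)"
  have s: "0 < s" using M p by (simp add: s_def)
  have "s * Rc = (M / ((p - 1) * b)) powr (1 / p)"
  proof -
    have e: "(p - 1) / p = 1 - 1 / p" using p by (simp add: field_simps)
    have 1: "(p - 1) powr (1 - 1 / p) = (p - 1) / (p - 1) powr (1 / p)" using p by (simp add: powr_diff)
    have 2: "M powr (1 - 1 / p) = M / M powr (1 / p)" using M by (simp add: powr_diff)
    have "s * Rc = M powr (1 / p) / ((p - 1) powr (1 / p) * b powr (1 / p))"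
      unfolding s_def Rc_def e 1 2 using M p b by (simp add: field_simps)
    also have "\<dots> = (M / ((p - 1) * b)) powr (1 / p)"
      using M p b by (simp add: powr_divide powr_mult)
    finally show ?thesis .
  qed
  then have "(s * Rc) powr p = M / ((p - 1) * b)" using M p b by (simp add: powr_powr)
  moreover have "(s * R) powr p \<le> (s * Rc) powr p" using R' R s p by (intro powr_mono2) auto
  ultimately have "b * (s * R) powr p \<le> b * (M / ((p - 1) * b))" using b by (intro mult_left_mono) auto
  also have "\<dots> = s - M" using b p by (simp add: s_def field_simps)
  finally show ?thesis using s by (intro exI[of _ s]) auto
qed

theorem theorem5:
  fixes p b R :: real
    and \<Omega> Y :: "(real ^ 'n) set"
    and f :: "real ^ 'n \<Rightarrow> real"
  assumes "p > 1" and "b > 0"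
    and "open \<Omega>" and "connected \<Omega>" and "\<Omega> \<noteq> {}" and "bounded \<Omega>"
    and "continuous_on \<Omega> f" and "bounded (f ` \<Omega>)" and "\<forall>x\<in>\<Omega>. 0 \<le> f x"
    and "R > 0" and "\<Omega> = (\<Inter>y\<in>Y. ball y R)"
    and "ereal R \<le> critical_radius p b (sup_norm_on \<Omega> f)"
  shows "\<exists>u. dirichlet_solution b p f \<Omega> u \<and>
    (\<forall>v. dirichlet_solution b p f \<Omega> v \<longrightarrow> (\<forall>x\<in>closure \<Omega>. v x = u x))"
proof -
  note p = assms(1) and b = assms(2) and O = assms(3) and bd = assms(6) and f = assms(7)
  define M where "M = sup_norm_on \<Omega> f"
  have bdd: "bdd_above ((\<lambda>x. \<bar>f x\<bar>) ` \<Omega>)"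
    using assms(8) by (auto simp: bounded_iff bdd_above_def)
  have fM: "f x \<le> M" if "x \<in> \<Omega>" for x
    using cSUP_upper[OF that bdd] by (simp add: M_def sup_norm_on_def)
  have M: "0 \<le> M" using assms(5,9) fM by (meson all_not_in_conv order_trans)
  obtain s where s: "0 < s" "M + b * (s * R) powr p \<le> s"
    using subcritical_slope_exists[OF p b M assms(10)] assms(12) unfolding M_def by blast
  have cO: "convex \<Omega>" unfolding assms(11) by (intro convex_INT convex_ball)
  have ball: "norm (x - y) < R" if "y \<in> Y" "x \<in> \<Omega>" for x y
    using that assms(11) by (auto simp: dist_norm norm_minus_commute)
  \<comment> \<open>The intersection of an empty family is the whole space, which is
    unbounded.\<close>
  have "Y \<noteq> {}" using assms(11) bd not_bounded_UNIV by auto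
  then obtain y0 where y0: "y0 \<in> Y" by blast
  have para: "paraboloid s R y \<in> perron_family b p f \<Omega>" if "y \<in> Y" for y
    using b by (intro paraboloid_subsolution[OF O cO p _ s(1) ball[OF that] fM s(2)]) auto
  interpret perron_setting b p f \<Omega>
    using O cO p b f assms(9) para[OF y0] by unfold_locales auto
  have fr: "x \<notin> \<Omega>" "x \<in> closure \<Omega>" if "x \<in> frontier \<Omega>" for x
    using that O by (auto simp: frontier_def interior_open)
  have u0: "u x = 0" if "x \<in> frontier \<Omega>" for x using fr(1)[OF that] by (simp add: perron_def)
  have ple: "paraboloid s R y x \<le> u x" if y: "y \<in> Y" and x: "x \<in> closure \<Omega>" for x y
  proof (cases "x \<in> \<Omega>")
    case True
    then show ?thesis by (intro perron_upper para y)
  next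
    case False
    have "\<Omega> \<subseteq> cball y R" using ball[OF y] by (auto simp: dist_norm norm_minus_commute less_imp_le)
    then have "x \<in> cball y R" using closure_minimal[of \<Omega> "cball y R"] x by auto
    then have "(norm (x - y))^2 \<le> R^2" by (intro power_mono) (auto simp: dist_norm norm_minus_commute)
    then show ?thesis using s False by (simp add: paraboloid_def mult_nonneg_nonpos perron_def)
  qed
  have uc: "continuous_on (closure \<Omega>) u"
    unfolding continuous_on_def
  proof
    fix x assume x: "x \<in> closure \<Omega>"
    show "(u \<longlongrightarrow> u x) (at x within closure \<Omega>)"
    proof (cases "x \<in> \<Omega>")
      case True
      have "continuous_on \<Omega> u" by (rule convex_on_continuous[OF O perron_convex])
      then have "isCont u x" using O True by (simp add: continuous_on_eq_continuous_at)
      then show ?thesis unfolding isCont_def by (rule Lim_at_imp_Lim_at_within)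
    next
      case False
      \<comment> \<open>A point of the closure outside the domain is missed by one of the balls. The
        paraboloid of that ball vanishes there and squeezes \<open>u\<close> against 0, so each
        boundary point has a barrier with its own centre.\<close>
      then obtain y where y: "y \<in> Y" "R \<le> norm (x - y)"
        using assms(11) by (auto simp: dist_norm norm_minus_commute not_less)
      have ux: "u x = 0" using False by (simp add: perron_def)
      have "0 \<le> paraboloid s R y x" using y s assms(10) by (simp add: paraboloid_def power_mono)
      then have px: "paraboloid s R y x = 0" using ple[OF y(1) x] ux by simp
      have "continuous_on UNIV (paraboloid s R y)" unfolding paraboloid_def by (intro continuous_intros)
      then have "(paraboloid s R y \<longlongrightarrow> 0) (at x within closure \<Omega>)"
        using px by (metis UNIV_I continuous_on_def tendsto_within_subset top_greatest)
      then show ?thesis unfolding ux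
      proof (rule tendsto_sandwich[rotated 2])
        show "\<forall>\<^sub>F z in at x within closure \<Omega>. paraboloid s R y z \<le> u z"
          using ple[OF y(1)] by (simp add: eventually_at_filter)
        show "\<forall>\<^sub>F z in at x within closure \<Omega>. u z \<le> 0" by (simp add: perron_nonpos)
      qed simp
    qed
  qed
  have sol: "dirichlet_solution b p f \<Omega> u"
    using uc perron_subsolution perron_supersolution u0 by (simp add: dirichlet_solution_def)
  \<comment> \<open>Comparison uses one fixed centre \<open>y0\<close>, in contrast to the barriers;
    applied in both orders it gives uniqueness.\<close>
  have le: "v x \<le> w x"
    if "dirichlet_solution b p f \<Omega> v" "dirichlet_solution b p f \<Omega> w" "x \<in> closure \<Omega>" for v w x
  proof (cases "x \<in> \<Omega>")
    case True
    show ?thesis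
      by (rule comparison_principle[OF O cO bd p b s(1) ball[OF y0] assms(10) fM s(2) f _ _ _ _ _ _ True])
         (use that in \<open>auto simp: dirichlet_solution_def\<close>)
  next
    case False
    then have "x \<in> frontier \<Omega>" using that(3) O by (simp add: frontier_def interior_open)
    then show ?thesis using that by (simp add: dirichlet_solution_def)
  qed
  show ?thesis using sol le by (intro exI[of _ u]) (auto intro: antisym)
qed

end
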